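(* Let $(\eta,u,v,P)$ be a periodic steady gravity water wave (as defined in the context), i.e. a solution of the steady water wave problem with $\eta\in C^2_{\rm per}(\mathbb{R})$, $u,v,P\in C^1_{\rm per}(\overline{\Omega}_\eta)$ and $u<c$ in $\overline{\Omega}_\eta$. Assume that the free surface is non-flat, i.e. $\eta$ is not constant. Assume moreover that there is some $p_1\in(p_0,0)$ such that the vorticity function $\gamma:[p_0,0]\to\mathbb{R}$ of the flow is Lipschitz continuous on $[p_1,0]$. Then the following are equivalent: (i) the wave profile $\eta$ is symmetric and has only one crest and one trough per period; (ii) there exists a vertical line $x=x_0$ such that all the fluid particles located on that line (within the fluid domain) minimize there their distance to the fluid bed $y=-d$.
   Context: Physical setting. Fix constants: gravitational acceleration $g>0$, wave speed $c$, atmospheric pressure $P_0$, and mean depth $d>0$. In a frame moving with the wave, a periodic steady gravity water wave consists of a free surface profile $\eta:\mathbb{R}\to(-d,\infty)$ with zero integral mean over a period, the fluid domain $\Omega_\eta=\{(x,y): x\in\mathbb{R},\ -d<y<\eta(x)\}$, and a velocity field $(u,v)$ and a pressure $P$ on $\overline{\Omega}_\eta$ satisfying $$(u-c)u_x+vu_y=-P_x,\qquad (u-c)v_x+vv_y=-P_y-g,\qquad u_x+v_y=0\quad\text{in }\Omega_\eta,$$ $$P=P_0\ \text{ and }\ v=(u-c)\eta'\ \text{ on } y=\eta(x),\qquad v=0\ \text{ on } y=-d,$$ together with the no-stagnation condition $u<c$ in $\overline{\Omega}_\eta$. The functions $\eta,u,v,P$ are periodic in $x$ with the same period, and have regularity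 $\eta\in C^2_{\rm per}(\mathbb{R})$, $u,v,P\in C^1_{\rm per}(\overline{\Omega}_\eta)$, where the subscript "per" denotes periodicity in $x$. Stream function and vorticity function. The stream function $\psi\in C^2_{\rm per}(\overline{\Omega}_\eta)$ is defined by $\nabla\psi=(-v,u-c)$ in $\overline{\Omega}_\eta$ and $\psi=0$ on $y=\eta(x)$. It is constant on $y=-d$; writing this constant as $-p_0$ defines the relative mass flux $p_0<0$. Since $\psi_y=u-c<0$, there is a function $\gamma\in C([p_0,0])$, the vorticity function, such that the vorticity $\omega:=u_y-v_x$ satisfies $\omega(x,y)=\gamma(-\psi(x,y))$ for all $(x,y)\in\overline{\Omega}_\eta$. Particle paths. The particle paths in the moving frame are the solutions of $x'=u(x,y)-c$, $y'=v(x,y)$; they coincide with the streamlines (the level curves of $\psi$), which are graphs over the $x$-axis of periodic $C^2$ functions and foliate $\overline{\Omega}_\eta$. That all the fluid particles located on the line $x=x_0$ minimize there their distance to the fluid bed means: for every $y_0\in[-d,\eta(x_0)]$, the height $y$ along the particle path through $(x_0,y_0)$ attains its global minimum at $(x_0,y_0)$. Equivalently, the function whose graph is the streamline through $(x_0,y_0)$ attains its global minimum at $x=x_0$. Symmetric profiles. A crest (trough) is a local maximum (minimum) of $\eta$, and the crest line (trough line) is the vertical line through it. "Symmetric with only one crest and one trough per period" means that within each minimal period $\eta$ has exactly one crest and one trough, is symmetric with respect to the crest lines and to the trough lines, and is strictly monotone between consecutive crests and troughs. *)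

theory Defs
  imports "HOL-Analysis.Analysis"
begin

definition partial_x :: "(real \<times> real \<Rightarrow> real) \<Rightarrow> real \<times> real \<Rightarrow> real" where
  "partial_x f z = deriv (\<lambda>s. f (s, snd z)) (fst z)"

definition partial_y :: "(real \<times> real \<Rightarrow> real) \<Rightarrow> real \<times> real \<Rightarrow> real" where
  "partial_y f z = deriv (\<lambda>s. f (fst z, s)) (snd z)"

text \<open>Boundary values of a function that is given on \<open>\<Omega>\<close> only; meaningful when the function has a
  continuous extension to \<open>closure \<Omega>\<close>.\<close>

definition boundary_ext :: "(real \<times> real) set \<Rightarrow> (real \<times> real \<Rightarrow> real) \<Rightarrow> real \<times> real \<Rightarrow> real" where
  "boundary_ext \<Omega> h z = (if z \<in> \<Omega> then h z else Lim (at z within \<Omega>) h)"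

text \<open>The class \<open>C\<^sup>1\<close> of the closed domain: continuously differentiable inside, with the function and
  its first partial derivatives extending continuously to the boundary.\<close>

definition C1_closure :: "(real \<times> real) set \<Rightarrow> (real \<times> real \<Rightarrow> real) \<Rightarrow> bool" where
  "C1_closure \<Omega> f \<longleftrightarrow>
     continuous_on (closure \<Omega>) f \<and>
     (\<forall>z\<in>\<Omega>. f differentiable (at z)) \<and>
     (\<exists>F. continuous_on (closure \<Omega>) F \<and> (\<forall>z\<in>\<Omega>. F z = partial_x f z)) \<and>
     (\<exists>F. continuous_on (closure \<Omega>) F \<and> (\<forall>z\<in>\<Omega>. F z = partial_y f z))"

definition C2_closure :: "(real \<times> real) set \<Rightarrow> (real \<times> real \<Rightarrow> real) \<Rightarrow> bool" where
  "C2_closure \<Omega> f \<longleftrightarrow>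
     C1_closure \<Omega> f \<and>
     C1_closure \<Omega> (boundary_ext \<Omega> (partial_x f)) \<and>
     C1_closure \<Omega> (boundary_ext \<Omega> (partial_y f))"

definition periodic_x_on :: "real \<Rightarrow> (real \<times> real) set \<Rightarrow> (real \<times> real \<Rightarrow> real) \<Rightarrow> bool" where
  "periodic_x_on L S f \<longleftrightarrow> (\<forall>(x, y)\<in>S. f (x + L, y) = f (x, y))"

definition fluid_domain :: "real \<Rightarrow> (real \<Rightarrow> real) \<Rightarrow> (real \<times> real) set" where
  "fluid_domain d \<eta> = {(x, y). - d < y \<and> y < \<eta> x}"

text \<open>\<open>L\<close> is some common period of \<open>\<eta>, u, v, P\<close>, not necessarily the minimal one.\<close>

definition steady_water_wave ::
  "real \<Rightarrow> real \<Rightarrow> real \<Rightarrow> real \<Rightarrow> real \<Rightarrow> (real \<Rightarrow> real) \<Rightarrow> (real \<times> real \<Rightarrow> real) \<Rightarrow>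
   (real \<times> real \<Rightarrow> real) \<Rightarrow> (real \<times> real \<Rightarrow> real) \<Rightarrow> bool" where
  "steady_water_wave g c P0 d L \<eta> u v P \<longleftrightarrow>
     (let \<Omega> = fluid_domain d \<eta> in
      L > 0 \<and>
      (\<forall>x. \<eta> x > - d) \<and>
      \<eta> C1_differentiable_on UNIV \<and> deriv \<eta> C1_differentiable_on UNIV \<and>
      (\<forall>x. \<eta> (x + L) = \<eta> x) \<and> integral {0..L} \<eta> = 0 \<and>
      C1_closure \<Omega> u \<and> C1_closure \<Omega> v \<and> C1_closure \<Omega> P \<and>
      periodic_x_on L (closure \<Omega>) u \<and> periodic_x_on L (closure \<Omega>) v \<and>
      periodic_x_on L (closure \<Omega>) P \<and>
      (\<forall>z\<in>\<Omega>. (u z - c) * partial_x u z + v z * partial_y u z = - partial_x P z) \<and>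
      (\<forall>z\<in>\<Omega>. (u z - c) * partial_x v z + v z * partial_y v z = - partial_y P z - g) \<and>
      (\<forall>z\<in>\<Omega>. partial_x u z + partial_y v z = 0) \<and>
      (\<forall>x. P (x, \<eta> x) = P0) \<and>
      (\<forall>x. v (x, \<eta> x) = (u (x, \<eta> x) - c) * deriv \<eta> x) \<and>
      (\<forall>x. v (x, - d) = 0) \<and>
      (\<forall>z\<in>closure \<Omega>. u z < c))"

definition is_stream_function ::
  "real \<Rightarrow> real \<Rightarrow> real \<Rightarrow> (real \<Rightarrow> real) \<Rightarrow> (real \<times> real \<Rightarrow> real) \<Rightarrow> (real \<times> real \<Rightarrow> real) \<Rightarrow>
   (real \<times> real \<Rightarrow> real) \<Rightarrow> bool" where
  "is_stream_function c d L \<eta> u v \<psi> \<longleftrightarrow>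
     (let \<Omega> = fluid_domain d \<eta> in
      C2_closure \<Omega> \<psi> \<and> periodic_x_on L (closure \<Omega>) \<psi> \<and>
      (\<forall>z\<in>closure \<Omega>. boundary_ext \<Omega> (partial_x \<psi>) z = - v z \<and>
                     boundary_ext \<Omega> (partial_y \<psi>) z = u z - c) \<and>
      (\<forall>x. \<psi> (x, \<eta> x) = 0))"

definition is_relative_mass_flux :: "real \<Rightarrow> (real \<times> real \<Rightarrow> real) \<Rightarrow> real \<Rightarrow> bool" where
  "is_relative_mass_flux d \<psi> p0 \<longleftrightarrow> (\<forall>x. \<psi> (x, - d) = - p0)"

definition vorticity ::
  "(real \<times> real) set \<Rightarrow> (real \<times> real \<Rightarrow> real) \<Rightarrow> (real \<times> real \<Rightarrow> real) \<Rightarrow> real \<times> real \<Rightarrow> real" where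
  "vorticity \<Omega> u v = boundary_ext \<Omega> (\<lambda>z. partial_y u z - partial_x v z)"

definition is_vorticity_function ::
  "real \<Rightarrow> (real \<Rightarrow> real) \<Rightarrow> (real \<times> real \<Rightarrow> real) \<Rightarrow> (real \<times> real \<Rightarrow> real) \<Rightarrow>
   (real \<times> real \<Rightarrow> real) \<Rightarrow> real \<Rightarrow> (real \<Rightarrow> real) \<Rightarrow> bool" where
  "is_vorticity_function d \<eta> u v \<psi> p0 \<gamma> \<longleftrightarrow>
     continuous_on {p0..0} \<gamma> \<and>
     (\<forall>z\<in>closure (fluid_domain d \<eta>). vorticity (fluid_domain d \<eta>) u v z = \<gamma> (- \<psi> z))"

text \<open>Particle paths are complete: the velocity is bounded and the top and bottom boundaries are
  themselves streamlines. Hence it is enough to consider solutions defined for all times.\<close>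

definition particle_path ::
  "real \<Rightarrow> real \<Rightarrow> (real \<Rightarrow> real) \<Rightarrow> (real \<times> real \<Rightarrow> real) \<Rightarrow> (real \<times> real \<Rightarrow> real) \<Rightarrow>
   (real \<Rightarrow> real) \<Rightarrow> (real \<Rightarrow> real) \<Rightarrow> bool" where
  "particle_path c d \<eta> u v X Y \<longleftrightarrow>
     (\<forall>t. (X t, Y t) \<in> closure (fluid_domain d \<eta>) \<and>
          (X has_real_derivative u (X t, Y t) - c) (at t) \<and>
          (Y has_real_derivative v (X t, Y t)) (at t))"

definition particles_lowest_on_line ::
  "real \<Rightarrow> real \<Rightarrow> (real \<Rightarrow> real) \<Rightarrow> (real \<times> real \<Rightarrow> real) \<Rightarrow> (real \<times> real \<Rightarrow> real) \<Rightarrow>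
   real \<Rightarrow> bool" where
  "particles_lowest_on_line c d \<eta> u v x0 \<longleftrightarrow>
     (\<forall>y0\<in>{- d..\<eta> x0}. \<forall>X Y. particle_path c d \<eta> u v X Y \<and> X 0 = x0 \<and> Y 0 = y0 \<longrightarrow>
        (\<forall>t. y0 \<le> Y t))"

definition is_crest :: "(real \<Rightarrow> real) \<Rightarrow> real \<Rightarrow> bool" where
  "is_crest \<eta> a \<longleftrightarrow> (\<forall>\<^sub>F x in nhds a. \<eta> x \<le> \<eta> a)"

definition is_trough :: "(real \<Rightarrow> real) \<Rightarrow> real \<Rightarrow> bool" where
  "is_trough \<eta> a \<longleftrightarrow> (\<forall>\<^sub>F x in nhds a. \<eta> a \<le> \<eta> x)"

definition is_minimal_period :: "(real \<Rightarrow> real) \<Rightarrow> real \<Rightarrow> bool" where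
  "is_minimal_period f T \<longleftrightarrow>
     T > 0 \<and> (\<forall>x. f (x + T) = f x) \<and>
     (\<forall>T'. T' > 0 \<and> (\<forall>x. f (x + T') = f x) \<longrightarrow> T \<le> T')"

definition symmetric_about :: "(real \<Rightarrow> real) \<Rightarrow> real \<Rightarrow> bool" where
  "symmetric_about f a \<longleftrightarrow> (\<forall>s. f (a + s) = f (a - s))"

definition symmetric_single_crest :: "(real \<Rightarrow> real) \<Rightarrow> bool" where
  "symmetric_single_crest \<eta> \<longleftrightarrow>
     (\<exists>T. is_minimal_period \<eta> T \<and>
        (\<forall>a. (\<exists>!x. x \<in> {a..<a + T} \<and> is_crest \<eta> x) \<and>
             (\<exists>!x. x \<in> {a..<a + T} \<and> is_trough \<eta> x))) \<and>
     (\<forall>a. is_crest \<eta> a \<or> is_trough \<eta> a \<longrightarrow> symmetric_about \<eta> a) \<and>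
     (\<forall>a b. a < b \<and> (\<forall>x\<in>{a<..<b}. \<not> is_crest \<eta> x \<and> \<not> is_trough \<eta> x) \<longrightarrow>
        (is_crest \<eta> a \<and> is_trough \<eta> b \<longrightarrow> strict_antimono_on {a..b} \<eta>) \<and>
        (is_trough \<eta> a \<and> is_crest \<eta> b \<longrightarrow> strict_mono_on {a..b} \<eta>))"

end

theory Submission
  imports Defs
begin

text \<open>Write the flow in the hodograph variables \<open>q = x\<close>, \<open>p = - \<psi>\<close>; the height \<open>h(q, p)\<close> of the
  streamlines then satisfies a quasilinear elliptic equation \<open>(1 + h\<^sub>q\<^sup>2) h\<^sub>p\<^sub>p - 2 h\<^sub>q h\<^sub>p h\<^sub>q\<^sub>p + h\<^sub>p\<^sup>2 h\<^sub>q\<^sub>q = \<gamma>(p) h\<^sub>p\<^sup>3\<close>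
  in a fixed strip, with the Bernoulli condition on the top. It has no zero-order term, so that
  differences of solutions obey maximum principles although \<open>\<gamma>\<close> is merely continuous.

  If \<open>\<eta>\<close> is symmetric and monotone between a trough and the next crest, then comparing \<open>h\<close> with its
  reflections in vertical lines shows that every streamline is lowest on the trough line.

  Conversely, start from a line on which all streamlines are lowest and move the reflecting line to the
  right. The hypothesis is exactly what keeps the difference of \<open>h\<close> and its reflection nonnegative on the
  far side, and a maximum principle near the boundary of the rectangle (Berestycki--Nirenberg) lets
  the plane advance without boundary point lemmas at corners. By periodicity the plane stops at a line
  on which \<open>h\<^sub>q = 0\<close>. On such a line \<open>\<psi>\<close> and its reflection have equal Cauchy data; as \<open>\<gamma>\<close> is Lipschitz
  near the surface, unique continuation (a Carleman estimate in polar coordinates) makes the surface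
  symmetric about it. The starting line is of the same kind.\<close>

section \<open>Maximum principles\<close>

text \<open>Linearising the Bernoulli condition bounds the normal derivative on the top by the
  difference of two heights and its tangential derivative. Gravity enters through the difference
  itself, with the sign that spoils a maximum principle. Hence a full rectangle can be compared only
  if the top values are already ordered, as in the first implication, or if the sign is known away
  from a thin boundary layer, as in the second. Unique continuation is carried out in the physical
  plane. There the stream function solves a semilinear equation with the plain Laplacian, so its
  difference \<open>W\<close> with the mirror image satisfies |Laplacian of \<open>W\<close>| \<le>
  \<open>C\<close> |\<open>W\<close>|, where \<open>C\<close> is a Lipschitz constant of \<gamma>. A
  Carleman estimate for the Laplacian with a bounded potential then suffices, instead of one with
  variable leading coefficients. The price is that the fluid domain and its mirror image need not
  coincide beforehand. Agreement is therefore tracked in the strip, whose upper part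
  \<open>p1 < p < 0\<close> is connected and invariant under the reflection, and balls are
  transported back and forth.\<close>

definition hess_on ::
  "(real \<times> real) set \<Rightarrow> (real \<times> real \<Rightarrow> real) \<Rightarrow> (real \<times> real \<Rightarrow> real) \<Rightarrow> (real \<times> real \<Rightarrow> real) \<Rightarrow>
   (real \<times> real \<Rightarrow> real) \<Rightarrow> (real \<times> real \<Rightarrow> real) \<Rightarrow> (real \<times> real \<Rightarrow> real) \<Rightarrow> bool" where
  "hess_on S f fq fp fqq fqp fpp \<longleftrightarrow>
     (\<forall>z\<in>S. (f has_derivative (\<lambda>h. fq z * fst h + fp z * snd h)) (at z) \<and>
            (fq has_derivative (\<lambda>h. fqq z * fst h + fqp z * snd h)) (at z) \<and>
            (fp has_derivative (\<lambda>h. fqp z * fst h + fpp z * snd h)) (at z))"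

section \<open>Functions with prescribed gradient and Hessian\<close>

lemma hess_on_subset:
  "hess_on S f fq fp fqq fqp fpp \<Longrightarrow> T \<subseteq> S \<Longrightarrow> hess_on T f fq fp fqq fqp fpp"
  unfolding hess_on_def by blast

lemma hess_on_continuous:
  assumes "hess_on S f fq fp fqq fqp fpp"
  shows "continuous_on S f" "continuous_on S fq" "continuous_on S fp"
  using assms unfolding hess_on_def
  by (meson has_derivative_continuous continuous_at_imp_continuous_on)+

lemma hess_on_diff:
  assumes "hess_on S f fq fp fqq fqp fpp" "hess_on S g gq gp gqq gqp gpp"
  shows "hess_on S (\<lambda>z. f z - g z) (\<lambda>z. fq z - gq z) (\<lambda>z. fp z - gp z)
           (\<lambda>z. fqq z - gqq z) (\<lambda>z. fqp z - gqp z) (\<lambda>z. fpp z - gpp z)"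
proof -
  have *: "(\<lambda>h. (x - y) * fst h + (x' - y') * snd h) =
    (\<lambda>h::real\<times>real. (x * fst h + x' * snd h) - (y * fst h + y' * snd h))" for x y x' y' :: real
    by (auto simp: algebra_simps)
  show ?thesis
    using assms unfolding hess_on_def * by (auto intro!: has_derivative_diff)
qed

lemma hess_on_line:
  assumes "hess_on S f fq fp fqq fqp fpp" "z + s *\<^sub>R e \<in> S"
  shows "((\<lambda>s. f (z + s *\<^sub>R e)) has_real_derivative
            fq (z + s *\<^sub>R e) * fst e + fp (z + s *\<^sub>R e) * snd e) (at s)"
    and "((\<lambda>s. fq (z + s *\<^sub>R e) * fst e + fp (z + s *\<^sub>R e) * snd e) has_real_derivative
            fqq (z + s *\<^sub>R e) * (fst e)\<^sup>2 + 2 * fqp (z + s *\<^sub>R e) * fst e * snd e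
            + fpp (z + s *\<^sub>R e) * (snd e)\<^sup>2) (at s)"
proof -
  have l: "((\<lambda>s. z + s *\<^sub>R e) has_derivative (\<lambda>s. s *\<^sub>R e)) (at s)"
    by (auto intro!: derivative_eq_intros)
  have c: "((\<lambda>s. k (z + s *\<^sub>R e)) has_real_derivative k' * fst e + k'' * snd e) (at s)"
    if "(k has_derivative (\<lambda>h. k' * fst h + k'' * snd h)) (at (z + s *\<^sub>R e))" for k k' k''
    using has_derivative_compose[OF l that] unfolding has_field_derivative_def
    by (rule has_derivative_eq_rhs) (auto simp: fun_eq_iff algebra_simps)
  note h = assms[unfolded hess_on_def]
  show "((\<lambda>s. f (z + s *\<^sub>R e)) has_real_derivative
            fq (z + s *\<^sub>R e) * fst e + fp (z + s *\<^sub>R e) * snd e) (at s)"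
    using h by (intro c) auto
  have 1: "((\<lambda>s. fq (z + s *\<^sub>R e)) has_real_derivative
       fqq (z + s *\<^sub>R e) * fst e + fqp (z + s *\<^sub>R e) * snd e) (at s)"
    and 2: "((\<lambda>s. fp (z + s *\<^sub>R e)) has_real_derivative
       fqp (z + s *\<^sub>R e) * fst e + fpp (z + s *\<^sub>R e) * snd e) (at s)"
    using h by (intro c; auto)+
  show "((\<lambda>s. fq (z + s *\<^sub>R e) * fst e + fp (z + s *\<^sub>R e) * snd e) has_real_derivative
            fqq (z + s *\<^sub>R e) * (fst e)\<^sup>2 + 2 * fqp (z + s *\<^sub>R e) * fst e * snd e
            + fpp (z + s *\<^sub>R e) * (snd e)\<^sup>2) (at s)"
    by (rule DERIV_cong[OF DERIV_add[OF DERIV_cmult_right[OF 1] DERIV_cmult_right[OF 2]]])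
      (simp add: power2_eq_square algebra_simps)
qed

text \<open>If \<open>k\<close> were negative, \<open>g'\<close> would be negative just to the right
  of its zero at \<open>0\<close>, and \<open>g\<close> would fall below its minimum. Only the
  derivative of \<open>g'\<close> at the single point \<open>0\<close> enters, which matches
  \<open>hess_on\<close>, where second derivatives exist pointwise.\<close>

lemma local_min_second_derivative:
  fixes g g' :: "real \<Rightarrow> real"
  assumes "\<epsilon> > 0" and min: "\<And>s. \<bar>s\<bar> < \<epsilon> \<Longrightarrow> g 0 \<le> g s"
    and g': "\<And>s. \<bar>s\<bar> < \<epsilon> \<Longrightarrow> (g has_real_derivative g' s) (at s)"
    and g'': "(g' has_real_derivative k) (at 0)"
  shows "g' 0 = 0" "0 \<le> k"
proof -
  show 0: "g' 0 = 0"
    using g'[of 0] assms(1) by (intro DERIV_local_min[of g "g' 0" 0 \<epsilon>]) (auto intro!: min)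
  show "0 \<le> k"
  proof (rule ccontr)
    assume "\<not> 0 \<le> k"
    then obtain d where d: "d > 0" "\<And>h. 0 < h \<Longrightarrow> h < d \<Longrightarrow> g' h < g' 0"
      using DERIV_neg_dec_right[OF g''] by auto
    define s where "s = min d \<epsilon> / 2"
    have s: "0 < s" "s < d" "s < \<epsilon>" using d(1) \<open>\<epsilon> > 0\<close> by (auto simp: s_def min_def)
    have "\<exists>y<0. DERIV g x :> y" if "0 < x" "x < s" for x
      using that s d(2)[of x] g'[of x] 0 by (intro exI[of _ "g' x"]) auto
    moreover have "continuous_on {0..s} g"
      using s g' by (intro DERIV_continuous_on[of _ _ g']) (auto intro: has_field_derivative_at_within)
    ultimately have "g s < g 0"
      by (intro DERIV_neg_imp_decreasing_open[OF s(1)]) auto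
    with min[of s] s show False by auto
  qed
qed

text \<open>The operator is the sum of two pure second derivatives, along \<open>(0, 1)\<close> and
  along \<open>(B, - A)\<close>. Restricting \<open>w - b\<close> to these lines reduces the claim
  to the second derivative test in one variable, whatever the numbers \<open>A\<close> and
  \<open>B\<close> are.\<close>

lemma touching:
  assumes "open N" "z \<in> N"
    and w: "hess_on N w wq wp wqq wqp wpp"
    and b: "hess_on N b bq bp bqq bqp bpp"
    and le: "\<forall>y\<in>N. b y \<le> w y" and eq: "b z = w z"
  shows "wq z = bq z" "wp z = bp z"
    and "bpp z + (B\<^sup>2 * bqq z - 2 * A * B * bqp z + A\<^sup>2 * bpp z)
       \<le> wpp z + (B\<^sup>2 * wqq z - 2 * A * B * wqp z + A\<^sup>2 * wpp z)"
proof -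
  note D = hess_on_diff[OF w b]
  have dir: "(wq z - bq z) * fst e + (wp z - bp z) * snd e = 0 \<and>
     0 \<le> (wqq z - bqq z) * (fst e)\<^sup>2 + 2 * (wqp z - bqp z) * fst e * snd e
         + (wpp z - bpp z) * (snd e)\<^sup>2" for e
  proof -
    have "open ((\<lambda>s. z + s *\<^sub>R e) -` N)"
      using assms(1) by (intro open_vimage) (auto intro!: continuous_intros)
    moreover have "0 \<in> (\<lambda>s. z + s *\<^sub>R e) -` N" using assms(2) by simp
    ultimately obtain \<epsilon> where \<epsilon>: "\<epsilon> > 0" "ball 0 \<epsilon> \<subseteq> (\<lambda>s. z + s *\<^sub>R e) -` N"
      using openE by blast
    have i: "z + s *\<^sub>R e \<in> N" if "\<bar>s\<bar> < \<epsilon>" for s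
      using \<epsilon>(2) that by (auto simp: dist_real_def)
    show ?thesis
      using local_min_second_derivative[OF \<epsilon>(1) _ hess_on_line(1)[OF D i]
          hess_on_line(2)[OF D i[of 0]]] le i eq \<epsilon>(1)
      by simp
  qed
  show "wq z = bq z" "wp z = bp z" using dir[of "(1,0)"] dir[of "(0,1)"] by auto
  show "bpp z + (B\<^sup>2 * bqq z - 2 * A * B * bqp z + A\<^sup>2 * bpp z)
       \<le> wpp z + (B\<^sup>2 * wqq z - 2 * A * B * wqp z + A\<^sup>2 * wpp z)"
    using dir[of "(0,1)"] dir[of "(B,-A)"] by (simp add: algebra_simps power2_eq_square)
qed

text \<open>The principal part is the square of the p-derivative plus the square of the derivative
  along \<open>(B, - A)\<close>. Its coefficients merely exist at each point, within bounds, and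
  first-order terms are swept into the right-hand side. One predicate thus covers a whole class of
  linear equations.\<close>

definition elliptic_at ::
  "real \<Rightarrow> real \<Rightarrow> real \<Rightarrow> (real \<times> real \<Rightarrow> real) \<Rightarrow> (real \<times> real \<Rightarrow> real) \<Rightarrow>
   (real \<times> real \<Rightarrow> real) \<Rightarrow> (real \<times> real \<Rightarrow> real) \<Rightarrow> (real \<times> real \<Rightarrow> real) \<Rightarrow> real \<times> real \<Rightarrow> bool" where
  "elliptic_at m M K wq wp wqq wqp wpp z \<longleftrightarrow>
     (\<exists>A B. \<bar>A\<bar> \<le> M \<and> m \<le> B \<and> B \<le> M \<and>
        \<bar>wpp z + (B\<^sup>2 * wqq z - 2 * A * B * wqp z + A\<^sup>2 * wpp z)\<bar> \<le> K * (\<bar>wq z\<bar> + \<bar>wp z\<bar>))"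

text \<open>Quantified over all admissible \<open>A\<close> and \<open>B\<close>, because a barrier
  is built before the touching point, and hence the coefficients there, are known.\<close>

definition strict_sub_at ::
  "real \<Rightarrow> real \<Rightarrow> real \<Rightarrow> (real \<times> real \<Rightarrow> real) \<Rightarrow> (real \<times> real \<Rightarrow> real) \<Rightarrow>
   (real \<times> real \<Rightarrow> real) \<Rightarrow> (real \<times> real \<Rightarrow> real) \<Rightarrow> (real \<times> real \<Rightarrow> real) \<Rightarrow> real \<times> real \<Rightarrow> bool" where
  "strict_sub_at m M K bq bp bqq bqp bpp z \<longleftrightarrow>
     (\<forall>A B. \<bar>A\<bar> \<le> M \<and> m \<le> B \<and> B \<le> M \<longrightarrow>
        K * (\<bar>bq z\<bar> + \<bar>bp z\<bar>) < bpp z + (B\<^sup>2 * bqq z - 2 * A * B * bqp z + A\<^sup>2 * bpp z))"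

text \<open>At a touching point the gradients agree, so the first-order bound of \<open>w\<close> is
  also that of \<open>b\<close>, and the strict inequality for \<open>b\<close> contradicts the
  ordering of the second derivatives. The barrier arguments below invoke this at interior
  points.\<close>

lemma no_touching:
  assumes "open N" "z \<in> N"
    and "hess_on N w wq wp wqq wqp wpp" "hess_on N b bq bp bqq bqp bpp"
    and "\<forall>y\<in>N. b y \<le> w y" "b z = w z"
    and "elliptic_at m M K wq wp wqq wqp wpp z" "strict_sub_at m M K bq bp bqq bqp bpp z"
  shows False
proof -
  obtain A B where AB: "\<bar>A\<bar> \<le> M" "m \<le> B" "B \<le> M"
    and le: "\<bar>wpp z + (B\<^sup>2 * wqq z - 2 * A * B * wqp z + A\<^sup>2 * wpp z)\<bar> \<le> K * (\<bar>wq z\<bar> + \<bar>wp z\<bar>)"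
    using assms(7) unfolding elliptic_at_def by blast
  note t = touching[OF assms(1-6)]
  have "K * (\<bar>bq z\<bar> + \<bar>bp z\<bar>) < bpp z + (B\<^sup>2 * bqq z - 2 * A * B * bqp z + A\<^sup>2 * bpp z)"
    using assms(8) AB unfolding strict_sub_at_def by blast
  with le t(3)[of B A] show False unfolding t(1,2) by linarith
qed

text \<open>An explicit ellipticity constant: \<open>X\<close> is recovered from
  \<open>B * X = V + A * Y\<close>, where \<open>B\<close> is at least \<open>m\<close> and
  \<open>A\<close> is bounded by \<open>M\<close>.\<close>

lemma elliptic_lower_bound:
  fixes m M A B X Y :: real
  assumes "0 < m" "\<bar>A\<bar> \<le> M" "m \<le> B" "B \<le> M"
  shows "m\<^sup>2 / (4 * (1 + M\<^sup>2)) * (X\<^sup>2 + Y\<^sup>2) \<le> Y\<^sup>2 + (B * X - A * Y)\<^sup>2"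
proof -
  define V where "V = B * X - A * Y"
  have A2: "A\<^sup>2 \<le> M\<^sup>2" using assms(2) by (simp add: abs_le_square_iff[symmetric])
  have m2: "m\<^sup>2 \<le> B\<^sup>2" "m\<^sup>2 \<le> M\<^sup>2" using assms by (auto intro!: power_mono)
  have "m\<^sup>2 * X\<^sup>2 \<le> B\<^sup>2 * X\<^sup>2" using m2 by (intro mult_right_mono) auto
  also have "\<dots> = (V + A * Y)\<^sup>2" by (simp add: V_def power_mult_distrib)
  also have "\<dots> \<le> 2 * V\<^sup>2 + 2 * (A * Y)\<^sup>2"
    using sum_squares_bound[of V "A*Y"] by (simp add: power2_sum)
  also have "\<dots> \<le> 2 * V\<^sup>2 + 2 * (M\<^sup>2 * Y\<^sup>2)"
    using A2 by (simp add: power_mult_distrib mult_right_mono)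
  finally have 1: "m\<^sup>2 * X\<^sup>2 \<le> 2 * V\<^sup>2 + 2 * (M\<^sup>2 * Y\<^sup>2)" .
  have 2: "m\<^sup>2 * Y\<^sup>2 \<le> M\<^sup>2 * Y\<^sup>2" using m2 by (intro mult_right_mono) auto
  have "m\<^sup>2 * (X\<^sup>2 + Y\<^sup>2) \<le> (4 * (1 + M\<^sup>2)) * (Y\<^sup>2 + V\<^sup>2)"
  proof -
    have "0 \<le> M\<^sup>2 * V\<^sup>2" "0 \<le> M\<^sup>2 * Y\<^sup>2" "0 \<le> V\<^sup>2" "0 \<le> Y\<^sup>2" by auto
    moreover have "(4 * (1 + M\<^sup>2)) * (Y\<^sup>2 + V\<^sup>2) - m\<^sup>2 * (X\<^sup>2 + Y\<^sup>2) =
        (2 * V\<^sup>2 + 2 * (M\<^sup>2 * Y\<^sup>2) - m\<^sup>2 * X\<^sup>2) + (M\<^sup>2 * Y\<^sup>2 - m\<^sup>2 * Y\<^sup>2)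
        + 4 * (M\<^sup>2 * V\<^sup>2) + M\<^sup>2 * Y\<^sup>2 + 2 * V\<^sup>2 + 4 * Y\<^sup>2"
      by (simp add: algebra_simps)
    ultimately show ?thesis using 1 2 by linarith
  qed
  moreover have "0 < 4 * (1 + M\<^sup>2)" by (simp add: add_pos_nonneg)
  ultimately show ?thesis unfolding V_def by (simp add: field_simps)
qed

section \<open>Hopf's boundary point bound and the strong maximum principle\<close>

definition gauss :: "real \<Rightarrow> real \<times> real \<Rightarrow> real \<times> real \<Rightarrow> real" where
  "gauss \<alpha> z0 z = exp (- \<alpha> * ((fst z - fst z0)\<^sup>2 + (snd z - snd z0)\<^sup>2))"

lemma hess_on_gauss:
  fixes z0 :: "real \<times> real" and \<alpha> \<epsilon> k :: real
  defines "X \<equiv> \<lambda>z. fst z - fst z0" and "Y \<equiv> \<lambda>z. snd z - snd z0"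
  defines "E \<equiv> gauss \<alpha> z0"
  shows "hess_on S (\<lambda>z. \<epsilon> * E z - k) (\<lambda>z. \<epsilon> * (- 2 * \<alpha> * X z * E z)) (\<lambda>z. \<epsilon> * (- 2 * \<alpha> * Y z * E z))
     (\<lambda>z. \<epsilon> * ((4 * \<alpha>\<^sup>2 * (X z)\<^sup>2 - 2 * \<alpha>) * E z)) (\<lambda>z. \<epsilon> * (4 * \<alpha>\<^sup>2 * X z * Y z * E z))
     (\<lambda>z. \<epsilon> * ((4 * \<alpha>\<^sup>2 * (Y z)\<^sup>2 - 2 * \<alpha>) * E z))"
  unfolding hess_on_def
proof (intro ballI conjI)
  fix z
  have X: "(X has_derivative fst) (at z)" and Y: "(Y has_derivative snd) (at z)"
    unfolding X_def Y_def by (auto intro!: derivative_eq_intros)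
  have E: "(E has_derivative (\<lambda>h. (- 2 * \<alpha> * X z * E z) * fst h + (- 2 * \<alpha> * Y z * E z) * snd h)) (at z)"
    unfolding E_def gauss_def
    by (auto intro!: derivative_eq_intros simp: X_def Y_def fun_eq_iff algebra_simps)
  show "((\<lambda>z. \<epsilon> * E z - k) has_derivative (\<lambda>h. \<epsilon> * (- 2 * \<alpha> * X z * E z) * fst h + \<epsilon> * (- 2 * \<alpha> * Y z * E z) * snd h)) (at z)"
    by (auto intro!: derivative_eq_intros E simp: fun_eq_iff algebra_simps)
  show "((\<lambda>z. \<epsilon> * (- 2 * \<alpha> * X z * E z)) has_derivative (\<lambda>h. \<epsilon> * ((4 * \<alpha>\<^sup>2 * (X z)\<^sup>2 - 2 * \<alpha>) * E z) * fst h + \<epsilon> * (4 * \<alpha>\<^sup>2 * X z * Y z * E z) * snd h)) (at z)"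
    by (auto intro!: derivative_eq_intros E X Y simp: fun_eq_iff algebra_simps power2_eq_square)
  show "((\<lambda>z. \<epsilon> * (- 2 * \<alpha> * Y z * E z)) has_derivative (\<lambda>h. \<epsilon> * (4 * \<alpha>\<^sup>2 * X z * Y z * E z) * fst h + \<epsilon> * ((4 * \<alpha>\<^sup>2 * (Y z)\<^sup>2 - 2 * \<alpha>) * E z) * snd h)) (at z)"
    by (auto intro!: derivative_eq_intros E X Y simp: fun_eq_iff algebra_simps power2_eq_square)
qed

lemma strict_sub_gauss:
  fixes z0 :: "real \<times> real" and m M K R :: real
  assumes "0 < m" "m \<le> M" "0 \<le> K" "0 < R"
  shows "\<exists>\<alpha>>0. \<forall>z \<epsilon>. \<epsilon> > 0 \<and> R / 2 \<le> dist z0 z \<and> dist z0 z \<le> R \<longrightarrow>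
      strict_sub_at m M K
        (\<lambda>z. \<epsilon> * (- 2 * \<alpha> * (fst z - fst z0) * gauss \<alpha> z0 z))
        (\<lambda>z. \<epsilon> * (- 2 * \<alpha> * (snd z - snd z0) * gauss \<alpha> z0 z))
        (\<lambda>z. \<epsilon> * ((4 * \<alpha>\<^sup>2 * (fst z - fst z0)\<^sup>2 - 2 * \<alpha>) * gauss \<alpha> z0 z))
        (\<lambda>z. \<epsilon> * (4 * \<alpha>\<^sup>2 * (fst z - fst z0) * (snd z - snd z0) * gauss \<alpha> z0 z))
        (\<lambda>z. \<epsilon> * ((4 * \<alpha>\<^sup>2 * (snd z - snd z0)\<^sup>2 - 2 * \<alpha>) * gauss \<alpha> z0 z)) z"
proof -
  define c where "c = m\<^sup>2 / (4 * (1 + M\<^sup>2))"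
  have "0 < 4 * (1 + M\<^sup>2)" by (simp add: add_pos_nonneg)
  then have c: "c > 0" using assms by (simp add: c_def)
  \<comment> \<open>In the annulus the quadratic form is at least \<open>c * R\<^sup>2 / 4\<close>.
    The numerator collects twice the bound \<open>1 + 2 * M\<^sup>2\<close> for the trace, the
    gradient term with \<open>\<bar>X\<bar> + \<bar>Y\<bar>\<close> at most \<open>2 * R\<close>,
    and a \<open>1\<close> for strictness.\<close>
  define \<alpha> where "\<alpha> = (2 * (1 + 2 * M\<^sup>2) + 4 * K * R + 1) / (c * R\<^sup>2)"
  have "0 < 2 * (1 + 2 * M\<^sup>2) + 4 * K * R + 1" using assms by (simp add: add_pos_nonneg)
  then have \<alpha>: "\<alpha> > 0" using c assms unfolding \<alpha>_def by simp
  have \<alpha>eq: "\<alpha> * (c * R\<^sup>2) = 2 * (1 + 2 * M\<^sup>2) + 4 * K * R + 1"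
    using c assms unfolding \<alpha>_def by simp
  show ?thesis
  proof (intro exI conjI allI impI, rule \<alpha>, unfold strict_sub_at_def, intro allI impI)
    fix z :: "real \<times> real" and \<epsilon> A B :: real
    assume "\<epsilon> > 0 \<and> R / 2 \<le> dist z0 z \<and> dist z0 z \<le> R"
      and AB: "\<bar>A\<bar> \<le> M \<and> m \<le> B \<and> B \<le> M"
    then have \<epsilon>: "\<epsilon> > 0" and d1: "R / 2 \<le> dist z0 z" and d2: "dist z0 z \<le> R" by auto
    define X Y where "X = fst z - fst z0" and "Y = snd z - snd z0"
    define E where "E = gauss \<alpha> z0 z"
    have E: "E > 0" unfolding E_def gauss_def by simp
    have r2: "X\<^sup>2 + Y\<^sup>2 = (dist z0 z)\<^sup>2"
      by (cases z; cases z0) (simp add: X_def Y_def dist_Pair_Pair dist_real_def power2_commute)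
    have "(R/2)\<^sup>2 \<le> X\<^sup>2 + Y\<^sup>2" unfolding r2 using d1 assms by (intro power_mono) auto
    then have r1: "R\<^sup>2 / 4 \<le> X\<^sup>2 + Y\<^sup>2" by (simp add: power_divide)
    have "X\<^sup>2 + Y\<^sup>2 \<le> R\<^sup>2" unfolding r2 using d2 by (intro power_mono) auto
    then have "X\<^sup>2 \<le> R\<^sup>2" "Y\<^sup>2 \<le> R\<^sup>2" using zero_le_power2[of X] zero_le_power2[of Y] by linarith+
    then have XY: "\<bar>X\<bar> \<le> R" "\<bar>Y\<bar> \<le> R" using assms abs_le_square_iff[of X R] abs_le_square_iff[of Y R] by auto
    have sq: "c * R\<^sup>2 / 4 \<le> Y\<^sup>2 + (B * X - A * Y)\<^sup>2"
    proof -
      have "c * (R\<^sup>2 / 4) \<le> c * (X\<^sup>2 + Y\<^sup>2)" using r1 c by (intro mult_left_mono) auto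
      also have "\<dots> \<le> Y\<^sup>2 + (B * X - A * Y)\<^sup>2"
        unfolding c_def using AB assms by (intro elliptic_lower_bound) auto
      finally show ?thesis by simp
    qed
    have AB2: "1 + B\<^sup>2 + A\<^sup>2 \<le> 1 + 2 * M\<^sup>2"
    proof -
      have "A\<^sup>2 \<le> M\<^sup>2" "B\<^sup>2 \<le> M\<^sup>2"
        using AB assms by (auto intro!: power_mono simp: abs_le_square_iff[symmetric])
      then show ?thesis by simp
    qed
    have "K * (\<bar>X\<bar> + \<bar>Y\<bar>) * 2 \<le> K * (R + R) * 2"
      using XY assms by (intro mult_right_mono mult_left_mono) auto
    also have "\<dots> < \<alpha> * (c * R\<^sup>2) - 2 * (1 + B\<^sup>2 + A\<^sup>2)"
      using AB2 unfolding \<alpha>eq by (simp add: algebra_simps)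
    also have "\<dots> \<le> 4 * \<alpha> * (Y\<^sup>2 + (B * X - A * Y)\<^sup>2) - 2 * (1 + B\<^sup>2 + A\<^sup>2)"
      using mult_left_mono[OF sq, of "4 * \<alpha>"] \<alpha> by simp
    finally have "\<epsilon> * (\<alpha> * E) * (K * (\<bar>X\<bar> + \<bar>Y\<bar>) * 2) <
        \<epsilon> * (\<alpha> * E) * (4 * \<alpha> * (Y\<^sup>2 + (B * X - A * Y)\<^sup>2) - 2 * (1 + B\<^sup>2 + A\<^sup>2))"
      using \<epsilon> \<alpha> E by (intro mult_strict_left_mono) auto
    moreover have "K * (\<bar>\<epsilon> * (- 2 * \<alpha> * X * E)\<bar> + \<bar>\<epsilon> * (- 2 * \<alpha> * Y * E)\<bar>) =
        \<epsilon> * (\<alpha> * E) * (K * (\<bar>X\<bar> + \<bar>Y\<bar>) * 2)"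
      using \<epsilon> \<alpha> E by (simp add: abs_mult algebra_simps)
    moreover have "\<epsilon> * ((4 * \<alpha>\<^sup>2 * Y\<^sup>2 - 2 * \<alpha>) * E) +
        (B\<^sup>2 * (\<epsilon> * ((4 * \<alpha>\<^sup>2 * X\<^sup>2 - 2 * \<alpha>) * E)) - 2 * A * B * (\<epsilon> * (4 * \<alpha>\<^sup>2 * X * Y * E)) +
         A\<^sup>2 * (\<epsilon> * ((4 * \<alpha>\<^sup>2 * Y\<^sup>2 - 2 * \<alpha>) * E))) =
        \<epsilon> * (\<alpha> * E) * (4 * \<alpha> * (Y\<^sup>2 + (B * X - A * Y)\<^sup>2) - 2 * (1 + B\<^sup>2 + A\<^sup>2))"
      by (simp add: algebra_simps power2_eq_square)
    ultimately show "K * (\<bar>\<epsilon> * (- 2 * \<alpha> * (fst z - fst z0) * gauss \<alpha> z0 z)\<bar> +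
         \<bar>\<epsilon> * (- 2 * \<alpha> * (snd z - snd z0) * gauss \<alpha> z0 z)\<bar>)
      < \<epsilon> * ((4 * \<alpha>\<^sup>2 * (snd z - snd z0)\<^sup>2 - 2 * \<alpha>) * gauss \<alpha> z0 z) +
        (B\<^sup>2 * (\<epsilon> * ((4 * \<alpha>\<^sup>2 * (fst z - fst z0)\<^sup>2 - 2 * \<alpha>) * gauss \<alpha> z0 z)) -
         2 * A * B * (\<epsilon> * (4 * \<alpha>\<^sup>2 * (fst z - fst z0) * (snd z - snd z0) * gauss \<alpha> z0 z)) +
         A\<^sup>2 * (\<epsilon> * ((4 * \<alpha>\<^sup>2 * (snd z - snd z0)\<^sup>2 - 2 * \<alpha>) * gauss \<alpha> z0 z)))"
      unfolding E_def[symmetric] X_def[symmetric] Y_def[symmetric] by linarith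
  qed
qed

text \<open>A Gaussian barrier in the annulus between half the ball and the ball. The conclusion is
  a linear lower bound along the radius instead of a normal derivative, so that it applies on the
  top of the strip, where only one-sided derivatives exist, as well as at interior points.\<close>

lemma hopf:
  fixes z0 z1 :: "real \<times> real"
  assumes "0 < m" "m \<le> M" "0 \<le> K" "0 < R"
    and w: "hess_on (ball z0 R) w wq wp wqq wqp wpp"
    and ell: "\<And>z. z \<in> ball z0 R \<Longrightarrow> elliptic_at m M K wq wp wqq wqp wpp z"
    and pos: "\<And>z. z \<in> ball z0 R \<Longrightarrow> 0 < w z"
    and cont: "continuous_on (cball z0 R) w"
    and z1: "dist z0 z1 = R"
    and nonneg: "\<And>z. z \<in> cball z0 R \<Longrightarrow> 0 \<le> w z"
  obtains \<epsilon> where "\<epsilon> > 0" "\<And>s. 0 \<le> s \<Longrightarrow> s \<le> 1/2 \<Longrightarrow> \<epsilon> * s \<le> w (z1 + s *\<^sub>R (z0 - z1))"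
proof -
  obtain \<alpha> where \<alpha>: "\<alpha> > 0" and sub: "\<forall>z \<epsilon>. \<epsilon> > 0 \<and> R / 2 \<le> dist z0 z \<and> dist z0 z \<le> R \<longrightarrow>
      strict_sub_at m M K (\<lambda>z. \<epsilon> * (- 2 * \<alpha> * (fst z - fst z0) * gauss \<alpha> z0 z))
        (\<lambda>z. \<epsilon> * (- 2 * \<alpha> * (snd z - snd z0) * gauss \<alpha> z0 z))
        (\<lambda>z. \<epsilon> * ((4 * \<alpha>\<^sup>2 * (fst z - fst z0)\<^sup>2 - 2 * \<alpha>) * gauss \<alpha> z0 z))
        (\<lambda>z. \<epsilon> * (4 * \<alpha>\<^sup>2 * (fst z - fst z0) * (snd z - snd z0) * gauss \<alpha> z0 z))
        (\<lambda>z. \<epsilon> * ((4 * \<alpha>\<^sup>2 * (snd z - snd z0)\<^sup>2 - 2 * \<alpha>) * gauss \<alpha> z0 z)) z"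
    using strict_sub_gauss[OF assms(1-4), of z0] by blast
  define E where "E = gauss \<alpha> z0"
  have Ed: "E z = exp (- \<alpha> * (dist z0 z)\<^sup>2)" for z
    by (cases z; cases z0) (simp add: E_def gauss_def dist_Pair_Pair dist_real_def power2_commute)
  define v where "v z = E z - exp (- \<alpha> * R\<^sup>2)" for z
  have "compact (sphere z0 (R/2))" "sphere z0 (R/2) \<noteq> {}" using assms(4) by auto
  moreover have "continuous_on (sphere z0 (R/2)) w"
    using assms(4) by (intro continuous_on_subset[OF cont]) auto
  ultimately obtain zm where zm: "zm \<in> sphere z0 (R/2)" "\<And>z. z \<in> sphere z0 (R/2) \<Longrightarrow> w zm \<le> w z"
    using continuous_attains_inf by metis
  \<comment> \<open>With this factor the barrier lies below \<open>w\<close> on the inner sphere,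
    since \<open>v\<close> is at most \<open>1\<close>; on the outer sphere \<open>v\<close>
    vanishes.\<close>
  define \<epsilon> where "\<epsilon> = w zm"
  have \<epsilon>: "\<epsilon> > 0" unfolding \<epsilon>_def using zm(1) assms(4) by (intro pos) auto
  define An where "An = cball z0 R - ball z0 (R/2)"
  have An: "compact An" unfolding An_def by (intro compact_diff) auto
  have contE: "continuous_on S E" for S unfolding E_def gauss_def by (intro continuous_intros)
  have main: "\<epsilon> * v z \<le> w z" if "z \<in> An" for z
  proof (rule ccontr)
    assume neg: "\<not> \<epsilon> * v z \<le> w z"
    have "continuous_on An (\<lambda>z. w z - \<epsilon> * v z)"
      unfolding v_def using cont contE
      by (intro continuous_intros) (auto simp: An_def intro: continuous_on_subset)
    then obtain y where y: "y \<in> An" "\<And>x. x \<in> An \<Longrightarrow> w y - \<epsilon> * v y \<le> w x - \<epsilon> * v x"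
      using continuous_attains_inf[OF An, of "\<lambda>z. w z - \<epsilon> * v z"] \<open>z \<in> An\<close> by blast
    \<comment> \<open>A negative minimum of the difference lies strictly inside the annulus.
      Lowering the barrier by its depth makes the two graphs touch there.\<close>
    define k where "k = w y - \<epsilon> * v y"
    have k: "k < 0" using y(2)[OF that] neg unfolding k_def by simp
    have ny1: "dist z0 y \<noteq> R"
    proof
      assume "dist z0 y = R"
      then have "v y = 0" "0 \<le> w y" using nonneg[of y] by (auto simp: v_def Ed)
      then show False using k unfolding k_def by simp
    qed
    have ny2: "dist z0 y \<noteq> R/2"
    proof
      assume d: "dist z0 y = R/2"
      then have "\<epsilon> \<le> w y" using zm(2)[of y] by (simp add: \<epsilon>_def)
      moreover have "v y \<le> 1" unfolding v_def Ed using \<alpha> by (smt (verit) exp_le_one_iff exp_gt_zero mult_nonneg_nonneg zero_le_power2 mult_minus_left)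
      ultimately have "\<epsilon> * v y \<le> w y" using \<epsilon> by (smt (verit) mult_left_le)
      then show False using k unfolding k_def by simp
    qed
    have yd: "R/2 < dist z0 y" "dist z0 y < R" using ny1 ny2 y(1) by (auto simp: An_def)
    define N where "N = ball z0 R - cball z0 (R/2)"
    have N: "open N" "y \<in> N" "N \<subseteq> An" "N \<subseteq> ball z0 R" using yd by (auto simp: N_def An_def)
    note hb = hess_on_gauss[of N \<epsilon> \<alpha> z0 "\<epsilon> * exp (- \<alpha> * R\<^sup>2) - k"]
    show False
    proof (rule no_touching[OF N(1,2) hess_on_subset[OF w N(4)] hb _ _ ell sub[rule_format]])
      show "\<forall>x\<in>N. \<epsilon> * gauss \<alpha> z0 x - (\<epsilon> * exp (- \<alpha> * R\<^sup>2) - k) \<le> w x"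
      proof
        fix x assume "x \<in> N"
        then have "w y - \<epsilon> * v y \<le> w x - \<epsilon> * v x" using y(2) N(3) by blast
        then show "\<epsilon> * gauss \<alpha> z0 x - (\<epsilon> * exp (- \<alpha> * R\<^sup>2) - k) \<le> w x"
          unfolding v_def E_def k_def by (simp add: right_diff_distrib)
      qed
      show "\<epsilon> * gauss \<alpha> z0 y - (\<epsilon> * exp (- \<alpha> * R\<^sup>2) - k) = w y"
        unfolding k_def v_def E_def by (simp add: algebra_simps)
    qed (use N(2,4) yd \<epsilon> in auto)
  qed
  \<comment> \<open>At distance \<open>(1 - s) * R\<close> from the centre the exponent exceeds its
    value on the sphere by \<open>\<alpha> * R\<^sup>2 * (2 * s - s\<^sup>2)\<close>, which is at
    least \<open>\<alpha> * R\<^sup>2 * s\<close>. The inequality \<open>1 + x \<le> exp x\<close>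
    turns this into linear growth.\<close>
  define \<epsilon>' where "\<epsilon>' = \<epsilon> * (exp (- \<alpha> * R\<^sup>2) * (\<alpha> * R\<^sup>2))"
  show ?thesis
  proof (rule that[of \<epsilon>'])
    show "\<epsilon>' > 0" using \<epsilon> \<alpha> assms(4) by (simp add: \<epsilon>'_def)
    fix s :: real assume s: "0 \<le> s" "s \<le> 1/2"
    define x where "x = z1 + s *\<^sub>R (z0 - z1)"
    have "z0 - x = (1 - s) *\<^sub>R (z0 - z1)" unfolding x_def by (simp add: algebra_simps)
    then have dx: "dist z0 x = (1 - s) * R" using s z1 by (simp add: dist_norm)
    have "(1/2) * R \<le> (1 - s) * R" "(1 - s) * R \<le> 1 * R" using s assms(4) by (intro mult_right_mono; auto)+
    then have "x \<in> An" using dx by (auto simp: An_def)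
    then have "\<epsilon> * v x \<le> w x" by (rule main)
    moreover have "exp (- \<alpha> * R\<^sup>2) * (\<alpha> * R\<^sup>2) * s \<le> v x"
    proof -
      have "s * s \<le> s * 1" using s by (intro mult_left_mono) auto
      then have "\<alpha> * R\<^sup>2 * s \<le> \<alpha> * R\<^sup>2 * (2 * s - s\<^sup>2)" using \<alpha> by (intro mult_left_mono) (auto simp: power2_eq_square)
      also have "\<dots> \<le> exp (\<alpha> * R\<^sup>2 * (2 * s - s\<^sup>2)) - 1" using exp_ge_add_one_self[of "\<alpha> * R\<^sup>2 * (2 * s - s\<^sup>2)"] by linarith
      finally have "exp (- \<alpha> * R\<^sup>2) * (\<alpha> * R\<^sup>2 * s) \<le> exp (- \<alpha> * R\<^sup>2) * (exp (\<alpha> * R\<^sup>2 * (2 * s - s\<^sup>2)) - 1)"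
        by (intro mult_left_mono) auto
      also have "\<dots> = v x" unfolding v_def Ed dx
        by (simp add: algebra_simps exp_add[symmetric] power2_eq_square)
      finally show ?thesis by (simp add: mult.assoc)
    qed
    then have "\<epsilon> * (exp (- \<alpha> * R\<^sup>2) * (\<alpha> * R\<^sup>2) * s) \<le> \<epsilon> * v x" using \<epsilon> by (intro mult_left_mono) auto
    ultimately show "\<epsilon>' * s \<le> w (z1 + s *\<^sub>R (z0 - z1))" unfolding x_def \<epsilon>'_def by (simp add: mult.assoc)
  qed
qed

text \<open>Slide a closed ball of fixed radius along the segment from \<open>z2\<close>, where
  \<open>w\<close> is positive, towards the zero \<open>z1\<close>. When it first meets a zero, that
  zero lies on its sphere, and Hopf's bound contradicts the vanishing derivative of \<open>w\<close>
  at an interior minimum.\<close>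

lemma strong_maximum:
  fixes w :: "real \<times> real \<Rightarrow> real"
  assumes "0 < m" "m \<le> M" "0 \<le> K" and "open S" "convex S"
    and w: "hess_on S w wq wp wqq wqp wpp"
    and ell: "\<And>z. z \<in> S \<Longrightarrow> elliptic_at m M K wq wp wqq wqp wpp z"
    and nonneg: "\<And>z. z \<in> S \<Longrightarrow> 0 \<le> w z"
    and z1: "z1 \<in> S" "w z1 = 0" and z2: "z2 \<in> S"
  shows "w z2 = 0"
proof (rule ccontr)
  assume "w z2 \<noteq> 0"
  with nonneg[OF z2] have w2: "0 < w z2" by simp
  have contw: "continuous_on S w" using hess_on_continuous(1)[OF w] .
  define \<sigma> where "\<sigma> t = z2 + t *\<^sub>R (z1 - z2)" for t :: real
  have seg: "\<sigma> t \<in> S" if "0 \<le> t" "t \<le> 1" for t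
  proof -
    have "\<sigma> t = (1 - t) *\<^sub>R z2 + t *\<^sub>R z1" by (simp add: \<sigma>_def algebra_simps)
    then show ?thesis using convexD[OF assms(5) z2 z1(1), of "1 - t" t] that by simp
  qed
  have cont\<sigma>: "continuous_on T \<sigma>" for T unfolding \<sigma>_def by (intro continuous_intros)
  define C where "C = \<sigma> ` {0..1}"
  have C: "compact C" "C \<subseteq> S" "C \<noteq> {}"
    unfolding C_def using seg by (auto intro!: compact_continuous_image cont\<sigma>)
  obtain \<rho>1 where \<rho>1: "\<rho>1 > 0" "(\<Union>z\<in>C. cball z \<rho>1) \<subseteq> S"
    by (rule compact_subset_open_imp_cball_epsilon_subset[OF C(1) assms(4) C(2)])
  obtain \<rho>2 where \<rho>2: "\<rho>2 > 0" "\<And>y. y \<in> ball z2 \<rho>2 \<Longrightarrow> y \<in> S \<and> 0 < w y"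
  proof -
    have "open {y\<in>S. 0 < w y}"
      using continuous_open_preimage[OF contw assms(4), of "{0<..}"]
      by (auto simp: vimage_def Int_def)
    then obtain e where "e > 0" "ball z2 e \<subseteq> {y\<in>S. 0 < w y}"
      using z2 w2 openE[of "{y\<in>S. 0 < w y}" z2] by blast
    then show ?thesis by (intro that[of e]) auto
  qed
  define \<rho> where "\<rho> = min \<rho>1 (\<rho>2 / 2)"
  have \<rho>: "\<rho> > 0" "\<rho> \<le> \<rho>1" "\<rho> < \<rho>2" using \<rho>1 \<rho>2 by (auto simp: \<rho>_def)
  have cb: "cball (\<sigma> t) \<rho> \<subseteq> S" if "0 \<le> t" "t \<le> 1" for t
  proof -
    have "\<sigma> t \<in> C" using that by (auto simp: C_def)
    then have "cball (\<sigma> t) \<rho>1 \<subseteq> S" using \<rho>1(2) by blast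
    then show ?thesis using \<rho>(2) by (meson subset_cball subset_trans)
  qed
  \<comment> \<open>The times at which the closed ball meets the zero set. As the projection of a
    compact set, \<open>T\<close> has a least element.\<close>
  define T where "T = {t\<in>{0..1}. \<exists>x\<in>cball 0 \<rho>. w (\<sigma> t + x) = 0}"
  have T: "T = fst ` {y \<in> {0..1} \<times> cball 0 \<rho>. w (\<sigma> (fst y) + snd y) = 0}"
    unfolding T_def by (force simp: image_iff)
  have in_S: "\<sigma> t + x \<in> S" if "0 \<le> t" "t \<le> 1" "x \<in> cball 0 \<rho>" for t x
  proof -
    have "\<sigma> t + x \<in> cball (\<sigma> t) \<rho>" using that(3) by (simp add: dist_norm)
    then show ?thesis using cb[OF that(1,2)] by blast
  qed
  have "continuous_on ({0..1} \<times> cball 0 \<rho>) (\<lambda>y. w (\<sigma> (fst y) + snd y))"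
  proof (rule continuous_on_compose2[OF contw])
    show "continuous_on ({0..1} \<times> cball 0 \<rho>) (\<lambda>y. \<sigma> (fst y) + snd y)"
      unfolding \<sigma>_def by (intro continuous_intros)
    show "(\<lambda>y. \<sigma> (fst y) + snd y) ` ({0..1} \<times> cball 0 \<rho>) \<subseteq> S" using in_S by auto
  qed
  then have "closed {y \<in> {0..1} \<times> cball 0 \<rho>. w (\<sigma> (fst y) + snd y) = 0}"
    by (intro continuous_closed_preimage_constant closed_Times) auto
  then have "compact ({0..1} \<times> cball 0 \<rho> \<inter> {y \<in> {0..1} \<times> cball 0 \<rho>. w (\<sigma> (fst y) + snd y) = 0})"
    by (intro compact_Int_closed compact_Times) auto
  moreover have "{0..1} \<times> cball 0 \<rho> \<inter> {y \<in> {0..1} \<times> cball 0 \<rho>. w (\<sigma> (fst y) + snd y) = 0} =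
    {y \<in> {0..1} \<times> cball 0 \<rho>. w (\<sigma> (fst y) + snd y) = 0}" by auto
  ultimately have compT: "compact T"
    unfolding T by (intro compact_continuous_image continuous_intros) simp
  have "1 \<in> T" unfolding T_def using z1(2) \<rho>(1) by (auto simp: \<sigma>_def intro!: bexI[of _ 0])
  then obtain t where t: "t \<in> T" "\<And>s. s \<in> T \<Longrightarrow> t \<le> s"
    using compact_attains_inf[OF compT] by blast
  then obtain x where x: "x \<in> cball 0 \<rho>" "w (\<sigma> t + x) = 0" and t01: "0 \<le> t" "t \<le> 1"
    unfolding T_def by auto
  have nz: "w (\<sigma> s + y) \<noteq> 0" if "0 \<le> s" "s < t" "y \<in> cball 0 \<rho>" for s y
    using t(2)[of s] that t01 unfolding T_def by force
  have t0: "0 < t"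
  proof (rule ccontr)
    assume "\<not> 0 < t"
    then have "t = 0" using t01 by simp
    then have "\<sigma> t + x \<in> ball z2 \<rho>2" using x(1) \<rho> by (auto simp: \<sigma>_def dist_norm)
    then show False using \<rho>2(2)[of "\<sigma> t + x"] x(2) by simp
  qed
  \<comment> \<open>A zero in the open ball at time \<open>t\<close> would already lie in the closed
    ball at a slightly earlier time.\<close>
  have pos: "0 < w y" if "y \<in> ball (\<sigma> t) \<rho>" for y
  proof -
    define k where "k = \<rho> - dist (\<sigma> t) y"
    have k: "k > 0" using that by (simp add: k_def)
    have "continuous (at_left t) (\<lambda>s. \<sigma> s)" using cont\<sigma>[of UNIV]
      by (simp add: continuous_on_eq_continuous_at continuous_at_imp_continuous_within)
    then have "(\<sigma> \<longlongrightarrow> \<sigma> t) (at_left t)" by (simp add: continuous_within)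
    then have "\<forall>\<^sub>F s in at_left t. dist (\<sigma> s) (\<sigma> t) < k" using k by (rule tendstoD)
    moreover have "\<forall>\<^sub>F s in at_left t. s \<in> {0<..<t}" using t0 by (rule eventually_at_leftI[rotated]) auto
    ultimately have "\<forall>\<^sub>F s in at_left t. dist (\<sigma> s) (\<sigma> t) < k \<and> s \<in> {0<..<t}" by eventually_elim simp
    then obtain s where s: "dist (\<sigma> s) (\<sigma> t) < k" "0 < s" "s < t"
      using eventually_happens[of _ "at_left t"] by force
    have "dist (\<sigma> s) y < \<rho>" using dist_triangle[of "\<sigma> s" y "\<sigma> t"] s(1) unfolding k_def by simp
    then have "y - \<sigma> s \<in> cball 0 \<rho>" by (simp add: dist_norm norm_minus_commute)
    from nz[OF _ s(3) this] s have "w y \<noteq> 0" by simp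
    moreover have "y \<in> S" using cb[OF t01] that by (meson ball_subset_cball subsetD)
    ultimately show ?thesis using nonneg[of y] by simp
  qed
  define y1 where "y1 = \<sigma> t + x"
  have y1S: "y1 \<in> S" unfolding y1_def using in_S[OF t01 x(1)] .
  have dy: "dist (\<sigma> t) y1 = \<rho>"
    using pos[of y1] x unfolding y1_def by (fastforce simp: dist_norm)
  have ballS: "ball (\<sigma> t) \<rho> \<subseteq> S" using cb[OF t01] by (meson ball_subset_cball subset_trans)
  obtain \<epsilon> where \<epsilon>: "\<epsilon> > 0" "\<And>s. 0 \<le> s \<Longrightarrow> s \<le> 1/2 \<Longrightarrow> \<epsilon> * s \<le> w (y1 + s *\<^sub>R (\<sigma> t - y1))"
    by (rule hopf[OF assms(1-3) \<rho>(1) hess_on_subset[OF w ballS] ell pos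
        continuous_on_subset[OF contw cb[OF t01]] dy nonneg])
      (use ballS cb[OF t01] x(2) y1_def in auto)
  define e where "e = \<sigma> t - y1"
  have "open ((\<lambda>s. y1 + s *\<^sub>R e) -` S)"
    using assms(4) by (intro open_vimage) (auto intro!: continuous_intros)
  moreover have "0 \<in> (\<lambda>s. y1 + s *\<^sub>R e) -` S" using y1S by simp
  ultimately obtain \<delta> where \<delta>: "\<delta> > 0" "ball 0 \<delta> \<subseteq> (\<lambda>s. y1 + s *\<^sub>R e) -` S"
    using openE by blast
  have i: "y1 + s *\<^sub>R e \<in> S" if "\<bar>s\<bar> < \<delta>" for s
    using \<delta>(2) that by (auto simp: dist_real_def)
  have D: "((\<lambda>s. w (y1 + s *\<^sub>R e)) has_real_derivative wq y1 * fst e + wp y1 * snd e) (at 0)"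
    using hess_on_line(1)[OF w i[of 0]] \<delta>(1) by simp
  have "wq y1 * fst e + wp y1 * snd e = 0"
    by (rule DERIV_local_min[OF D \<delta>(1)]) (use i nonneg x(2) y1_def in auto)
  then have "((\<lambda>s. w (y1 + s *\<^sub>R e)) has_real_derivative 0) (at 0)" using D by simp
  then have "((\<lambda>s. w (y1 + s *\<^sub>R e) / s) \<longlongrightarrow> 0) (at 0)"
    using x(2) unfolding has_field_derivative_iff y1_def by simp
  then have "((\<lambda>s. w (y1 + s *\<^sub>R e) / s) \<longlongrightarrow> 0) (at_right 0)" by (rule tendsto_mono[OF at_le, rotated]) auto
  moreover have "\<forall>\<^sub>F s in at_right 0. \<epsilon> \<le> w (y1 + s *\<^sub>R e) / s"
  proof (rule eventually_at_rightI[of 0 "1/2"])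
    fix s :: real assume "s \<in> {0<..<1/2}"
    then show "\<epsilon> \<le> w (y1 + s *\<^sub>R e) / s" using \<epsilon>(2)[of s] by (simp add: e_def pos_le_divide_eq)
  qed simp
  ultimately have "\<epsilon> \<le> 0" by (intro tendsto_lowerbound) auto
  with \<epsilon>(1) show False by simp
qed

section \<open>The height equation in a strip\<close>

lemma hess_on_separable:
  fixes \<alpha> \<beta> :: "real \<Rightarrow> real"
  assumes "\<And>q. (\<alpha> has_real_derivative \<alpha>' q) (at q)" "\<And>q. (\<alpha>' has_real_derivative \<alpha>'' q) (at q)"
    and "\<And>p. (\<beta> has_real_derivative \<beta>' p) (at p)" "\<And>p. (\<beta>' has_real_derivative \<beta>'' p) (at p)"
  shows "hess_on S (\<lambda>z. \<alpha> (fst z) + \<beta> (snd z)) (\<lambda>z. \<alpha>' (fst z)) (\<lambda>z. \<beta>' (snd z))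
     (\<lambda>z. \<alpha>'' (fst z)) (\<lambda>z. 0) (\<lambda>z. \<beta>'' (snd z))"
proof -
  have f: "((\<lambda>z. k (fst z)) has_derivative (\<lambda>h. k' * fst h)) (at z)"
    if "(k has_real_derivative k') (at (fst z))" for k k' and z :: "real \<times> real"
    using has_derivative_compose[OF has_derivative_fst[OF has_derivative_ident]
        that[unfolded has_field_derivative_def]] .
  have s: "((\<lambda>z. k (snd z)) has_derivative (\<lambda>h. k' * snd h)) (at z)"
    if "(k has_real_derivative k') (at (snd z))" for k k' and z :: "real \<times> real"
    using has_derivative_compose[OF has_derivative_snd[OF has_derivative_ident]
        that[unfolded has_field_derivative_def]] .
  show ?thesis unfolding hess_on_def
    using f[OF assms(1)] f[OF assms(2)] s[OF assms(3)] s[OF assms(4)]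
    by (auto intro!: has_derivative_add)
qed

lemma one_sided_min_derivative:
  fixes f :: "real \<Rightarrow> real"
  assumes "p0 < 0" "(f has_real_derivative D) (at 0 within {p0..0})"
    and "\<And>s. p0 \<le> s \<Longrightarrow> s \<le> 0 \<Longrightarrow> f 0 \<le> f s"
  shows "D \<le> 0"
proof -
  have nt: "at 0 within {p0..0} \<noteq> bot" using assms(1) by (simp add: trivial_limit_within islimpt_Icc)
  have "((\<lambda>s. (f s - f 0) / (s - 0)) \<longlongrightarrow> D) (at 0 within {p0..0})"
    using assms(2) unfolding has_field_derivative_iff .
  moreover have "\<forall>\<^sub>F s in at 0 within {p0..0}. (f s - f 0) / (s - 0) \<le> 0"
    unfolding eventually_at_filter using assms(3)
    by (intro always_eventually) (auto simp: divide_nonneg_nonpos)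
  ultimately show ?thesis using nt by (intro tendsto_upperbound)
qed

lemma periodic_shift:
  fixes f :: "real \<Rightarrow> 'a"
  assumes "\<And>q. f (q + T) = f q"
  shows "f (q + of_int k * T) = f q"
proof (induction k arbitrary: q rule: int_induct[of _ 0])
  case base show ?case by simp
next
  case (step1 i)
  have "f (q + of_int (i + 1) * T) = f ((q + of_int i * T) + T)" by (simp add: algebra_simps)
  then show ?case using assms step1 by simp
next
  case (step2 i)
  have "f (q + of_int (i - 1) * T) = f ((q + of_int (i - 1) * T) + T)" using assms by simp
  also have "\<dots> = f (q + of_int i * T)" by (simp add: algebra_simps)
  finally show ?case using step2 by simp
qed

lemma periodic_reduce:
  fixes T q a :: real
  assumes "T > 0"
  obtains k :: int where "q + of_int k * T \<in> {a..<a + T}"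
proof
  have "\<lfloor>(q - a) / T\<rfloor> \<le> (q - a) / T" "(q - a) / T < \<lfloor>(q - a) / T\<rfloor> + 1" by linarith+
  then have "\<lfloor>(q - a) / T\<rfloor> * T \<le> q - a" "q - a < (\<lfloor>(q - a) / T\<rfloor> + 1) * T"
    by (simp_all only: pos_le_divide_eq[OF assms] pos_divide_less_eq[OF assms])
  then show "q + of_int (- \<lfloor>(q - a) / T\<rfloor>) * T \<in> {a..<a + T}" by (auto simp: algebra_simps)
qed

section \<open>The nonlinear height problem and its linearisation\<close>

locale strip_problem =
  fixes p0 m M g Q :: real and \<gamma> :: "real \<Rightarrow> real"
  assumes p0: "p0 < 0" and m: "0 < m" "m \<le> M" and g: "0 \<le> g"
begin

text \<open>The first two terms come from the lower-order terms of the linearised height equation,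
  the last two from the tangential and the zero-order coefficient of the linearised Bernoulli
  condition. One constant serves both.\<close>

definition K :: real where
  "K = 3 * M ^ 3 + 6 * M\<^sup>2 + M ^ 3 / m + g * M ^ 4 / m"

lemma K_nonneg: "0 \<le> K"
  unfolding K_def using m g by (intro add_nonneg_nonneg divide_nonneg_nonneg mult_nonneg_nonneg) auto

abbreviation strip :: "(real \<times> real) set" where "strip \<equiv> UNIV \<times> {p0<..<0}"

lemma open_strip: "open strip" by (intro open_Times) auto

text \<open>The top carries a tangential and a one-sided normal derivative because the Bernoulli
  condition is nonlinear in the gradient. On the bottom a Dirichlet condition will be imposed, so
  values of \<open>H\<close> suffice.\<close>

definition height_sol ::
  "(real \<times> real \<Rightarrow> real) \<Rightarrow> (real \<times> real \<Rightarrow> real) \<Rightarrow> (real \<times> real \<Rightarrow> real) \<Rightarrow>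
   (real \<times> real \<Rightarrow> real) \<Rightarrow> (real \<times> real \<Rightarrow> real) \<Rightarrow> (real \<times> real \<Rightarrow> real) \<Rightarrow> bool" where
  "height_sol H a b hqq hqp hpp \<longleftrightarrow>
     hess_on strip H a b hqq hqp hpp \<and>
     continuous_on (UNIV \<times> {p0..0}) H \<and>
     (\<forall>q. ((\<lambda>s. H (s, 0)) has_real_derivative a (q, 0)) (at q)) \<and>
     (\<forall>q. ((\<lambda>s. H (q, s)) has_real_derivative b (q, 0)) (at 0 within {p0..0})) \<and>
     (\<forall>q. \<forall>p\<in>{p0<..0}. \<bar>a (q, p)\<bar> \<le> M \<and> m \<le> b (q, p) \<and> b (q, p) \<le> M) \<and>
     (\<forall>z\<in>strip. \<bar>hqq z\<bar> \<le> M \<and> \<bar>hqp z\<bar> \<le> M \<and> \<bar>hpp z\<bar> \<le> M \<and> \<bar>\<gamma> (snd z)\<bar> \<le> M \<and>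
        hpp z + ((b z)\<^sup>2 * hqq z - 2 * a z * b z * hqp z + (a z)\<^sup>2 * hpp z) = \<gamma> (snd z) * b z ^ 3) \<and>
     (\<forall>q. (1 + (a (q, 0))\<^sup>2) / (b (q, 0))\<^sup>2 + 2 * g * H (q, 0) = Q)"

text \<open>The linearised problem in the form of inequalities: differences of solutions with
  translates or mirror images all fall into this one class, and their coefficients need not be
  named.\<close>

definition lin_sol ::
  "(real \<times> real \<Rightarrow> real) \<Rightarrow> (real \<times> real \<Rightarrow> real) \<Rightarrow> (real \<times> real \<Rightarrow> real) \<Rightarrow>
   (real \<times> real \<Rightarrow> real) \<Rightarrow> (real \<times> real \<Rightarrow> real) \<Rightarrow> (real \<times> real \<Rightarrow> real) \<Rightarrow> bool" where
  "lin_sol w wq wp wqq wqp wpp \<longleftrightarrow>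
     hess_on strip w wq wp wqq wqp wpp \<and>
     continuous_on (UNIV \<times> {p0..0}) w \<and>
     (\<forall>q. ((\<lambda>s. w (s, 0)) has_real_derivative wq (q, 0)) (at q)) \<and>
     (\<forall>q. ((\<lambda>s. w (q, s)) has_real_derivative wp (q, 0)) (at 0 within {p0..0})) \<and>
     (\<forall>z\<in>strip. elliptic_at m M K wq wp wqq wqp wpp z) \<and>
     (\<forall>q. \<bar>wp (q, 0)\<bar> \<le> K * (\<bar>w (q, 0)\<bar> + \<bar>wq (q, 0)\<bar>))"

text \<open>The coefficients of the first solution are kept in the principal part. Every remaining
  term is a bounded second derivative of the second solution, or \<gamma>, times a difference of
  first derivatives. Both equations evaluate \<gamma> at the same \<open>p\<close>, so only its size
  enters and not its modulus of continuity.\<close>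

lemma height_sol_diff:
  assumes 1: "height_sol H1 a1 b1 hqq1 hqp1 hpp1" and 2: "height_sol H2 a2 b2 hqq2 hqp2 hpp2"
  shows "lin_sol (\<lambda>z. H1 z - H2 z) (\<lambda>z. a1 z - a2 z) (\<lambda>z. b1 z - b2 z)
     (\<lambda>z. hqq1 z - hqq2 z) (\<lambda>z. hqp1 z - hqp2 z) (\<lambda>z. hpp1 z - hpp2 z)"
proof -
  note s1 = 1[unfolded height_sol_def] and s2 = 2[unfolded height_sol_def]
  have M: "0 < M" using m by simp
  have "elliptic_at m M K (\<lambda>z. a1 z - a2 z) (\<lambda>z. b1 z - b2 z)
     (\<lambda>z. hqq1 z - hqq2 z) (\<lambda>z. hqp1 z - hqp2 z) (\<lambda>z. hpp1 z - hpp2 z) z" if z: "z \<in> strip" for z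
  proof -
    have pr: "z = (fst z, snd z)" "snd z \<in> {p0<..0}" using z by (auto simp: mem_Times_iff)
    have ab: "\<bar>a1 z\<bar> \<le> M" "m \<le> b1 z" "b1 z \<le> M" "\<bar>a2 z\<bar> \<le> M" "m \<le> b2 z" "b2 z \<le> M"
      using s1 s2 pr by metis+
    have h2: "\<bar>hqq2 z\<bar> \<le> M" "\<bar>hqp2 z\<bar> \<le> M" "\<bar>hpp2 z\<bar> \<le> M" "\<bar>\<gamma> (snd z)\<bar> \<le> M" using s2 z by blast+
    have e1: "hpp1 z + ((b1 z)\<^sup>2 * hqq1 z - 2 * a1 z * b1 z * hqp1 z + (a1 z)\<^sup>2 * hpp1 z) = \<gamma> (snd z) * b1 z ^ 3"
      and e2: "hpp2 z + ((b2 z)\<^sup>2 * hqq2 z - 2 * a2 z * b2 z * hqp2 z + (a2 z)\<^sup>2 * hpp2 z) = \<gamma> (snd z) * b2 z ^ 3"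
      using s1 s2 z by blast+
    define \<alpha> \<beta> where "\<alpha> = a1 z - a2 z" and "\<beta> = b1 z - b2 z"
    define Lw where "Lw = (hpp1 z - hpp2 z) + ((b1 z)\<^sup>2 * (hqq1 z - hqq2 z) - 2 * a1 z * b1 z * (hqp1 z - hqp2 z) + (a1 z)\<^sup>2 * (hpp1 z - hpp2 z))"
    have eq: "Lw = \<gamma> (snd z) * ((b1 z)\<^sup>2 + b1 z * b2 z + (b2 z)\<^sup>2) * \<beta> - (b1 z + b2 z) * hqq2 z * \<beta>
       + 2 * b1 z * hqp2 z * \<alpha> + 2 * a2 z * hqp2 z * \<beta> - (a1 z + a2 z) * hpp2 z * \<alpha>"
    proof -
      have "Lw = \<gamma> (snd z) * b1 z ^ 3 - \<gamma> (snd z) * b2 z ^ 3 - (((b1 z)\<^sup>2 - (b2 z)\<^sup>2) * hqq2 z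
         - 2 * (a1 z * b1 z - a2 z * b2 z) * hqp2 z + ((a1 z)\<^sup>2 - (a2 z)\<^sup>2) * hpp2 z)"
        unfolding Lw_def using e1 e2 by (simp add: algebra_simps)
      then show ?thesis unfolding \<alpha>_def \<beta>_def by (simp add: algebra_simps power2_eq_square power3_eq_cube)
    qed
    have prod2: "\<bar>x * y\<bar> \<le> c * d" if "\<bar>x\<bar> \<le> c" "\<bar>y\<bar> \<le> d" for x y c d :: real
      unfolding abs_mult using that by (intro mult_mono) auto
    have sq: "\<bar>(b1 z)\<^sup>2 + b1 z * b2 z + (b2 z)\<^sup>2\<bar> \<le> 3 * M\<^sup>2"
      using prod2[of "b1 z" M "b1 z" M] prod2[of "b1 z" M "b2 z" M] prod2[of "b2 z" M "b2 z" M] ab m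
      by (simp add: power2_eq_square)
    have t1: "\<bar>\<gamma> (snd z) * ((b1 z)\<^sup>2 + b1 z * b2 z + (b2 z)\<^sup>2) * \<beta>\<bar> \<le> (M * (3 * M\<^sup>2)) * \<bar>\<beta>\<bar>"
      using h2 sq by (intro prod2) auto
    have t2: "\<bar>(b1 z + b2 z) * hqq2 z * \<beta>\<bar> \<le> (2 * M * M) * \<bar>\<beta>\<bar>"
      using h2 ab m by (intro prod2) auto
    have t3: "\<bar>2 * b1 z * hqp2 z * \<alpha>\<bar> \<le> (2 * M * M) * \<bar>\<alpha>\<bar>"
      using h2 ab m by (intro prod2) auto
    have t4: "\<bar>2 * a2 z * hqp2 z * \<beta>\<bar> \<le> (2 * M * M) * \<bar>\<beta>\<bar>"
      using h2 ab m by (intro prod2) auto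
    have t5: "\<bar>(a1 z + a2 z) * hpp2 z * \<alpha>\<bar> \<le> (2 * M * M) * \<bar>\<alpha>\<bar>"
      using h2 ab m by (intro prod2) auto
    have "\<bar>Lw\<bar> \<le> (M * (3 * M\<^sup>2)) * \<bar>\<beta>\<bar> + (2 * M * M) * \<bar>\<beta>\<bar> + (2 * M * M) * \<bar>\<alpha>\<bar> + (2 * M * M) * \<bar>\<beta>\<bar> + (2 * M * M) * \<bar>\<alpha>\<bar>"
    proof -
      have tri: "\<bar>x1 - x2 + x3 + x4 - x5\<bar> \<le> \<bar>x1\<bar> + \<bar>x2\<bar> + \<bar>x3\<bar> + \<bar>x4\<bar> + \<bar>x5\<bar>"
        for x1 x2 x3 x4 x5 :: real by linarith
      show ?thesis unfolding eq by (rule order_trans[OF tri]) (intro add_mono t1 t2 t3 t4 t5)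
    qed
    also have "\<dots> \<le> (3 * M ^ 3 + 6 * M\<^sup>2) * (\<bar>\<alpha>\<bar> + \<bar>\<beta>\<bar>)"
    proof -
      have "0 \<le> M ^ 3 * \<bar>\<alpha>\<bar>" "0 \<le> M\<^sup>2 * \<bar>\<alpha>\<bar>" "0 \<le> M\<^sup>2 * \<bar>\<beta>\<bar>" using M by auto
      moreover have "(3 * M ^ 3 + 6 * M\<^sup>2) * (\<bar>\<alpha>\<bar> + \<bar>\<beta>\<bar>) =
        ((M * (3 * M\<^sup>2)) * \<bar>\<beta>\<bar> + (2 * M * M) * \<bar>\<beta>\<bar> + (2 * M * M) * \<bar>\<alpha>\<bar> + (2 * M * M) * \<bar>\<beta>\<bar> + (2 * M * M) * \<bar>\<alpha>\<bar>)
        + 3 * (M ^ 3 * \<bar>\<alpha>\<bar>) + 2 * (M\<^sup>2 * \<bar>\<alpha>\<bar>) + 2 * (M\<^sup>2 * \<bar>\<beta>\<bar>)"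
        by (simp add: algebra_simps power2_eq_square power3_eq_cube)
      ultimately show ?thesis by linarith
    qed
    also have "\<dots> \<le> K * (\<bar>\<alpha>\<bar> + \<bar>\<beta>\<bar>)"
      unfolding K_def using m g by (intro mult_right_mono) auto
    finally show ?thesis
      unfolding elliptic_at_def Lw_def \<alpha>_def \<beta>_def using ab by (intro exI[of _ "a1 z"] exI[of _ "b1 z"]) auto
  qed
  moreover have "\<bar>b1 (q, 0) - b2 (q, 0)\<bar> \<le> K * (\<bar>H1 (q, 0) - H2 (q, 0)\<bar> + \<bar>a1 (q, 0) - a2 (q, 0)\<bar>)" for q
  proof -
    define A1 B1 A2 B2 W where "A1 = a1 (q, 0)" and "B1 = b1 (q, 0)" and "A2 = a2 (q, 0)"
      and "B2 = b2 (q, 0)" and "W = H1 (q, 0) - H2 (q, 0)"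
    have z: "(0::real) \<in> {p0<..0}" using p0 by simp
    have ab: "\<bar>A1\<bar> \<le> M" "m \<le> B1" "B1 \<le> M" "\<bar>A2\<bar> \<le> M" "m \<le> B2" "B2 \<le> M"
      using s1 s2 z unfolding A1_def B1_def A2_def B2_def by metis+
    have e1: "(1 + A1\<^sup>2) / B1\<^sup>2 + 2 * g * H1 (q, 0) = Q" and e2: "(1 + A2\<^sup>2) / B2\<^sup>2 + 2 * g * H2 (q, 0) = Q"
      using s1 s2 unfolding A1_def B1_def A2_def B2_def by blast+
    define R where "R = (1 + A1\<^sup>2) / B1\<^sup>2"
    have B: "0 < B1" "0 < B2" using ab m by auto
    have R1: "R * B1\<^sup>2 = 1 + A1\<^sup>2" using B by (simp add: R_def)
    have R2: "(R + 2 * g * W) * B2\<^sup>2 = 1 + A2\<^sup>2"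
    proof -
      have "R + 2 * g * W = (1 + A2\<^sup>2) / B2\<^sup>2" using e1 e2 unfolding R_def W_def by (simp add: algebra_simps)
      then show ?thesis using B by simp
    qed
    \<comment> \<open>The Bernoulli conditions are cleared of denominators and subtracted. The left
      factor is bounded below, so the equation can be solved for \<open>B1 - B2\<close>.\<close>
    have main: "R * (B1 + B2) * (B1 - B2) = (A1 + A2) * (A1 - A2) + 2 * g * W * B2\<^sup>2"
      using R1 R2 by (simp add: algebra_simps power2_eq_square)
    have Rlow: "1 / M\<^sup>2 \<le> R"
    proof -
      have "B1\<^sup>2 \<le> M\<^sup>2" using ab B by (intro power_mono) auto
      then have "1 / M\<^sup>2 \<le> 1 / B1\<^sup>2" using B M by (intro divide_left_mono) auto
      also have "\<dots> \<le> R" unfolding R_def by (intro divide_right_mono) auto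
      finally show ?thesis .
    qed
    have "1 / M\<^sup>2 * (2 * m) * \<bar>B1 - B2\<bar> \<le> R * (B1 + B2) * \<bar>B1 - B2\<bar>"
      using Rlow ab m M by (intro mult_right_mono mult_mono) (auto intro: order_trans[OF _ Rlow])
    also have "\<dots> = \<bar>(A1 + A2) * (A1 - A2) + 2 * g * W * B2\<^sup>2\<bar>"
    proof -
      have "0 \<le> R * (B1 + B2)" using B by (simp add: R_def)
      then show ?thesis unfolding main[symmetric]
        by (simp only: abs_mult[of "R * (B1 + B2)"] abs_of_nonneg)
    qed
    also have "\<dots> \<le> 2 * M * \<bar>A1 - A2\<bar> + 2 * g * \<bar>W\<bar> * M\<^sup>2"
    proof -
      have "\<bar>(A1 + A2) * (A1 - A2)\<bar> \<le> 2 * M * \<bar>A1 - A2\<bar>"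
        unfolding abs_mult using ab by (intro mult_right_mono) auto
      moreover have "\<bar>2 * g * W * B2\<^sup>2\<bar> \<le> 2 * g * \<bar>W\<bar> * M\<^sup>2"
        using g ab B by (auto simp: abs_mult intro!: mult_left_mono power_mono)
      ultimately show ?thesis by linarith
    qed
    finally have "1 / M\<^sup>2 * (2 * m) * \<bar>B1 - B2\<bar> \<le> 2 * M * \<bar>A1 - A2\<bar> + 2 * g * \<bar>W\<bar> * M\<^sup>2" .
    then have "(M\<^sup>2 / (2 * m)) * (1 / M\<^sup>2 * (2 * m) * \<bar>B1 - B2\<bar>) \<le> (M\<^sup>2 / (2 * m)) * (2 * M * \<bar>A1 - A2\<bar> + 2 * g * \<bar>W\<bar> * M\<^sup>2)"
      using m by (intro mult_left_mono) auto
    then have "\<bar>B1 - B2\<bar> \<le> M ^ 3 / m * \<bar>A1 - A2\<bar> + g * M ^ 4 / m * \<bar>W\<bar>"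
      using m M by (simp add: field_simps power2_eq_square power3_eq_cube power4_eq_xxxx)
    also have "\<dots> \<le> K * \<bar>A1 - A2\<bar> + K * \<bar>W\<bar>"
      unfolding K_def using m g by (intro add_mono mult_right_mono) auto
    finally show ?thesis unfolding A1_def B1_def A2_def B2_def W_def by (simp add: algebra_simps)
  qed
  moreover have "\<forall>q. ((\<lambda>s. H1 (s, 0) - H2 (s, 0)) has_real_derivative a1 (q, 0) - a2 (q, 0)) (at q)"
    "\<forall>q. ((\<lambda>s. H1 (q, s) - H2 (q, s)) has_real_derivative b1 (q, 0) - b2 (q, 0)) (at 0 within {p0..0})"
    using s1 s2 by (auto intro!: DERIV_diff)
  moreover have "hess_on strip (\<lambda>z. H1 z - H2 z) (\<lambda>z. a1 z - a2 z) (\<lambda>z. b1 z - b2 z)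
     (\<lambda>z. hqq1 z - hqq2 z) (\<lambda>z. hqp1 z - hqp2 z) (\<lambda>z. hpp1 z - hpp2 z)"
    using s1 s2 by (intro hess_on_diff) blast+
  moreover have "continuous_on (UNIV \<times> {p0..0}) (\<lambda>z. H1 z - H2 z)"
    using s1 s2 by (intro continuous_on_diff) blast+
  ultimately show ?thesis unfolding lin_sol_def by blast
qed

text \<open>Each q-derivative contributes a factor \<sigma>. The factors cancel in the equation and
  in the Bernoulli condition, because \<open>a\<close> and \<open>hqp\<close> occur there only in
  even total degree.\<close>

lemma height_sol_affine:
  assumes H: "height_sol H a b hqq hqp hpp" and \<sigma>: "\<sigma> = 1 \<or> \<sigma> = -1"
  shows "height_sol (\<lambda>z. H (\<tau> + \<sigma> * fst z, snd z)) (\<lambda>z. \<sigma> * a (\<tau> + \<sigma> * fst z, snd z))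
     (\<lambda>z. b (\<tau> + \<sigma> * fst z, snd z)) (\<lambda>z. hqq (\<tau> + \<sigma> * fst z, snd z))
     (\<lambda>z. \<sigma> * hqp (\<tau> + \<sigma> * fst z, snd z)) (\<lambda>z. hpp (\<tau> + \<sigma> * fst z, snd z))"
proof -
  note h = H[unfolded height_sol_def]
  have hH: "hess_on strip H a b hqq hqp hpp" using h by blast
  define \<Phi> where "\<Phi> z = (\<tau> + \<sigma> * fst z, snd z)" for z :: "real \<times> real"
  have D: "((\<lambda>z. k (\<Phi> z)) has_derivative (\<lambda>h. k' * (\<sigma> * fst h) + k'' * snd h)) (at z)"
    if "(k has_derivative (\<lambda>h. k' * fst h + k'' * snd h)) (at (\<Phi> z))" for k k' k'' z
  proof -
    have "(\<Phi> has_derivative (\<lambda>h. (\<sigma> * fst h, snd h))) (at z)"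
      unfolding \<Phi>_def by (auto intro!: derivative_eq_intros)
    from has_derivative_compose[OF this that] show ?thesis by simp
  qed
  have in_strip: "\<Phi> z \<in> strip" if "z \<in> strip" for z using that by (auto simp: \<Phi>_def)
  have hess: "hess_on strip (\<lambda>z. H (\<Phi> z)) (\<lambda>z. \<sigma> * a (\<Phi> z)) (\<lambda>z. b (\<Phi> z)) (\<lambda>z. hqq (\<Phi> z))
     (\<lambda>z. \<sigma> * hqp (\<Phi> z)) (\<lambda>z. hpp (\<Phi> z))"
    unfolding hess_on_def
  proof (intro ballI conjI)
    fix z assume "z \<in> strip"
    then have "\<Phi> z \<in> strip" by (rule in_strip)
    note dd = hH[unfolded hess_on_def, rule_format, OF this]
    have d: "(H has_derivative (\<lambda>h. a (\<Phi> z) * fst h + b (\<Phi> z) * snd h)) (at (\<Phi> z))"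
      "(a has_derivative (\<lambda>h. hqq (\<Phi> z) * fst h + hqp (\<Phi> z) * snd h)) (at (\<Phi> z))"
      "(b has_derivative (\<lambda>h. hqp (\<Phi> z) * fst h + hpp (\<Phi> z) * snd h)) (at (\<Phi> z))"
      using dd by auto
    show "((\<lambda>z. H (\<Phi> z)) has_derivative (\<lambda>h. \<sigma> * a (\<Phi> z) * fst h + b (\<Phi> z) * snd h)) (at z)"
      using D[OF d(1)] by (simp add: mult.assoc mult.left_commute)
    show "((\<lambda>z. b (\<Phi> z)) has_derivative (\<lambda>h. \<sigma> * hqp (\<Phi> z) * fst h + hpp (\<Phi> z) * snd h)) (at z)"
      using D[OF d(3)] by (simp add: mult.assoc mult.left_commute)
    have "((\<lambda>z. \<sigma> * a (\<Phi> z)) has_derivative (\<lambda>h. \<sigma> * (hqq (\<Phi> z) * (\<sigma> * fst h) + hqp (\<Phi> z) * snd h))) (at z)"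
      by (intro has_derivative_mult_right D d)
    moreover have "(\<lambda>h. \<sigma> * (hqq (\<Phi> z) * (\<sigma> * fst h) + hqp (\<Phi> z) * snd h)) =
        (\<lambda>h::real\<times>real. hqq (\<Phi> z) * fst h + \<sigma> * hqp (\<Phi> z) * snd h)"
      using \<sigma> by (auto simp: fun_eq_iff algebra_simps)
    ultimately show "((\<lambda>z. \<sigma> * a (\<Phi> z)) has_derivative (\<lambda>h. hqq (\<Phi> z) * fst h + \<sigma> * hqp (\<Phi> z) * snd h)) (at z)"
      by simp
  qed
  have cont: "continuous_on (UNIV \<times> {p0..0}) (\<lambda>z. H (\<Phi> z))"
  proof (rule continuous_on_compose2[of "UNIV \<times> {p0..0}" H])
    show "continuous_on (UNIV \<times> {p0..0}) \<Phi>" unfolding \<Phi>_def by (intro continuous_intros)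
  qed (use h in \<open>auto simp: \<Phi>_def\<close>)
  have top: "((\<lambda>s. H (\<tau> + \<sigma> * s, 0)) has_real_derivative \<sigma> * a (\<tau> + \<sigma> * q, 0)) (at q)" for q
  proof -
    have l: "((\<lambda>s. \<tau> + \<sigma> * s) has_real_derivative \<sigma>) (at q)" by (auto intro!: derivative_eq_intros)
    have "((\<lambda>s. H (s, 0)) has_real_derivative a (\<tau> + \<sigma> * q, 0)) (at (\<tau> + \<sigma> * q))" using h by blast
    from DERIV_chain2[OF this l] show ?thesis by (simp add: mult.commute)
  qed
  have b1: "\<bar>\<sigma> * x\<bar> = \<bar>x\<bar>" and b2: "(\<sigma> * x)\<^sup>2 = x\<^sup>2" for x using \<sigma> by auto
  have b3: "2 * (\<sigma> * x) * y * (\<sigma> * z) = 2 * x * y * z" for x y z using \<sigma> by auto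
  show ?thesis
    unfolding height_sol_def using hess cont[unfolded \<Phi>_def] top h in_strip unfolding \<Phi>_def
    by (auto simp: b1 b2 b3 mem_Times_iff)
qed

text \<open>The quotient of \<open>w\<close> by the positive function \<phi> attains a minimum.
  There a negative multiple of \<phi> touches \<open>w\<close> from below.\<close>

lemma lin_sol_rect_min:
  fixes \<phi> :: "real \<times> real \<Rightarrow> real"
  assumes w: "lin_sol w wq wp wqq wqp wpp" and "l \<le> r"
    and \<phi>: "continuous_on (UNIV \<times> {p0..0}) \<phi>" "\<And>z. z \<in> {l..r} \<times> {p0..0} \<Longrightarrow> 0 < \<phi> z"
    and z1: "z1 \<in> {l..r} \<times> {p0..0}" "w z1 < 0"
  obtains z k where "z \<in> {l..r} \<times> {p0..0}" "0 < k" "w z = - k * \<phi> z"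
    "\<And>y. y \<in> {l..r} \<times> {p0..0} \<Longrightarrow> - k * \<phi> y \<le> w y"
proof -
  let ?R = "{l..r} \<times> {p0..0}"
  have "continuous_on ?R w" using w unfolding lin_sol_def by (auto intro: continuous_on_subset)
  moreover have "continuous_on ?R \<phi>" using \<phi>(1) by (auto intro: continuous_on_subset)
  ultimately have "continuous_on ?R (\<lambda>z. w z / \<phi> z)"
    using \<phi>(2) by (intro continuous_on_divide) (auto dest: \<phi>(2) simp: less_le)
  moreover have "compact ?R" "?R \<noteq> {}" using z1 by (auto intro!: compact_Times)
  ultimately obtain z where z: "z \<in> ?R" "\<forall>y\<in>?R. w z / \<phi> z \<le> w y / \<phi> y"
    using continuous_attains_inf[of ?R "\<lambda>z. w z / \<phi> z"] by blast
  show ?thesis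
  proof (rule that[of z "- (w z / \<phi> z)"])
    have "w z / \<phi> z \<le> w z1 / \<phi> z1" using z z1 by blast
    also have "\<dots> < 0" using z1 \<phi>(2) by (simp add: divide_neg_pos)
    finally show "0 < - (w z / \<phi> z)" by simp
    show "w z = - (- (w z / \<phi> z)) * \<phi> z" using \<phi>(2)[OF z(1)] by simp
    fix y assume y: "y \<in> ?R"
    then have "w z / \<phi> z * \<phi> y \<le> w y / \<phi> y * \<phi> y" using z(2) \<phi>(2)[OF y] by (intro mult_right_mono) auto
    then show "- (- (w z / \<phi> z)) * \<phi> y \<le> w y" using \<phi>(2)[OF y] by simp
  qed (rule z)
qed

section \<open>Weak maximum principles with a barrier in the vertical variable\<close>

definition weak_barrier :: "real \<times> real \<Rightarrow> real" where
  "weak_barrier z = exp (- (K + 1) * p0) + 1 - exp (- (K + 1) * snd z)"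

lemma weak_barrier_pos: "p0 \<le> snd z \<Longrightarrow> 0 < weak_barrier z"
  unfolding weak_barrier_def using K_nonneg
  by (smt (verit) exp_le_cancel_iff mult_left_mono_neg)

text \<open>Up to a constant the multiple is \<open>k * exp (- c * p)\<close> with rate
  \<open>c = K + 1\<close>. Its second derivative carries \<open>c\<^sup>2\<close> and beats the
  admissible first-order term, which carries \<open>K * c\<close>.\<close>

lemma weak_barrier_no_touch:
  assumes w: "lin_sol w wq wp wqq wqp wpp"
    and N: "open N" "z \<in> N" "N \<subseteq> strip" and k: "0 < k"
    and le: "\<forall>y\<in>N. - k * weak_barrier y \<le> w y" and eq: "w z = - k * weak_barrier z"
  shows False
proof -
  define c where "c = K + 1"
  have c: "c > K" "c > 0" using K_nonneg by (auto simp: c_def)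
  define C where "C = exp (- c * p0) + 1"
  define \<beta> where "\<beta> p = k * exp (- c * p) - k * C" for p
  have b: "- k * weak_barrier y = 0 + \<beta> (snd y)" for y
    by (simp add: weak_barrier_def \<beta>_def C_def c_def[symmetric] right_diff_distrib distrib_left)
  have hb: "hess_on N (\<lambda>z. 0 + \<beta> (snd z)) (\<lambda>z. 0) (\<lambda>z. - k * c * exp (- c * snd z)) (\<lambda>z. 0) (\<lambda>z. 0)
      (\<lambda>z. k * c\<^sup>2 * exp (- c * snd z))"
    unfolding \<beta>_def
    by (rule hess_on_separable[where \<alpha> = "\<lambda>_. 0" and \<alpha>' = "\<lambda>_. 0" and \<alpha>'' = "\<lambda>_. 0"])
      (auto intro!: derivative_eq_intros simp: power2_eq_square)
  have hw: "hess_on N w wq wp wqq wqp wpp"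
    using w N(3) unfolding lin_sol_def by (auto intro: hess_on_subset)
  have el: "elliptic_at m M K wq wp wqq wqp wpp z" using w N unfolding lin_sol_def by blast
  have sub: "strict_sub_at m M K (\<lambda>z. 0) (\<lambda>z. - k * c * exp (- c * snd z)) (\<lambda>z. 0) (\<lambda>z. 0)
      (\<lambda>z. k * c\<^sup>2 * exp (- c * snd z)) z"
    unfolding strict_sub_at_def
  proof (intro allI impI)
    fix A B :: real
    define E where "E = k * c * exp (- c * snd z)"
    have E: "E > 0" using k c by (simp add: E_def)
    have "K * E < c * E" using E c by simp
    also have "\<dots> \<le> c * E + A\<^sup>2 * (c * E)" using E c by simp
    finally show "K * (\<bar>0\<bar> + \<bar>- k * c * exp (- c * snd z)\<bar>)
        < k * c\<^sup>2 * exp (- c * snd z) + (B\<^sup>2 * 0 - 2 * A * B * 0 + A\<^sup>2 * (k * c\<^sup>2 * exp (- c * snd z)))"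
      using k c unfolding E_def by (simp add: power2_eq_square mult_ac abs_mult)
  qed
  show False
    by (rule no_touching[OF N(1,2) hw hb _ _ el sub]) (use le eq b in auto)
qed

lemma weak_maximum_rect:
  assumes w: "lin_sol w wq wp wqq wqp wpp" and "l \<le> r"
    and sides: "\<And>p. p \<in> {p0..0} \<Longrightarrow> 0 \<le> w (l, p) \<and> 0 \<le> w (r, p)"
    and bt: "\<And>q. q \<in> {l..r} \<Longrightarrow> 0 \<le> w (q, p0) \<and> 0 \<le> w (q, 0)"
    and z1: "z1 \<in> {l..r} \<times> {p0..0}"
  shows "0 \<le> w z1"
proof (rule ccontr)
  assume "\<not> 0 \<le> w z1"
  then have neg: "w z1 < 0" by simp
  have cb: "continuous_on (UNIV \<times> {p0..0}) weak_barrier"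
    unfolding weak_barrier_def by (intro continuous_intros)
  obtain z k where z: "z \<in> {l..r} \<times> {p0..0}" "0 < k" "w z = - k * weak_barrier z"
    "\<And>y. y \<in> {l..r} \<times> {p0..0} \<Longrightarrow> - k * weak_barrier y \<le> w y"
    by (rule lin_sol_rect_min[OF w assms(2) cb _ z1 neg]) (auto intro: weak_barrier_pos)
  have "w z < 0" using z(2,3) weak_barrier_pos[of z] z(1) by (auto simp: mem_Times_iff)
  with sides[of "snd z"] bt[of "fst z"] z(1) have "z \<in> {l<..<r} \<times> {p0<..<0}"
    by (cases z) (auto simp: order_less_le)
  then show False
    by (intro weak_barrier_no_touch[OF w _ _ _ z(2) _ z(3), of "{l<..<r} \<times> {p0<..<0}"])
      (use z(4) in \<open>auto intro!: open_Times\<close>)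
qed

text \<open>The barrier does not depend on \<open>q\<close>, so a multiple touching \<open>w\<close>
  from below on one period cell stays below \<open>w\<close> on the whole strip. A touching point on
  a lateral side of the cell is then an interior point of the strip.\<close>

lemma weak_maximum_periodic:
  assumes w: "lin_sol w wq wp wqq wqp wpp" and "0 < L"
    and per: "\<And>q p. p \<in> {p0..0} \<Longrightarrow> w (q + L, p) = w (q, p)"
    and bt: "\<And>q. 0 \<le> w (q, p0) \<and> 0 \<le> w (q, 0)"
    and p: "p \<in> {p0..0}"
  shows "0 \<le> w (q, p)"
proof (rule ccontr)
  assume neg: "\<not> 0 \<le> w (q, p)"
  have per': "w (q + of_int k * L, p) = w (q, p)" if "p \<in> {p0..0}" for q p k
    using periodic_shift[of "\<lambda>q. w (q, p)" L] per that by blast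
  obtain k' where k': "q + of_int k' * L \<in> {0..<0 + L}" using periodic_reduce[OF assms(2)] .
  have neg': "w (q + of_int k' * L, p) < 0" using neg per'[OF p] by simp
  have in_rect: "(q + of_int k' * L, p) \<in> {0..L} \<times> {p0..0}" using k' p by auto
  have cb: "continuous_on (UNIV \<times> {p0..0}) weak_barrier"
    unfolding weak_barrier_def by (intro continuous_intros)
  obtain z k where z: "z \<in> {0..L} \<times> {p0..0}" "0 < k" "w z = - k * weak_barrier z"
    "\<And>y. y \<in> {0..L} \<times> {p0..0} \<Longrightarrow> - k * weak_barrier y \<le> w y"
    by (rule lin_sol_rect_min[OF w less_imp_le[OF assms(2)] cb _ in_rect neg']) (auto intro: weak_barrier_pos)
  have "w z < 0" using z(2,3) weak_barrier_pos[of z] z(1) by (auto simp: mem_Times_iff)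
  with bt[of "fst z"] z(1) have zs: "z \<in> strip" by (cases z) (auto simp: order_less_le)
  have le: "- k * weak_barrier y \<le> w y" if "y \<in> strip" for y
  proof -
    obtain j where j: "fst y + of_int j * L \<in> {0..<0 + L}" using periodic_reduce[OF assms(2)] .
    have "- k * weak_barrier (fst y + of_int j * L, snd y) \<le> w (fst y + of_int j * L, snd y)"
      using j that by (intro z(4)) auto
    also have "\<dots> = w y" using per'[of "snd y" "fst y" j] that by auto
    finally show ?thesis by (simp add: weak_barrier_def)
  qed
  show False
    by (rule weak_barrier_no_touch[OF w open_strip zs _ z(2) _ z(3)]) (use le in auto)
qed

section \<open>Positivity on the top boundary\<close>

lemma top_tangential_zero:
  assumes w: "lin_sol w wq wp wqq wqp wpp" and "l < q" "q < r"
    and "\<And>s. s \<in> {l..r} \<Longrightarrow> 0 \<le> w (s, 0)" "w (q, 0) = 0"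
  shows "wq (q, 0) = 0" "wp (q, 0) = 0"
proof -
  have D: "((\<lambda>s. w (s, 0)) has_real_derivative wq (q, 0)) (at q)" using w unfolding lin_sol_def by blast
  show "wq (q, 0) = 0"
    by (rule DERIV_local_min[OF D, of "min (q - l) (r - q)"]) (use assms(2-5) in \<open>auto simp: abs_if split: if_splits\<close>)
  moreover have "\<bar>wp (q, 0)\<bar> \<le> K * (\<bar>w (q, 0)\<bar> + \<bar>wq (q, 0)\<bar>)" using w unfolding lin_sol_def by blast
  ultimately show "wp (q, 0) = 0" using assms(5) by simp
qed

text \<open>At a zero on the top the tangential derivative vanishes by minimality, and the
  linearised Bernoulli condition makes the normal derivative vanish too, its zero-order term being
  multiplied by \<open>w (q, 0) = 0\<close>. Hopf's bound in a ball tangent to the top from below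
  excludes this.\<close>

lemma top_positive:
  assumes w: "lin_sol w wq wp wqq wqp wpp" and q: "l < q" "q < r"
    and pos: "\<And>z. z \<in> {l<..<r} \<times> {p0<..<0} \<Longrightarrow> 0 < w z"
    and nonneg: "\<And>z. z \<in> {l..r} \<times> {p0..0} \<Longrightarrow> 0 \<le> w z"
  shows "0 < w (q, 0)"
proof (rule ccontr)
  assume "\<not> 0 < w (q, 0)"
  then have w0: "w (q, 0) = 0" using nonneg[of "(q, 0)"] q p0 by simp
  have wp0: "wp (q, 0) = 0"
    using top_tangential_zero[OF w q _ w0] nonneg p0 by auto
  \<comment> \<open>A third of the smallest of the distances to the sides and the depth: the tangent
    ball stays inside the rectangle and meets the top only at \<open>(q, 0)\<close>.\<close>
  define \<rho> where "\<rho> = min (min (q - l) (r - q)) (- p0) / 3"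
  have \<rho>: "0 < \<rho>" "\<rho> < q - l" "\<rho> < r - q" "2 * \<rho> < - p0" using q p0 unfolding \<rho>_def min_def by (auto split: if_splits)
  define z0 where "z0 = (q, - \<rho>)"
  have cb: "y \<in> {l<..<r} \<times> {p0<..0}" if "y \<in> cball z0 \<rho>" for y
  proof -
    have "\<bar>fst y - q\<bar> \<le> \<rho>" "\<bar>snd y + \<rho>\<bar> \<le> \<rho>"
      using that dist_fst_le[of z0 y] dist_snd_le[of z0 y] by (auto simp: z0_def dist_real_def)
    then show ?thesis using \<rho> by (cases y) auto
  qed
  have ba: "y \<in> {l<..<r} \<times> {p0<..<0}" if "y \<in> ball z0 \<rho>" for y
  proof -
    have "\<bar>snd y + \<rho>\<bar> < \<rho>"
      using that dist_snd_le[of z0 y] by (auto simp: z0_def dist_real_def)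
    then show ?thesis using cb[of y] that by (cases y) auto
  qed
  have bs: "ball z0 \<rho> \<subseteq> strip" using ba by auto
  have hw: "hess_on (ball z0 \<rho>) w wq wp wqq wqp wpp"
    using w bs unfolding lin_sol_def by (blast intro: hess_on_subset)
  have cw: "continuous_on (cball z0 \<rho>) w"
  proof -
    have "cball z0 \<rho> \<subseteq> UNIV \<times> {p0..0}" using cb by force
    moreover have "continuous_on (UNIV \<times> {p0..0}) w" using w unfolding lin_sol_def by blast
    ultimately show ?thesis by (rule continuous_on_subset[rotated])
  qed
  have el: "elliptic_at m M K wq wp wqq wqp wpp y" if "y \<in> ball z0 \<rho>" for y
    using w bs that unfolding lin_sol_def by blast
  obtain \<epsilon> where \<epsilon>: "\<epsilon> > 0" "\<And>s. 0 \<le> s \<Longrightarrow> s \<le> 1/2 \<Longrightarrow> \<epsilon> * s \<le> w ((q, 0) + s *\<^sub>R (z0 - (q, 0)))"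
  proof (rule hopf[OF m K_nonneg \<rho>(1) hw el _ cw])
    show "0 < w z" if "z \<in> ball z0 \<rho>" for z using pos ba that by blast
    show "0 \<le> w z" if "z \<in> cball z0 \<rho>" for z using nonneg[of z] cb[OF that] by auto
    show "dist z0 (q, 0) = \<rho>" using \<rho>(1) by (simp add: z0_def dist_Pair_Pair dist_real_def)
  qed (use w0 in auto)
  have "((\<lambda>s. w (q, s)) has_real_derivative 0) (at 0 within {p0..0})"
    using w wp0 unfolding lin_sol_def by metis
  then have "((\<lambda>s. w (q, s) / s) \<longlongrightarrow> 0) (at 0 within {p0..0})"
    using w0 unfolding has_field_derivative_iff by simp
  moreover have "\<forall>\<^sub>F s in at 0 within {p0..0}. w (q, s) / s \<le> - (\<epsilon> / \<rho>)"
    unfolding eventually_at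
  proof (intro exI[of _ "\<rho> / 2"] conjI ballI impI)
    fix s assume "s \<in> {p0..0}" "s \<noteq> 0 \<and> dist s 0 < \<rho> / 2"
    then have s: "s < 0" "- s / \<rho> \<le> 1/2" using \<rho>(1) by (auto simp: dist_real_def field_simps)
    have "\<epsilon> * (- s / \<rho>) \<le> w ((q, 0) + (- s / \<rho>) *\<^sub>R (z0 - (q, 0)))"
      using s \<rho>(1) divide_nonneg_pos[of "- s" \<rho>] by (intro \<epsilon>(2)) auto
    also have "(q, 0) + (- s / \<rho>) *\<^sub>R (z0 - (q, 0)) = (q, s)" using \<rho>(1) by (simp add: z0_def)
    finally show "w (q, s) / s \<le> - (\<epsilon> / \<rho>)" using s(1) by (simp add: neg_divide_le_eq)
  qed (use \<rho> in auto)
  moreover have "at 0 within {p0..0} \<noteq> bot" using p0 by (simp add: trivial_limit_within islimpt_Icc)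
  ultimately have "0 \<le> - (\<epsilon> / \<rho>)" by (intro tendsto_upperbound)
  then show False using \<epsilon>(1) \<rho>(1) by (simp add: field_simps)
qed

text \<open>The number \<delta> is fixed before \<open>w\<close> and the rectangle; it depends only
  on the bound \<Lambda> for the width. Moving planes use this uniformity twice. A rectangle
  narrower than \<open>2 * \<delta>\<close> has an empty inner part, so nothing has to be checked
  for the first planes. Later, the sign on compact inner parts is stable under small moves of the
  plane.\<close>

lemma narrow_maximum:
  assumes "\<Lambda> > 0"
  shows "\<exists>\<delta>>0. \<forall>w wq wp wqq wqp wpp l r. lin_sol w wq wp wqq wqp wpp \<and> l \<le> r \<and> r - l \<le> \<Lambda> \<and>
     (\<forall>p\<in>{p0..0}. 0 \<le> w (l, p) \<and> 0 \<le> w (r, p)) \<and> (\<forall>q\<in>{l..r}. 0 \<le> w (q, p0)) \<and>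
     (\<forall>q\<in>{l+\<delta>..r-\<delta>}. \<forall>p\<in>{p0+\<delta>..-\<delta>}. 0 \<le> w (q, p)) \<longrightarrow>
     (\<forall>q\<in>{l..r}. \<forall>p\<in>{p0..0}. 0 \<le> w (q, p))"
proof -
  \<comment> \<open>Half of \<kappa> is the slope that the exponential gives the barrier on the top.
    Less \<open>\<epsilon> \<le> 1\<close> it still exceeds \<open>2 * K\<close>, the most that the
    boundary condition permits.\<close>
  define \<kappa> where "\<kappa> = 2 * (2 * K + 2)"
  \<comment> \<open>Keeps the sum of the four \<open>e\<close>-terms in the barrier at most
    \<open>1/4\<close>, so that \<phi> stays at least \<open>1/4\<close> on the rectangle.\<close>
  define \<epsilon> where "\<epsilon> = min 1 (1 / (4 * (\<Lambda> - p0)))"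
  have \<epsilon>: "0 < \<epsilon>" "\<epsilon> \<le> 1" "\<epsilon> * (\<Lambda> - p0) \<le> 1/4"
  proof -
    have "0 < \<Lambda> - p0" using assms p0 by simp
    then show "0 < \<epsilon>" "\<epsilon> \<le> 1" by (auto simp: \<epsilon>_def)
    have "\<epsilon> * (\<Lambda> - p0) \<le> 1 / (4 * (\<Lambda> - p0)) * (\<Lambda> - p0)"
      using \<open>0 < \<Lambda> - p0\<close> by (intro mult_right_mono) (auto simp: \<epsilon>_def)
    also have "\<dots> = 1/4" using \<open>0 < \<Lambda> - p0\<close> by simp
    finally show "\<epsilon> * (\<Lambda> - p0) \<le> 1/4" .
  qed
  have \<kappa>: "\<kappa> > 0" using K_nonneg by (simp add: \<kappa>_def)
  define m1 where "m1 = min 1 (m\<^sup>2)"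
  have m1: "m1 > 0" "m1 \<le> 1" "m1 \<le> m\<^sup>2" using m by (auto simp: m1_def)
  \<comment> \<open>Bounds what works against the barrier: the second derivative of the exponential,
    and \<open>K\<close> times the slopes. The value of \<delta> below makes
    \<open>m1 * (\<epsilon> / (3 * \<delta>))\<close> equal to \<open>2 * G\<close>, where
    \<open>m1\<close> bounds both \<open>1 + A\<^sup>2\<close> and \<open>B\<^sup>2\<close> from
    below.\<close>
  define G where "G = (1 + M\<^sup>2) * \<kappa>\<^sup>2 / 2 + K * (2 * \<epsilon> + \<kappa> / 2)"
  have G: "0 < G" unfolding G_def using \<kappa> K_nonneg \<epsilon>
    by (intro add_pos_nonneg mult_nonneg_nonneg divide_pos_pos mult_pos_pos) (auto simp: add_pos_nonneg)
  define \<delta> where "\<delta> = m1 * \<epsilon> / (6 * G)"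
  have \<delta>: "0 < \<delta>" unfolding \<delta>_def using m1 \<epsilon> G by simp
  have \<delta>G: "G < m1 * (\<epsilon> / (3 * \<delta>))" using G m1 \<epsilon> by (simp add: \<delta>_def)
  txt \<open>The function \<open>e\<close> and its slope are small on the whole rectangle, but its second derivative is of order
    \<open>\<epsilon> / \<delta>\<close> within distance \<open>\<delta>\<close> of \<open>0\<close>; applied to the distances from the four sides it makes the
    barrier \<open>\<phi>\<close> below strictly superharmonic near the boundary. The term \<open>exp (\<kappa> * p)\<close> in \<open>\<phi>\<close> beats the
    boundary condition on the top, whose zero-order term has the wrong sign for a maximum principle.\<close>
  define e where "e s = \<epsilon> * (s - \<delta> + \<delta> * exp (- s / \<delta>))" for s
  define e' where "e' s = \<epsilon> * (1 - exp (- s / \<delta>))" for s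
  define e'' where "e'' s = \<epsilon> / \<delta> * exp (- s / \<delta>)" for s
  have De: "(e has_real_derivative e' s) (at s)" "(e' has_real_derivative e'' s) (at s)" for s
    unfolding e_def e'_def e''_def using \<delta> by (auto intro!: derivative_eq_intros simp: field_simps)
  have e_le: "e s \<le> \<epsilon> * s" if "0 \<le> s" for s
  proof -
    have "exp (- s / \<delta>) \<le> 1" using that \<delta> by simp
    then have "\<delta> * exp (- s / \<delta>) \<le> \<delta> * 1" using \<delta> by (intro mult_left_mono) auto
    then show ?thesis unfolding e_def using \<epsilon> by (intro mult_left_mono) auto
  qed
  have e_ge: "0 \<le> e s" for s
  proof -
    have "\<delta> * (1 + (- s / \<delta>)) \<le> \<delta> * exp (- s / \<delta>)" using \<delta> by (intro mult_left_mono exp_ge_add_one_self) auto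
    then show ?thesis unfolding e_def using \<epsilon> \<delta> by (intro mult_nonneg_nonneg) (auto simp: algebra_simps)
  qed
  have e'_b: "0 \<le> e' s" "e' s \<le> \<epsilon>" if "0 \<le> s" for s
    using that \<delta> \<epsilon> by (auto simp: e'_def mult_le_cancel_left1)
  have e''_pos: "0 \<le> e'' s" for s using \<epsilon> \<delta> by (simp add: e''_def)
  have e''_ge: "\<epsilon> / (3 * \<delta>) \<le> e'' s" if "s \<le> \<delta>" for s
  proof -
    have "s / \<delta> \<le> 1" using that \<delta> by simp
    then have "exp (s / \<delta>) \<le> exp 1" by simp
    also have "\<dots> \<le> 3" by (rule exp_le)
    finally have "1 / 3 \<le> exp (- s / \<delta>)" by (simp add: exp_minus field_simps)
    then have "\<epsilon> / \<delta> * (1/3) \<le> e'' s" unfolding e''_def using \<epsilon> \<delta> by (intro mult_left_mono) auto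
    then show ?thesis by (simp add: field_simps)
  qed
  show ?thesis
  proof (intro exI[of _ \<delta>] conjI allI impI ballI \<delta>, elim conjE)
    fix w wq wp wqq wqp wpp l r q p
    assume w: "lin_sol w wq wp wqq wqp wpp" and lr: "l \<le> r" "r - l \<le> \<Lambda>"
      and sides: "\<forall>p\<in>{p0..0}. 0 \<le> w (l, p) \<and> 0 \<le> w (r, p)"
      and bot: "\<forall>q\<in>{l..r}. 0 \<le> w (q, p0)"
      and inner: "\<forall>q\<in>{l+\<delta>..r-\<delta>}. \<forall>p\<in>{p0+\<delta>..-\<delta>}. 0 \<le> w (q, p)"
      and qp: "q \<in> {l..r}" "p \<in> {p0..0}"
    let ?R = "{l..r} \<times> {p0..0}"
    define \<alpha> where "\<alpha> q = - e (q - l) - e (r - q)" for q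
    define \<alpha>' where "\<alpha>' q = - e' (q - l) + e' (r - q)" for q
    define \<alpha>'' where "\<alpha>'' q = - e'' (q - l) - e'' (r - q)" for q
    define \<beta> where "\<beta> p = 1/2 + 1/2 * exp (\<kappa> * p) - e (p - p0) - e (- p)" for p
    define \<beta>' where "\<beta>' p = \<kappa> / 2 * exp (\<kappa> * p) - e' (p - p0) + e' (- p)" for p
    define \<beta>'' where "\<beta>'' p = \<kappa>\<^sup>2 / 2 * exp (\<kappa> * p) - e'' (p - p0) - e'' (- p)" for p
    have c1: "((\<lambda>x. f (x - c)) has_real_derivative f' (x - c)) (at x)" and
         c2: "((\<lambda>x. f (c - x)) has_real_derivative - f' (c - x)) (at x)"
      if "\<And>s. (f has_real_derivative f' s) (at s)" for f f' :: "real \<Rightarrow> real" and c x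
    proof -
      have "((\<lambda>x. x - c) has_real_derivative 1) (at x)" "((\<lambda>x. c - x) has_real_derivative - 1) (at x)"
        by (auto intro!: derivative_eq_intros)
      from DERIV_chain2[OF that this(1)] DERIV_chain2[OF that this(2)]
      show "((\<lambda>x. f (x - c)) has_real_derivative f' (x - c)) (at x)"
        "((\<lambda>x. f (c - x)) has_real_derivative - f' (c - x)) (at x)" by simp_all
    qed
    have c3: "((\<lambda>x. f (- x)) has_real_derivative - f' (- x)) (at x)"
      if "\<And>s. (f has_real_derivative f' s) (at s)" for f f' :: "real \<Rightarrow> real" and x
      using c2[OF that, of 0 x] by simp
    have D\<alpha>: "(\<alpha> has_real_derivative \<alpha>' x) (at x)" "(\<alpha>' has_real_derivative \<alpha>'' x) (at x)" for x
      unfolding \<alpha>_def[abs_def] \<alpha>'_def[abs_def] \<alpha>''_def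
      by (auto intro!: derivative_eq_intros c1 c2 De)
    have D\<beta>: "(\<beta> has_real_derivative \<beta>' x) (at x)" "(\<beta>' has_real_derivative \<beta>'' x) (at x)" for x
      unfolding \<beta>_def[abs_def] \<beta>'_def[abs_def] \<beta>''_def
      by (auto intro!: derivative_eq_intros c1 c3 De simp: power2_eq_square)
    define \<phi> where "\<phi> z = \<alpha> (fst z) + \<beta> (snd z)" for z
    have \<phi>_b: "1/4 \<le> \<phi> z" "\<phi> z \<le> 1" if "z \<in> ?R" for z
    proof -
      have z: "l \<le> fst z" "fst z \<le> r" "p0 \<le> snd z" "snd z \<le> 0" using that by auto
      have "e (fst z - l) + e (r - fst z) + e (snd z - p0) + e (- snd z)
          \<le> \<epsilon> * (fst z - l) + \<epsilon> * (r - fst z) + \<epsilon> * (snd z - p0) + \<epsilon> * (- snd z)"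
        using z by (intro add_mono e_le) auto
      also have "\<dots> = \<epsilon> * ((r - l) - p0)" by (simp add: algebra_simps)
      also have "\<dots> \<le> \<epsilon> * (\<Lambda> - p0)" using lr \<epsilon> by (intro mult_left_mono) auto
      also have "\<dots> \<le> 1/4" by (rule \<epsilon>)
      finally show "1/4 \<le> \<phi> z" unfolding \<phi>_def \<alpha>_def \<beta>_def using exp_gt_zero[of "\<kappa> * snd z"] by linarith
      have "exp (\<kappa> * snd z) \<le> 1" using z \<kappa> by (simp add: mult_nonneg_nonpos)
      then show "\<phi> z \<le> 1" unfolding \<phi>_def \<alpha>_def \<beta>_def
        using e_ge[of "fst z - l"] e_ge[of "r - fst z"] e_ge[of "snd z - p0"] e_ge[of "- snd z"] by linarith
    qed
    have cont\<phi>: "continuous_on S \<phi>" for S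
      unfolding \<phi>_def \<alpha>_def \<beta>_def e_def using \<delta> by (intro continuous_intros) auto
    show "0 \<le> w (q, p)"
    proof (rule ccontr)
      assume "\<not> 0 \<le> w (q, p)"
      then have neg: "w (q, p) < 0" by simp
      have qpR: "(q, p) \<in> ?R" using qp by simp
      have \<phi>_pos: "0 < \<phi> z" if "z \<in> ?R" for z using \<phi>_b(1)[OF that] by simp
      obtain z k where z: "z \<in> ?R" "0 < k" "w z = - k * \<phi> z" "\<And>y. y \<in> ?R \<Longrightarrow> - k * \<phi> y \<le> w y"
        by (rule lin_sol_rect_min[OF w lr(1) cont\<phi> _ qpR neg], erule \<phi>_pos) (rule that)
      have wz: "w z < 0" using z(2,3) \<phi>_pos[OF z(1)] by simp
      have z_mem: "fst z \<in> {l..r}" "snd z \<in> {p0..0}" using z(1) by auto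
      have "fst z \<noteq> l" "fst z \<noteq> r" "snd z \<noteq> p0"
        using bspec[OF sides z_mem(2)] bspec[OF bot z_mem(1)] wz by (cases z; auto)+
      then have zlt: "l < fst z" "fst z < r" "p0 < snd z" "snd z \<le> 0" using z_mem by auto
      have al': "\<bar>\<alpha>' (fst z)\<bar> \<le> \<epsilon>"
        unfolding \<alpha>'_def using e'_b[of "fst z - l"] e'_b[of "r - fst z"] zlt by auto
      show False
      proof (cases "snd z = 0")
        \<comment> \<open>On the top the touching point is no interior minimum. The tangential
          derivatives of \<open>w\<close> and \<open>- k * \<phi>\<close> agree, the normal ones are
          ordered, and \<phi> is too steep there for the boundary condition.\<close>
        case True
        then have zz: "z = (fst z, 0)" by (cases z) auto
        have "((\<lambda>s. w (s, 0) + k * \<phi> (s, 0)) has_real_derivative wq (fst z, 0) + k * \<alpha>' (fst z)) (at (fst z))"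
          using w unfolding lin_sol_def \<phi>_def by (auto intro!: derivative_eq_intros D\<alpha>)
        then have t: "wq (fst z, 0) + k * \<alpha>' (fst z) = 0"
        proof (rule DERIV_local_min[where d = "min (fst z - l) (r - fst z)"])
          show "\<forall>y. \<bar>fst z - y\<bar> < min (fst z - l) (r - fst z) \<longrightarrow>
              w (fst z, 0) + k * \<phi> (fst z, 0) \<le> w (y, 0) + k * \<phi> (y, 0)"
          proof (intro allI impI)
            fix y assume "\<bar>fst z - y\<bar> < min (fst z - l) (r - fst z)"
            then have "(y, 0) \<in> ?R" using p0 by auto
            from z(4)[OF this] z(3) zz show "w (fst z, 0) + k * \<phi> (fst z, 0) \<le> w (y, 0) + k * \<phi> (y, 0)" by simp
          qed
        qed (use zlt in auto)
        have "((\<lambda>s. w (fst z, s) + k * \<phi> (fst z, s)) has_real_derivative wp (fst z, 0) + k * \<beta>' 0) (at 0 within {p0..0})"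
          using w unfolding lin_sol_def \<phi>_def
          by (auto intro!: derivative_eq_intros has_field_derivative_at_within[OF D\<beta>(1)])
        then have n: "wp (fst z, 0) + k * \<beta>' 0 \<le> 0"
        proof (rule one_sided_min_derivative[OF p0])
          fix s assume "p0 \<le> s" "s \<le> 0"
          then have "(fst z, s) \<in> ?R" using zlt by simp
          from z(4)[OF this] z(3) zz
          show "w (fst z, 0) + k * \<phi> (fst z, 0) \<le> w (fst z, s) + k * \<phi> (fst z, s)" by simp
        qed
        have "\<kappa> / 2 - \<epsilon> \<le> \<beta>' 0" unfolding \<beta>'_def using e'_b[of "- p0"] p0 e'_b[of 0] by simp
        then have "k * (\<kappa> / 2 - \<epsilon>) \<le> k * \<beta>' 0" using z(2) by (intro mult_left_mono) auto
        with n have "k * (\<kappa> / 2 - \<epsilon>) \<le> - wp (fst z, 0)" by simp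
        also have "\<dots> \<le> \<bar>wp (fst z, 0)\<bar>" by simp
        also have "\<dots> \<le> K * (\<bar>w (fst z, 0)\<bar> + \<bar>wq (fst z, 0)\<bar>)" using w unfolding lin_sol_def by blast
        also have "\<dots> \<le> K * (k * 1 + k * 1)"
        proof (intro mult_left_mono add_mono K_nonneg)
          show "\<bar>w (fst z, 0)\<bar> \<le> k * 1" using z(3) \<phi>_b[OF z(1)] z(2) zz by (simp add: abs_mult)
          have "\<bar>wq (fst z, 0)\<bar> = k * \<bar>\<alpha>' (fst z)\<bar>" using t z(2) by (simp add: abs_mult eq_neg_iff_add_eq_0[symmetric])
          also have "\<dots> \<le> k * 1" using al' \<epsilon> z(2) by (intro mult_left_mono) auto
          finally show "\<bar>wq (fst z, 0)\<bar> \<le> k * 1" .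
        qed
        finally have "k * (\<kappa> / 2 - \<epsilon>) \<le> k * (2 * K)" by (simp add: algebra_simps)
        then have "\<kappa> / 2 - \<epsilon> \<le> 2 * K" using z(2) by simp
        moreover have "\<kappa> / 2 = 2 * K + 2" by (simp add: \<kappa>_def)
        ultimately show False using \<epsilon>(1,2) by linarith
      next
        case False
        define N where "N = {l<..<r} \<times> {p0<..<0}"
        have N: "open N" "z \<in> N" "N \<subseteq> strip" "N \<subseteq> ?R"
          using zlt False by (auto simp: N_def mem_Times_iff intro!: open_Times)
        \<comment> \<open>Since \<open>w\<close> is nonnegative on the inner rectangle, the touching
          point is within \<delta> of a side, where the corresponding \<open>e''\<close> is at least
          \<open>\<epsilon> / (3 * \<delta>)\<close>.\<close>
        have near: "fst z - l \<le> \<delta> \<or> r - fst z \<le> \<delta> \<or> snd z - p0 \<le> \<delta> \<or> - snd z \<le> \<delta>"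
        proof (rule ccontr)
          assume "\<not> ?thesis"
          then have "0 \<le> w (fst z, snd z)" using inner[rule_format, of "fst z" "snd z"] by auto
          with wz show False by simp
        qed
        have hb: "hess_on N (\<lambda>z. - k * \<alpha> (fst z) + - k * \<beta> (snd z)) (\<lambda>z. - k * \<alpha>' (fst z)) (\<lambda>z. - k * \<beta>' (snd z))
            (\<lambda>z. - k * \<alpha>'' (fst z)) (\<lambda>z. 0) (\<lambda>z. - k * \<beta>'' (snd z))"
          by (rule hess_on_separable[of "\<lambda>x. - k * \<alpha> x" "\<lambda>x. - k * \<alpha>' x" "\<lambda>x. - k * \<alpha>'' x"
                "\<lambda>x. - k * \<beta> x" "\<lambda>x. - k * \<beta>' x" "\<lambda>x. - k * \<beta>'' x"]; intro DERIV_cmult D\<alpha> D\<beta>)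
        have hw: "hess_on N w wq wp wqq wqp wpp"
          using w unfolding lin_sol_def by (intro hess_on_subset[OF _ N(3)]) blast
        have el: "elliptic_at m M K wq wp wqq wqp wpp z" using w N unfolding lin_sol_def by blast
        have sub: "strict_sub_at m M K (\<lambda>z. - k * \<alpha>' (fst z)) (\<lambda>z. - k * \<beta>' (snd z))
            (\<lambda>z. - k * \<alpha>'' (fst z)) (\<lambda>z. 0) (\<lambda>z. - k * \<beta>'' (snd z)) z"
          unfolding strict_sub_at_def
        proof (intro allI impI)
          fix A B :: real assume AB: "\<bar>A\<bar> \<le> M \<and> m \<le> B \<and> B \<le> M"
          have ex: "exp (\<kappa> * snd z) \<le> 1" using zlt \<kappa> by (simp add: mult_nonneg_nonpos)
          have be': "\<bar>\<beta>' (snd z)\<bar> \<le> \<kappa> / 2 + \<epsilon>"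
          proof -
            have "0 \<le> \<kappa> / 2 * exp (\<kappa> * snd z)" "\<kappa> / 2 * exp (\<kappa> * snd z) \<le> \<kappa> / 2 * 1"
              using \<kappa> ex by (auto intro!: mult_left_mono)
            then show ?thesis unfolding \<beta>'_def using e'_b[of "snd z - p0"] e'_b[of "- snd z"] zlt by auto
          qed
          have A2: "A\<^sup>2 \<le> M\<^sup>2" using AB by (auto simp: abs_le_square_iff[symmetric])
          have B2: "m\<^sup>2 \<le> B\<^sup>2" using AB m by (intro power_mono) auto
          have "K * (\<bar>\<alpha>' (fst z)\<bar> + \<bar>\<beta>' (snd z)\<bar>) \<le> K * (\<epsilon> + (\<kappa> / 2 + \<epsilon>))"
            using al' be' K_nonneg by (intro mult_left_mono add_mono) auto
          moreover have "(1 + A\<^sup>2) * (\<kappa>\<^sup>2 / 2 * exp (\<kappa> * snd z)) \<le> (1 + M\<^sup>2) * (\<kappa>\<^sup>2 / 2 * 1)"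
            using A2 ex by (intro mult_mono add_mono) auto
          moreover have "m1 * (\<epsilon> / (3 * \<delta>)) \<le> (1 + A\<^sup>2) * (e'' (snd z - p0) + e'' (- snd z)) + B\<^sup>2 * (e'' (fst z - l) + e'' (r - fst z))"
          proof -
            have E: "m1 * e'' (snd z - p0) \<le> (1 + A\<^sup>2) * e'' (snd z - p0)"
              "m1 * e'' (- snd z) \<le> (1 + A\<^sup>2) * e'' (- snd z)"
              "m1 * e'' (fst z - l) \<le> B\<^sup>2 * e'' (fst z - l)" "m1 * e'' (r - fst z) \<le> B\<^sup>2 * e'' (r - fst z)"
              using m1 B2 e''_pos by (auto intro!: mult_right_mono add_increasing2)
            have P: "0 \<le> m1 * e'' s" for s using m1 e''_pos by simp
            have "\<exists>s\<in>{snd z - p0, - snd z, fst z - l, r - fst z}. s \<le> \<delta>" using near by auto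
            then obtain s where s: "s \<in> {snd z - p0, - snd z, fst z - l, r - fst z}" "s \<le> \<delta>" by blast
            have "m1 * (\<epsilon> / (3 * \<delta>)) \<le> m1 * e'' s" using e''_ge[OF s(2)] m1 by (intro mult_left_mono) auto
            also have "\<dots> \<le> m1 * e'' (snd z - p0) + m1 * e'' (- snd z) + m1 * e'' (fst z - l) + m1 * e'' (r - fst z)"
              using s(1) P[of "snd z - p0"] P[of "- snd z"] P[of "fst z - l"] P[of "r - fst z"] by auto
            finally show ?thesis using E unfolding distrib_left by linarith
          qed
          moreover have "G = (1 + M\<^sup>2) * (\<kappa>\<^sup>2 / 2 * 1) + K * (\<epsilon> + (\<kappa> / 2 + \<epsilon>))" by (simp add: G_def algebra_simps)
          moreover have "- (1 + A\<^sup>2) * \<beta>'' (snd z) - B\<^sup>2 * \<alpha>'' (fst z) =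
              ((1 + A\<^sup>2) * (e'' (snd z - p0) + e'' (- snd z)) + B\<^sup>2 * (e'' (fst z - l) + e'' (r - fst z)))
              - (1 + A\<^sup>2) * (\<kappa>\<^sup>2 / 2 * exp (\<kappa> * snd z))"
          proof -
            have "- (1 + a) * (x - e1 - e2) - b * (- e3 - e4) = ((1 + a) * (e1 + e2) + b * (e3 + e4)) - (1 + a) * x"
              for a b x e1 e2 e3 e4 :: real by (simp add: algebra_simps)
            then show ?thesis unfolding \<beta>''_def \<alpha>''_def .
          qed
          ultimately have "K * (\<bar>\<alpha>' (fst z)\<bar> + \<bar>\<beta>' (snd z)\<bar>) < - (1 + A\<^sup>2) * \<beta>'' (snd z) - B\<^sup>2 * \<alpha>'' (fst z)"
            using \<delta>G by linarith
          then have "k * (K * (\<bar>\<alpha>' (fst z)\<bar> + \<bar>\<beta>' (snd z)\<bar>)) < k * (- (1 + A\<^sup>2) * \<beta>'' (snd z) - B\<^sup>2 * \<alpha>'' (fst z))"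
            using z(2) by (intro mult_strict_left_mono)
          then show "K * (\<bar>- k * \<alpha>' (fst z)\<bar> + \<bar>- k * \<beta>' (snd z)\<bar>) < - k * \<beta>'' (snd z)
              + (B\<^sup>2 * (- k * \<alpha>'' (fst z)) - 2 * A * B * 0 + A\<^sup>2 * (- k * \<beta>'' (snd z)))"
            using z(2) by (simp add: abs_mult algebra_simps)
        qed
        show False
        proof (rule no_touching[OF N(1,2) hw hb _ _ el sub])
          have \<phi>: "- k * \<alpha> (fst y) + - k * \<beta> (snd y) = - k * \<phi> y" for y
            by (simp add: \<phi>_def algebra_simps)
          show "\<forall>y\<in>N. - k * \<alpha> (fst y) + - k * \<beta> (snd y) \<le> w y" unfolding \<phi> using z(4) N(4) by blast
          show "- k * \<alpha> (fst z) + - k * \<beta> (snd z) = w z" unfolding \<phi> z(3) ..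
        qed
      qed
    qed
  qed
qed

end

section \<open>Moving planes\<close>

context strip_problem
begin

lemma reflection_lin_sol:
  assumes "height_sol H a b hqq hqp hpp"
  shows "lin_sol (\<lambda>z. H z - H (2 * l - fst z, snd z)) (\<lambda>z. a z + a (2 * l - fst z, snd z))
     (\<lambda>z. b z - b (2 * l - fst z, snd z)) (\<lambda>z. hqq z - hqq (2 * l - fst z, snd z))
     (\<lambda>z. hqp z + hqp (2 * l - fst z, snd z)) (\<lambda>z. hpp z - hpp (2 * l - fst z, snd z))"
  using height_sol_diff[OF assms height_sol_affine[OF assms, of "-1" "2 * l"]] by simp

text \<open>The mirror line \<open>l = q / 2\<close> carries \<open>q\<close> to \<open>0\<close>.
  On the rectangle from \<open>l\<close> to \<open>l + T / 2\<close> the difference with the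
  reflection vanishes on the bottom and on both sides, on the right one by periodicity. Only the
  sign on the top remains, and it is read off from the monotone profile.\<close>

lemma lowest_line_of_monotone_surface:
  assumes sol: "height_sol H a b hqq hqp hpp" and "0 < L"
    and per: "\<And>q p. p \<in> {p0..0} \<Longrightarrow> H (q + L, p) = H (q, p)"
    and bottom: "\<And>q. H (q, p0) = c0"
    and "0 < T" and topT: "\<And>q. H (q + T, 0) = H (q, 0)"
    and even: "\<And>s. H (- s, 0) = H (s, 0)"
    and mono: "\<And>s t. 0 \<le> s \<Longrightarrow> s \<le> t \<Longrightarrow> t \<le> T / 2 \<Longrightarrow> H (s, 0) \<le> H (t, 0)"
    and p: "p \<in> {p0..0}"
  shows "H (0, p) \<le> H (q, p)"
proof -
  have shifted: "height_sol (\<lambda>z. H (T + fst z, snd z)) (\<lambda>z. a (T + fst z, snd z)) (\<lambda>z. b (T + fst z, snd z))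
     (\<lambda>z. hqq (T + fst z, snd z)) (\<lambda>z. hqp (T + fst z, snd z)) (\<lambda>z. hpp (T + fst z, snd z))"
    using height_sol_affine[OF sol, of 1 T] by simp
  \<comment> \<open>The field inherits the period of its surface: the height and its shift agree on
    top and bottom, so the weak maximum principle applies in both directions. \<open>L\<close> only
    serves as some period of the whole flow.\<close>
  have HT: "H (q + T, p) = H (q, p)" if p: "p \<in> {p0..0}" for q p
  proof -
    have L: "H (T + (q + L), p) = H (T + q, p)" if "p \<in> {p0..0}" for q p
      using per[OF that, of "T + q"] by (simp add: add.assoc)
    have T0: "H (T + q, 0) = H (q, 0)" for q using topT[of q] by (simp add: add.commute)
    have "0 \<le> (\<lambda>z. H z - H (T + fst z, snd z)) (q, p)"
      by (rule weak_maximum_periodic[OF height_sol_diff[OF sol shifted] \<open>0 < L\<close> _ _ p])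
        (auto simp: L per bottom T0)
    moreover have "0 \<le> (\<lambda>z. H (T + fst z, snd z) - H z) (q, p)"
      by (rule weak_maximum_periodic[OF height_sol_diff[OF shifted sol] \<open>0 < L\<close> _ _ p])
        (auto simp: L per bottom T0)
    ultimately show ?thesis by (simp add: add.commute)
  qed
  have main: "H (0, p) \<le> H (q, p)" if q: "0 \<le> q" "q < T" for q
  proof -
    define l where "l = q / 2"
    define w where "w z = H z - H (2 * l - fst z, snd z)" for z
    note w = reflection_lin_sol[OF sol, of l, folded w_def]
    have "0 \<le> w (q, p)"
    proof (rule weak_maximum_rect[OF w])
      show "l \<le> l + T / 2" using \<open>0 < T\<close> by simp
      show "0 \<le> w (l, p) \<and> 0 \<le> w (l + T / 2, p)" if "p \<in> {p0..0}" for p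
        using HT[of p "l - T / 2"] that by (simp add: w_def add.commute)
      show "0 \<le> w (s, p0) \<and> 0 \<le> w (s, 0)" if s: "s \<in> {l..l + T / 2}" for s
      proof
        show "0 \<le> w (s, p0)" by (simp add: w_def bottom)
        have abs: "H (2 * l - s, 0) = H (\<bar>2 * l - s\<bar>, 0)" using even[of "2 * l - s"] by (simp add: abs_if)
        have "H (2 * l - s, 0) \<le> H (s, 0)"
        proof (cases "s \<le> T / 2")
          case True
          then show ?thesis unfolding abs using s q by (intro mono) (auto simp: l_def)
        next
          \<comment> \<open>Past half a period, \<open>s\<close> is first folded back to
            \<open>T - s\<close>, which still dominates the absolute value of the mirror
            point.\<close>
          case False
          have "H (s, 0) = H (T - s, 0)" using even[of s] topT[of "- s"] by (simp add: add.commute)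
          moreover have "H (\<bar>2 * l - s\<bar>, 0) \<le> H (T - s, 0)"
            using s q False by (intro mono) (auto simp: l_def)
          ultimately show ?thesis using abs by simp
        qed
        then show "0 \<le> w (s, 0)" by (simp add: w_def)
      qed
      show "(q, p) \<in> {l..l + T / 2} \<times> {p0..0}" using q p by (auto simp: l_def)
    qed
    then show ?thesis by (simp add: w_def l_def)
  qed
  obtain k where k: "q + of_int k * T \<in> {0..<0 + T}" using periodic_reduce[OF \<open>0 < T\<close>] .
  have "H (0, p) \<le> H (q + of_int k * T, p)" using k by (intro main) auto
  also have "\<dots> = H (q, p)" using periodic_shift[of "\<lambda>q. H (q, p)" T] HT[OF p] by blast
  finally show ?thesis .
qed

text \<open>The hypothesis \<open>sym\<close> is the abstract outcome of unique continuation.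
  \<open>D\<close> collects the lines at which the comparison fails together with the critical ones,
  and its infimum is the line sought. Putting both kinds into one set avoids separate discussions of
  the two ways in which the plane can stop.\<close>

lemma moving_planes:
  assumes sol: "height_sol H a b hqq hqp hpp" and "0 < L"
    and per: "\<And>q p. p \<in> {p0..0} \<Longrightarrow> H (q + L, p) = H (q, p)"
    and bottom: "\<And>q. H (q, p0) = c0"
    and lowest: "\<And>q p. p \<in> {p0..0} \<Longrightarrow> H (0, p) \<le> H (q, p)"
    and sym: "\<And>\<mu>. (\<And>p. p \<in> {p0<..<0} \<Longrightarrow> a (\<mu>, p) = 0) \<Longrightarrow> \<forall>s. H (\<mu> + s, 0) = H (\<mu> - s, 0)"
    and nonconst: "H (q1, 0) \<noteq> H (0, 0)"
  shows "\<exists>l>0. (\<forall>s. H (l + s, 0) = H (l - s, 0)) \<and> (\<forall>s. H (s, 0) = H (- s, 0)) \<and>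
     strict_mono_on {0..l} (\<lambda>q. H (q, 0))"
proof -
  note s = sol[unfolded height_sol_def]
  have hess: "hess_on strip H a b hqq hqp hpp" using s by blast
  have cont: "continuous_on (UNIV \<times> {p0..0}) H" using s by blast
  \<comment> \<open>The interval from \<open>l\<close> to \<open>2 * l\<close> is the mirror image
    of that from \<open>0\<close> to \<open>l\<close>, so its far side is compared with the line of
    lowest points.\<close>
  define good where "good l \<longleftrightarrow> (\<forall>q\<in>{l..2*l}. \<forall>p\<in>{p0..0}. H (2 * l - q, p) \<le> H (q, p))" for l
  define crit where "crit l \<longleftrightarrow> (\<forall>p\<in>{p0<..<0}. a (l, p) = 0)" for l
  have dq: "((\<lambda>t. H (q + t, p)) has_real_derivative a (q, p)) (at 0)" if "p \<in> {p0<..<0}" for q p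
    using hess_on_line(1)[OF hess, of "(q, p)" 0 "(1, 0)"] that by simp
  have cont_row: "continuous_on S (\<lambda>x. H (f x, p))" if "p \<in> {p0..0}" "continuous_on S f" for S p and f :: "real \<Rightarrow> real"
    by (rule continuous_on_compose2[OF cont]) (use that in \<open>auto intro!: continuous_intros\<close>)
  \<comment> \<open>A minimum in the horizontal direction has zero slope, so the starting line is
    critical and the surface is symmetric about it.\<close>
  have crit0: "crit 0"
    unfolding crit_def
  proof
    fix p assume p: "p \<in> {p0<..<0}"
    show "a (0, p) = 0"
      by (rule DERIV_local_min[OF dq[OF p], of 1]) (use lowest p in auto)
  qed
  have even: "H (s, 0) = H (- s, 0)" for s using sym[of 0] crit0 unfolding crit_def by simp

  \<comment> \<open>The rectangles have width \<open>l \<le> L\<close>, so one \<delta> serves all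
    planes. The difference vanishes at \<open>q = l\<close> and equals
    \<open>H (2 * l, p) - H (0, p)\<close> at \<open>q = 2 * l\<close>.\<close>
  obtain \<delta> where \<delta>: "\<delta> > 0" and narrow:
    "\<And>l. 0 < l \<Longrightarrow> l \<le> L \<Longrightarrow> (\<forall>q\<in>{l+\<delta>..2*l-\<delta>}. \<forall>p\<in>{p0+\<delta>..-\<delta>}. H (2 * l - q, p) \<le> H (q, p)) \<Longrightarrow> good l"
  proof -
    obtain \<delta> where \<delta>: "\<delta> > 0" and n: "\<forall>w wq wp wqq wqp wpp l r. lin_sol w wq wp wqq wqp wpp \<and> l \<le> r \<and> r - l \<le> L \<and>
     (\<forall>p\<in>{p0..0}. 0 \<le> w (l, p) \<and> 0 \<le> w (r, p)) \<and> (\<forall>q\<in>{l..r}. 0 \<le> w (q, p0)) \<and>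
     (\<forall>q\<in>{l+\<delta>..r-\<delta>}. \<forall>p\<in>{p0+\<delta>..-\<delta>}. 0 \<le> w (q, p)) \<longrightarrow>
     (\<forall>q\<in>{l..r}. \<forall>p\<in>{p0..0}. 0 \<le> w (q, p))"
      using narrow_maximum[OF \<open>0 < L\<close>] by blast
    have "good l" if l: "0 < l" "l \<le> L"
      and i: "\<forall>q\<in>{l+\<delta>..2*l-\<delta>}. \<forall>p\<in>{p0+\<delta>..-\<delta>}. H (2 * l - q, p) \<le> H (q, p)" for l
    proof -
      define w where "w z = H z - H (2 * l - fst z, snd z)" for z
      have "\<forall>q\<in>{l..2*l}. \<forall>p\<in>{p0..0}. 0 \<le> w (q, p)"
      proof (rule n[THEN spec, THEN spec, THEN spec, THEN spec, THEN spec, THEN spec, THEN spec, THEN spec, THEN mp],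
          intro conjI)
        show "lin_sol w (\<lambda>z. a z + a (2 * l - fst z, snd z)) (\<lambda>z. b z - b (2 * l - fst z, snd z))
          (\<lambda>z. hqq z - hqq (2 * l - fst z, snd z)) (\<lambda>z. hqp z + hqp (2 * l - fst z, snd z))
          (\<lambda>z. hpp z - hpp (2 * l - fst z, snd z))"
          unfolding w_def using reflection_lin_sol[OF sol] .
      qed (use l i lowest bottom in \<open>auto simp: w_def\<close>)
      then show ?thesis unfolding good_def w_def by simp
    qed
    with \<delta> show ?thesis using that by blast
  qed
  \<comment> \<open>A single interior zero would make the difference vanish on the whole open
    rectangle. Its q-derivative on the mirror line is \<open>2 * a (l, p)\<close>, so the line would
    be critical.\<close>
  have strict: "H (2 * l - q, p) < H (q, p)"
    if l: "0 < l" "good l" "\<not> crit l" and q: "l < q" "q < 2 * l" and p: "p0 < p" "p \<le> 0" for l q p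
  proof -
    define w where "w z = H z - H (2 * l - fst z, snd z)" for z
    note w = reflection_lin_sol[OF sol, of l, folded w_def]
    let ?S = "{l<..<2*l} \<times> {p0<..<0}"
    have nonneg: "0 \<le> w z" if "z \<in> {l..2*l} \<times> {p0..0}" for z
      using l(2) that unfolding good_def w_def by (cases z) auto
    have pos: "0 < w z" if z: "z \<in> ?S" for z
    proof (rule ccontr)
      assume "\<not> 0 < w z"
      then have z0: "w z = 0" using nonneg[of z] z by (cases z) auto
      have "open ?S" by (intro open_Times) auto
      moreover have "convex ?S" by (intro convex_Times) auto
      ultimately have oc: "open ?S" "convex ?S" by auto
      have sub: "?S \<subseteq> strip" by auto
      have zero: "w y = 0" if y: "y \<in> ?S" for y
      proof (rule strong_maximum[where w = w, OF m K_nonneg oc _ _ _ z z0 y])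
        show "hess_on ?S w (\<lambda>z. a z + a (2 * l - fst z, snd z)) (\<lambda>z. b z - b (2 * l - fst z, snd z))
          (\<lambda>z. hqq z - hqq (2 * l - fst z, snd z)) (\<lambda>z. hqp z + hqp (2 * l - fst z, snd z))
          (\<lambda>z. hpp z - hpp (2 * l - fst z, snd z))"
          using w unfolding lin_sol_def by (intro hess_on_subset[OF _ sub]) blast
        show "elliptic_at m M K (\<lambda>z. a z + a (2 * l - fst z, snd z)) (\<lambda>z. b z - b (2 * l - fst z, snd z))
          (\<lambda>z. hqq z - hqq (2 * l - fst z, snd z)) (\<lambda>z. hqp z + hqp (2 * l - fst z, snd z))
          (\<lambda>z. hpp z - hpp (2 * l - fst z, snd z)) x" if "x \<in> ?S" for x
          using w sub that unfolding lin_sol_def by blast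
        show "0 \<le> w x" if "x \<in> ?S" for x using nonneg[of x] that by (cases x) auto
      qed
      have "crit l"
        unfolding crit_def
      proof
        fix p assume p: "p \<in> {p0<..<0}"
        have "((\<lambda>t. w ((l, p) + t *\<^sub>R (1, 0))) has_real_derivative 2 * a (l, p)) (at 0)"
          using hess_on_line(1)[of strip w _ _ _ _ _ "(l, p)" 0 "(1, 0)"] w p unfolding lin_sol_def by fastforce
        then have "((\<lambda>t. w (l + t, p) / t) \<longlongrightarrow> 2 * a (l, p)) (at 0)"
          unfolding has_field_derivative_iff by (simp add: w_def)
        then have "((\<lambda>t. w (l + t, p) / t) \<longlongrightarrow> 2 * a (l, p)) (at_right 0)"
          by (rule tendsto_mono[OF at_le, rotated]) auto
        moreover have "\<forall>\<^sub>F t in at_right 0. w (l + t, p) / t = 0"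
          using l(1) p by (intro eventually_at_rightI[of 0 l]) (auto intro!: zero)
        ultimately have "2 * a (l, p) = 0"
          using tendsto_unique[OF trivial_limit_at_right_real _ tendsto_eventually] by blast
        then show "a (l, p) = 0" by simp
      qed
      with l(3) show False by simp
    qed
    show ?thesis
    proof (cases "p = 0")
      case True
      then show ?thesis using top_positive[OF w q pos nonneg] by (simp add: w_def)
    next
      case False
      then show ?thesis using pos[of "(q, p)"] q p by (simp add: w_def)
    qed
  qed
  define D where "D = {l. 0 < l \<and> l \<le> L \<and> (\<not> good l \<or> crit l)}"
  \<comment> \<open>If all planes up to \<open>L\<close> were good, the one halfway between
    \<open>q\<close> and \<open>L\<close> would give
    \<open>H (q, 0) \<le> H (L, 0) = H (0, 0)\<close>, which is the minimum, and the surface would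
    be flat.\<close>
  have "D \<noteq> {}"
  proof
    assume "D = {}"
    then have all: "good l" if "0 < l" "l \<le> L" for l using that unfolding D_def by blast
    have "H (q, 0) = H (0, 0)" if q: "0 \<le> q" "q < L" for q
    proof -
      have "H (2 * ((q + L) / 2) - L, 0) \<le> H (L, 0)"
        using all[of "(q + L) / 2"] q p0 unfolding good_def by auto
      moreover have "2 * ((q + L) / 2) - L = q" by (simp add: field_simps)
      ultimately have "H (q, 0) \<le> H (L, 0)" by simp
      also have "H (L, 0) = H (0, 0)" using per[of 0 0] p0 by simp
      finally show ?thesis using lowest[of 0 q] p0 by simp
    qed
    moreover obtain k where k: "q1 + of_int k * L \<in> {0..<0 + L}" using periodic_reduce[OF \<open>0 < L\<close>] .
    moreover have "H (q1 + of_int k * L, 0) = H (q1, 0)"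
      using periodic_shift[of "\<lambda>q. H (q, 0)" L] per p0 by simp
    ultimately show False using nonconst by (metis add_0 atLeastLessThan_iff)
  qed
  have bdd: "bdd_below D" unfolding D_def by (rule bdd_belowI[of _ 0]) auto
  define \<Lambda> where "\<Lambda> = Inf D"
  have \<Lambda>_le: "\<Lambda> \<le> l" if "l \<in> D" for l unfolding \<Lambda>_def using bdd that by (rule cInf_lower[rotated])
  have near: "\<exists>l\<in>D. l < \<Lambda> + e" if "0 < e" for e
    using cInf_lessD[OF \<open>D \<noteq> {}\<close>, of "\<Lambda> + e"] that unfolding \<Lambda>_def by auto
  have \<Lambda>0: "0 \<le> \<Lambda>" unfolding \<Lambda>_def using \<open>D \<noteq> {}\<close> by (intro cInf_greatest) (auto simp: D_def)
  have \<Lambda>L: "\<Lambda> \<le> L" using \<open>D \<noteq> {}\<close> \<Lambda>_le unfolding D_def by fastforce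
  \<comment> \<open>Planes with \<open>2 * l < \<delta>\<close> are good, as their inner rectangle
    is empty, so members of \<open>D\<close> near \<open>0\<close> would be critical. Together with
    the symmetry about \<open>0\<close> such a line yields the period \<open>2 * l\<close>, and
    arbitrarily small periods force a constant surface.\<close>
  have \<Lambda>pos: "0 < \<Lambda>"
  proof (rule ccontr)
    assume "\<not> 0 < \<Lambda>"
    then have "\<Lambda> = 0" using \<Lambda>0 by simp
    have "continuous_on UNIV (\<lambda>q. H (q, 0))" using p0 by (intro cont_row) auto
    then have "isCont (\<lambda>q. H (q, 0)) 0" by (simp add: continuous_on_eq_continuous_at)
    then obtain \<eta> where \<eta>: "\<eta> > 0" "\<And>x. dist x 0 < \<eta> \<Longrightarrow> dist (H (x, 0)) (H (0, 0)) < \<bar>H (q1, 0) - H (0, 0)\<bar>"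
      using nonconst unfolding continuous_at_eps_delta by (metis zero_less_abs_iff right_minus_eq)
    obtain l where l: "l \<in> D" "l < min (\<delta> / 2) (\<eta> / 2)" using near[of "min (\<delta> / 2) (\<eta> / 2)"] \<delta> \<eta>(1) \<open>\<Lambda> = 0\<close> by auto
    then have l': "0 < l" "l \<le> L" "2 * l < \<delta>" "2 * l < \<eta>" by (auto simp: D_def)
    have "good l" using l' \<delta> by (intro narrow) auto
    then have "crit l" using l(1) by (auto simp: D_def)
    then have refl: "H (l + s, 0) = H (l - s, 0)" for s using sym[of l] unfolding crit_def by blast
    have pl: "H (q + 2 * l, 0) = H (q, 0)" for q
      using refl[of "l + q"] even[of q] by (simp add: algebra_simps)
    obtain k where k: "q1 + of_int k * (2 * l) \<in> {0..<0 + 2 * l}" using periodic_reduce[of "2 * l" q1 0] l'(1) by fastforce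
    have "H (q1 + of_int k * (2 * l), 0) = H (q1, 0)"
      using periodic_shift[of "\<lambda>q. H (q, 0)" "2 * l"] pl by simp
    moreover have "dist (q1 + of_int k * (2 * l)) 0 < \<eta>" using k l'(4) by (auto simp: dist_real_def)
    ultimately show False using \<eta>(2) by (metis dist_real_def less_irrefl)
  qed
  have below: "good l \<and> \<not> crit l" if "0 < l" "l < \<Lambda>" for l
    using \<Lambda>_le[of l] that \<Lambda>L unfolding D_def by fastforce
  \<comment> \<open>The inequality survives the limit of good planes from the left; at
    \<open>q = 2 * \<Lambda>\<close> it is the minimality of the line \<open>0\<close>.\<close>
  have good\<Lambda>: "good \<Lambda>"
    unfolding good_def
  proof (intro ballI)
    fix q p assume q: "q \<in> {\<Lambda>..2*\<Lambda>}" and p: "p \<in> {p0..0}"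
    consider "q = \<Lambda>" | "q = 2 * \<Lambda>" | "\<Lambda> < q" "q < 2 * \<Lambda>" using q by fastforce
    then show "H (2 * \<Lambda> - q, p) \<le> H (q, p)"
    proof cases
      case 3
      have "continuous_on UNIV (\<lambda>l. H (2 * l - q, p))" using p by (intro cont_row continuous_intros)
      then have "isCont (\<lambda>l. H (2 * l - q, p)) \<Lambda>" by (simp add: continuous_on_eq_continuous_at)
      then have "((\<lambda>l. H (2 * l - q, p)) \<longlongrightarrow> H (2 * \<Lambda> - q, p)) (at_left \<Lambda>)"
        unfolding isCont_def by (rule tendsto_mono[OF at_le, rotated]) auto
      moreover have "\<forall>\<^sub>F l in at_left \<Lambda>. H (2 * l - q, p) \<le> H (q, p)"
      proof (rule eventually_at_leftI[of "q / 2"])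
        fix l assume l: "l \<in> {q/2<..<\<Lambda>}"
        then have "good l" using below[of l] 3 \<Lambda>pos by simp
        then show "H (2 * l - q, p) \<le> H (q, p)" using l 3 p unfolding good_def by simp
      qed (use 3 in simp)
      ultimately show ?thesis by (intro tendsto_upperbound) auto
    qed (use lowest p in auto)
  qed
  have crit\<Lambda>: "crit \<Lambda>"
  proof (rule ccontr)
    assume nc: "\<not> crit \<Lambda>"
    obtain \<eta>1 where \<eta>1: "\<eta>1 > 0" "\<And>l. \<Lambda> \<le> l \<Longrightarrow> l < \<Lambda> + \<eta>1 \<Longrightarrow> \<not> crit l"
    proof -
      obtain p where p: "p \<in> {p0<..<0}" "a (\<Lambda>, p) \<noteq> 0" using nc unfolding crit_def by blast
      have "continuous_on UNIV (\<lambda>l. a (l, p))"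
        by (rule continuous_on_compose2[OF hess_on_continuous(2)[OF hess]]) (use p in \<open>auto intro!: continuous_intros\<close>)
      then have "isCont (\<lambda>l. a (l, p)) \<Lambda>" by (simp add: continuous_on_eq_continuous_at)
      then obtain e where e: "e > 0" "\<And>l. dist \<Lambda> l < e \<Longrightarrow> a (l, p) \<noteq> 0"
        using continuous_at_avoid[of \<Lambda> "\<lambda>l. a (l, p)" 0] p(2) by auto
      have "\<not> crit l" if "\<Lambda> \<le> l" "l < \<Lambda> + e" for l
        using e(2)[of l] p(1) that unfolding crit_def by (auto simp: dist_real_def)
      with e(1) show ?thesis using that by blast
    qed
    \<comment> \<open>\<open>U\<close> consists of planes from \<Lambda> onwards together with
      points of their inner rectangle at which the strict inequality fails. Its projection to the
      plane parameter is closed and misses \<Lambda>. Planes just beyond \<Lambda> therefore have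
      the right sign inside, and \<open>narrow\<close> makes them good.\<close>
    define V where "V = {x :: real \<times> real \<times> real. \<Lambda> \<le> fst x \<and> fst x \<le> \<Lambda> + 1 \<and> fst x + \<delta> \<le> fst (snd x) \<and>
        fst (snd x) \<le> 2 * fst x - \<delta> \<and> p0 + \<delta> \<le> snd (snd x) \<and> snd (snd x) \<le> - \<delta>}"
    define U where "U = {x \<in> V. H (fst (snd x), snd (snd x)) \<le> H (2 * fst x - fst (snd x), snd (snd x))}"
    have "closed V" unfolding V_def by (intro closed_Collect_conj closed_Collect_le continuous_intros)
    moreover have "continuous_on V (\<lambda>x. H (fst (snd x), snd (snd x)))"
      "continuous_on V (\<lambda>x. H (2 * fst x - fst (snd x), snd (snd x)))"
      using \<delta> by (intro continuous_on_compose2[OF cont] continuous_intros; force simp: V_def)+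
    ultimately have "closed U" unfolding U_def by (intro continuous_on_closed_Collect_le)
    moreover have "U \<subseteq> {\<Lambda>..\<Lambda>+1} \<times> {\<Lambda>+\<delta>..2*(\<Lambda>+1)-\<delta>} \<times> {p0+\<delta>..-\<delta>}"
      unfolding U_def V_def by auto
    ultimately have "compact U"
      using compact_Int_closed[of "{\<Lambda>..\<Lambda>+1} \<times> {\<Lambda>+\<delta>..2*(\<Lambda>+1)-\<delta>} \<times> {p0+\<delta>..-\<delta>}" U]
      by (auto simp: Int_absorb1 intro!: compact_Times)
    then have "compact (fst ` U)" by (intro compact_continuous_image continuous_intros)
    then have "closed (fst ` U)" by (rule compact_imp_closed)
    moreover have "\<Lambda> \<notin> fst ` U"
    proof
      assume "\<Lambda> \<in> fst ` U"
      then obtain q p where "(\<Lambda>, q, p) \<in> U" by force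
      then have "\<Lambda> + \<delta> \<le> q" "q \<le> 2 * \<Lambda> - \<delta>" "p0 + \<delta> \<le> p" "p \<le> - \<delta>" "H (q, p) \<le> H (2 * \<Lambda> - q, p)"
        by (auto simp: U_def V_def)
      then show False using strict[OF \<Lambda>pos good\<Lambda> nc, of q p] \<delta> by auto
    qed
    ultimately obtain \<eta>2 where \<eta>2: "\<eta>2 > 0" "ball \<Lambda> \<eta>2 \<subseteq> - fst ` U"
      using openE[of "- fst ` U" \<Lambda>] by blast
    define \<eta> where "\<eta> = min \<eta>1 (min \<eta>2 1)"
    have \<eta>: "\<eta> > 0" using \<eta>1 \<eta>2 by (simp add: \<eta>_def)
    obtain l where l: "l \<in> D" "l < \<Lambda> + \<eta>" using near[OF \<eta>] by blast
    have l': "\<Lambda> \<le> l" "l < \<Lambda> + \<eta>1" "l < \<Lambda> + \<eta>2" "l \<le> \<Lambda> + 1" "0 < l" "l \<le> L" using l \<Lambda>_le[OF l(1)] by (auto simp: \<eta>_def D_def)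
    have nU: "l \<notin> fst ` U" using \<eta>2(2) l' by (auto simp: dist_real_def subset_iff)
    have "good l"
    proof (intro narrow[OF l'(5,6)] ballI, rule ccontr)
      fix q p assume "q \<in> {l+\<delta>..2*l-\<delta>}" "p \<in> {p0+\<delta>..-\<delta>}" "\<not> H (2 * l - q, p) \<le> H (q, p)"
      then have "(l, q, p) \<in> U" using l' by (auto simp: U_def V_def)
      with nU show False by force
    qed
    moreover have "\<not> crit l" using \<eta>1(2) l' by blast
    ultimately show False using l(1) by (simp add: D_def)
  qed
  have sym\<Lambda>: "\<forall>s. H (\<Lambda> + s, 0) = H (\<Lambda> - s, 0)"
    using sym[of \<Lambda>] crit\<Lambda> unfolding crit_def by blast
  \<comment> \<open>The plane halfway between \<open>x\<close> and \<open>y\<close> maps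
    \<open>y\<close> to \<open>x\<close>. It lies strictly before \<Lambda>, hence is good and not
    critical.\<close>
  have step: "H (x, 0) < H (y, 0)" if "0 < x" "x < y" "y \<le> \<Lambda>" for x y
  proof -
    have "2 * ((x + y) / 2) - y = x" by (simp add: field_simps)
    then show ?thesis using strict[of "(x + y) / 2" y 0] below[of "(x + y) / 2"] that p0 by auto
  qed
  have "strict_mono_on {0..\<Lambda>} (\<lambda>q. H (q, 0))"
  proof (rule strict_mono_onI)
    fix x y assume xy: "x \<in> {0..\<Lambda>}" "y \<in> {0..\<Lambda>}" "x < y"
    show "H (x, 0) < H (y, 0)"
    proof (cases "x = 0")
      \<comment> \<open>The strict inequality stops short of \<open>q = 2 * l\<close>, so the point
        \<open>0\<close> is reached through its weak minimality and \<open>y / 2\<close>.\<close>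
      case True
      have "H (0, 0) \<le> H (y / 2, 0)" using lowest p0 by simp
      also have "\<dots> < H (y, 0)" using step[of "y / 2" y] xy True by simp
      finally show ?thesis using True by simp
    qed (use step[of x y] xy in auto)
  qed
  with sym\<Lambda> \<Lambda>pos even show ?thesis by blast
qed

end

section \<open>Unique continuation\<close>

text \<open>Logarithmic polar coordinates, with radius \<open>exp t\<close> about \<open>a\<close>.
  The map is conformal, so in the sum of the two pure second derivatives the first-order terms
  cancel and the Laplacian is only multiplied by the square of the radius.\<close>

lemma hess_on_polar:
  fixes f :: "real \<times> real \<Rightarrow> real" and a :: "real \<times> real"
  defines "c \<equiv> \<lambda>z::real \<times> real. exp (fst z) * cos (snd z)"
    and "s \<equiv> \<lambda>z::real \<times> real. exp (fst z) * sin (snd z)"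
  defines "\<Gamma> \<equiv> \<lambda>z. (fst a + c z, snd a + s z)"
  assumes f: "hess_on S f fx fy fxx fxy fyy" and T: "\<And>z. z \<in> T \<Longrightarrow> \<Gamma> z \<in> S"
  shows "hess_on T (\<lambda>z. f (\<Gamma> z))
     (\<lambda>z. fx (\<Gamma> z) * c z + fy (\<Gamma> z) * s z) (\<lambda>z. fy (\<Gamma> z) * c z - fx (\<Gamma> z) * s z)
     (\<lambda>z. (fxx (\<Gamma> z) * c z + fxy (\<Gamma> z) * s z) * c z + fx (\<Gamma> z) * c z
        + (fxy (\<Gamma> z) * c z + fyy (\<Gamma> z) * s z) * s z + fy (\<Gamma> z) * s z)
     (\<lambda>z. (fxy (\<Gamma> z) * c z - fxx (\<Gamma> z) * s z) * c z - fx (\<Gamma> z) * s z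
        + (fyy (\<Gamma> z) * c z - fxy (\<Gamma> z) * s z) * s z + fy (\<Gamma> z) * c z)
     (\<lambda>z. (fyy (\<Gamma> z) * c z - fxy (\<Gamma> z) * s z) * c z - fy (\<Gamma> z) * s z
        - (fxy (\<Gamma> z) * c z - fxx (\<Gamma> z) * s z) * s z - fx (\<Gamma> z) * c z)"
  unfolding hess_on_def
proof (intro ballI)
  fix z assume "z \<in> T"
  then have S: "\<Gamma> z \<in> S" by (rule T)
  have c: "(c has_derivative (\<lambda>h. c z * fst h - s z * snd h)) (at z)"
    unfolding c_def s_def by (auto intro!: derivative_eq_intros simp: algebra_simps)
  have s: "(s has_derivative (\<lambda>h. s z * fst h + c z * snd h)) (at z)"
    unfolding c_def s_def by (auto intro!: derivative_eq_intros simp: algebra_simps)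
  have \<Gamma>: "(\<Gamma> has_derivative (\<lambda>h. (c z * fst h - s z * snd h, s z * fst h + c z * snd h))) (at z)"
    unfolding \<Gamma>_def by (auto intro!: derivative_eq_intros c s)
  have comp: "((\<lambda>z. k (\<Gamma> z)) has_derivative
       (\<lambda>h. kx * (c z * fst h - s z * snd h) + ky * (s z * fst h + c z * snd h))) (at z)"
    if "(k has_derivative (\<lambda>h. kx * fst h + ky * snd h)) (at (\<Gamma> z))" for k kx ky
    using has_derivative_compose[OF \<Gamma> that] by simp
  note d = f[unfolded hess_on_def, rule_format, OF S]
  have f0: "((\<lambda>z. f (\<Gamma> z)) has_derivative
       (\<lambda>h. fx (\<Gamma> z) * (c z * fst h - s z * snd h) + fy (\<Gamma> z) * (s z * fst h + c z * snd h))) (at z)"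
    and f1: "((\<lambda>z. fx (\<Gamma> z)) has_derivative
       (\<lambda>h. fxx (\<Gamma> z) * (c z * fst h - s z * snd h) + fxy (\<Gamma> z) * (s z * fst h + c z * snd h))) (at z)"
    and f2: "((\<lambda>z. fy (\<Gamma> z)) has_derivative
       (\<lambda>h. fxy (\<Gamma> z) * (c z * fst h - s z * snd h) + fyy (\<Gamma> z) * (s z * fst h + c z * snd h))) (at z)"
    using d by (auto intro!: comp)
  show "((\<lambda>z. f (\<Gamma> z)) has_derivative
       (\<lambda>h. (fx (\<Gamma> z) * c z + fy (\<Gamma> z) * s z) * fst h + (fy (\<Gamma> z) * c z - fx (\<Gamma> z) * s z) * snd h)) (at z) \<and>
     ((\<lambda>z. fx (\<Gamma> z) * c z + fy (\<Gamma> z) * s z) has_derivative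
       (\<lambda>h. ((fxx (\<Gamma> z) * c z + fxy (\<Gamma> z) * s z) * c z + fx (\<Gamma> z) * c z
        + (fxy (\<Gamma> z) * c z + fyy (\<Gamma> z) * s z) * s z + fy (\<Gamma> z) * s z) * fst h +
        ((fxy (\<Gamma> z) * c z - fxx (\<Gamma> z) * s z) * c z - fx (\<Gamma> z) * s z
        + (fyy (\<Gamma> z) * c z - fxy (\<Gamma> z) * s z) * s z + fy (\<Gamma> z) * c z) * snd h)) (at z) \<and>
     ((\<lambda>z. fy (\<Gamma> z) * c z - fx (\<Gamma> z) * s z) has_derivative
       (\<lambda>h. ((fxy (\<Gamma> z) * c z - fxx (\<Gamma> z) * s z) * c z - fx (\<Gamma> z) * s z
        + (fyy (\<Gamma> z) * c z - fxy (\<Gamma> z) * s z) * s z + fy (\<Gamma> z) * c z) * fst h +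
        ((fyy (\<Gamma> z) * c z - fxy (\<Gamma> z) * s z) * c z - fy (\<Gamma> z) * s z
        - (fxy (\<Gamma> z) * c z - fxx (\<Gamma> z) * s z) * s z - fx (\<Gamma> z) * c z) * snd h)) (at z)"
  proof (intro conjI)
    show "((\<lambda>z. f (\<Gamma> z)) has_derivative
       (\<lambda>h. (fx (\<Gamma> z) * c z + fy (\<Gamma> z) * s z) * fst h + (fy (\<Gamma> z) * c z - fx (\<Gamma> z) * s z) * snd h)) (at z)"
      by (rule has_derivative_eq_rhs[OF f0]) (simp add: fun_eq_iff algebra_simps)
  qed (rule has_derivative_eq_rhs[OF has_derivative_add[OF has_derivative_mult[OF f1 c] has_derivative_mult[OF f2 s]]],
       simp add: fun_eq_iff algebra_simps,
       rule has_derivative_eq_rhs[OF has_derivative_diff[OF has_derivative_mult[OF f2 c] has_derivative_mult[OF f1 s]]],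
       simp add: fun_eq_iff algebra_simps)
qed

text \<open>Multiplication by a Carleman weight that depends on the radial coordinate alone, which
  is why only the derivatives in that coordinate acquire extra terms.\<close>

lemma hess_on_weighted:
  fixes F :: "real \<times> real \<Rightarrow> real" and \<phi> \<phi>1 \<phi>2 :: "real \<Rightarrow> real"
  assumes F: "hess_on S F Ft Fh Ftt Fth Fhh"
    and \<phi>: "\<And>t. (\<phi> has_real_derivative \<phi>1 t) (at t)" "\<And>t. (\<phi>1 has_real_derivative \<phi>2 t) (at t)"
  shows "hess_on S (\<lambda>z. exp (\<phi> (fst z)) * F z) (\<lambda>z. exp (\<phi> (fst z)) * (Ft z + \<phi>1 (fst z) * F z))
     (\<lambda>z. exp (\<phi> (fst z)) * Fh z)
     (\<lambda>z. exp (\<phi> (fst z)) * (Ftt z + 2 * \<phi>1 (fst z) * Ft z + (\<phi>2 (fst z) + (\<phi>1 (fst z))\<^sup>2) * F z))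
     (\<lambda>z. exp (\<phi> (fst z)) * (Fth z + \<phi>1 (fst z) * Fh z)) (\<lambda>z. exp (\<phi> (fst z)) * Fhh z)"
  unfolding hess_on_def
proof (intro ballI conjI)
  fix z assume z: "z \<in> S"
  have k: "((\<lambda>z. k (fst z)) has_derivative (\<lambda>h. k' * fst h)) (at z)"
    if "(k has_real_derivative k') (at (fst z))" for k k'
    using has_derivative_compose[OF has_derivative_fst[OF has_derivative_ident]
        that[unfolded has_field_derivative_def]] .
  note d = F[unfolded hess_on_def, rule_format, OF z]
  note d1 = d[THEN conjunct1] and d2 = d[THEN conjunct2, THEN conjunct1] and d3 = d[THEN conjunct2, THEN conjunct2]
  have E: "((\<lambda>z. exp (\<phi> (fst z))) has_derivative (\<lambda>h. exp (\<phi> (fst z)) * \<phi>1 (fst z) * fst h)) (at z)"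
    by (rule k) (auto intro!: derivative_eq_intros \<phi>)
  note p1 = k[OF \<phi>(2)]
  show "((\<lambda>z. exp (\<phi> (fst z)) * F z) has_derivative (\<lambda>h. exp (\<phi> (fst z)) * (Ft z + \<phi>1 (fst z) * F z) * fst h
     + exp (\<phi> (fst z)) * Fh z * snd h)) (at z)"
    by (rule has_derivative_eq_rhs[OF has_derivative_mult[OF E d1]]) (simp add: fun_eq_iff algebra_simps)
  show "((\<lambda>z. exp (\<phi> (fst z)) * (Ft z + \<phi>1 (fst z) * F z)) has_derivative
     (\<lambda>h. exp (\<phi> (fst z)) * (Ftt z + 2 * \<phi>1 (fst z) * Ft z + (\<phi>2 (fst z) + (\<phi>1 (fst z))\<^sup>2) * F z) * fst h
     + exp (\<phi> (fst z)) * (Fth z + \<phi>1 (fst z) * Fh z) * snd h)) (at z)"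
    by (rule has_derivative_eq_rhs[OF has_derivative_mult[OF E has_derivative_add[OF d2 has_derivative_mult[OF p1 d1]]]])
      (simp add: fun_eq_iff algebra_simps power2_eq_square)
  show "((\<lambda>z. exp (\<phi> (fst z)) * Fh z) has_derivative (\<lambda>h. exp (\<phi> (fst z)) * (Fth z + \<phi>1 (fst z) * Fh z) * fst h
     + exp (\<phi> (fst z)) * Fhh z * snd h)) (at z)"
    by (rule has_derivative_eq_rhs[OF has_derivative_mult[OF E d3]]) (simp add: fun_eq_iff algebra_simps)
qed

lemma has_derivative_rowcol:
  assumes "(k has_derivative (\<lambda>h. kx * fst h + ky * snd h)) (at (x, y))"
  shows "((\<lambda>s. k (s, y)) has_real_derivative kx) (at x)" "((\<lambda>s. k (x, s)) has_real_derivative ky) (at y)"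
proof -
  have 1: "((\<lambda>s. (s, y)) has_derivative (\<lambda>h. (h, 0))) (at x)"
    and 2: "((\<lambda>s. (x, s)) has_derivative (\<lambda>h. (0, h))) (at y)"
    by (auto intro!: derivative_eq_intros)
  show "((\<lambda>s. k (s, y)) has_real_derivative kx) (at x)"
    using has_derivative_compose[OF 1 assms] by (simp add: has_field_derivative_def)
  show "((\<lambda>s. k (x, s)) has_real_derivative ky) (at y)"
    using has_derivative_compose[OF 2 assms] by (simp add: has_field_derivative_def)
qed

lemma hess_on_partials:
  assumes "hess_on S f fq fp fqq fqp fpp" "(x, y) \<in> S"
  shows "((\<lambda>s. f (s, y)) has_real_derivative fq (x, y)) (at x)"
    "((\<lambda>s. fq (s, y)) has_real_derivative fqq (x, y)) (at x)"
    "((\<lambda>s. fp (s, y)) has_real_derivative fqp (x, y)) (at x)"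
    "((\<lambda>s. f (x, s)) has_real_derivative fp (x, y)) (at y)"
    "((\<lambda>s. fq (x, s)) has_real_derivative fqp (x, y)) (at y)"
    "((\<lambda>s. fp (x, s)) has_real_derivative fpp (x, y)) (at y)"
proof -
  note d = assms(1)[unfolded hess_on_def, rule_format, OF assms(2)]
  show "((\<lambda>s. f (s, y)) has_real_derivative fq (x, y)) (at x)"
    "((\<lambda>s. fq (s, y)) has_real_derivative fqq (x, y)) (at x)"
    "((\<lambda>s. fp (s, y)) has_real_derivative fqp (x, y)) (at x)"
    "((\<lambda>s. f (x, s)) has_real_derivative fp (x, y)) (at y)"
    "((\<lambda>s. fq (x, s)) has_real_derivative fqp (x, y)) (at y)"
    "((\<lambda>s. fp (x, s)) has_real_derivative fpp (x, y)) (at y)"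
    using d by (auto intro: has_derivative_rowcol)
qed

section \<open>Integration by parts and the Carleman estimate\<close>

lemma integral_cbox_fst_derivative:
  fixes B B' :: "real \<times> real \<Rightarrow> real"
  assumes "a \<le> b" and cont: "continuous_on (cbox (a, c) (b, d)) B'"
    and D: "\<And>t \<theta>. t \<in> {a..b} \<Longrightarrow> \<theta> \<in> {c..d} \<Longrightarrow> ((\<lambda>t. B (t, \<theta>)) has_real_derivative B' (t, \<theta>)) (at t)"
  shows "integral (cbox (a, c) (b, d)) B' = integral {c..d} (\<lambda>\<theta>. B (b, \<theta>) - B (a, \<theta>))"
proof -
  have "integral (cbox (a, c) (b, d)) B' = integral (cbox a b) (\<lambda>t. integral (cbox c d) (\<lambda>\<theta>. B' (t, \<theta>)))"
    using cont by (rule integral_prod_continuous)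
  also have "\<dots> = integral (cbox c d) (\<lambda>\<theta>. integral (cbox a b) (\<lambda>t. B' (t, \<theta>)))"
    using cont by (intro integral_swap_continuous) simp
  also have "\<dots> = integral (cbox c d) (\<lambda>\<theta>. B (b, \<theta>) - B (a, \<theta>))"
  proof (rule integral_cong)
    fix \<theta> assume "\<theta> \<in> cbox c d"
    then have \<theta>: "\<theta> \<in> {c..d}" by simp
    have "((\<lambda>t. B' (t, \<theta>)) has_integral B (b, \<theta>) - B (a, \<theta>)) {a..b}"
    proof (rule fundamental_theorem_of_calculus[OF assms(1)])
      fix t assume "t \<in> {a..b}"
      from D[OF this \<theta>] show "((\<lambda>t. B (t, \<theta>)) has_vector_derivative B' (t, \<theta>)) (at t within {a..b})"
        unfolding has_real_derivative_iff_has_vector_derivative by (rule has_vector_derivative_at_within)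
    qed
    then show "integral (cbox a b) (\<lambda>t. B' (t, \<theta>)) = B (b, \<theta>) - B (a, \<theta>)" by (simp add: integral_unique)
  qed
  finally show ?thesis by simp
qed

lemma integral_cbox_snd_derivative:
  fixes B B' :: "real \<times> real \<Rightarrow> real"
  assumes "c \<le> d" and cont: "continuous_on (cbox (a, c) (b, d)) B'"
    and D: "\<And>t \<theta>. t \<in> {a..b} \<Longrightarrow> \<theta> \<in> {c..d} \<Longrightarrow> ((\<lambda>\<theta>. B (t, \<theta>)) has_real_derivative B' (t, \<theta>)) (at \<theta>)"
  shows "integral (cbox (a, c) (b, d)) B' = integral {a..b} (\<lambda>t. B (t, d) - B (t, c))"
proof -
  have "integral (cbox (a, c) (b, d)) B' = integral (cbox a b) (\<lambda>t. integral (cbox c d) (\<lambda>\<theta>. B' (t, \<theta>)))"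
    using cont by (rule integral_prod_continuous)
  also have "\<dots> = integral (cbox a b) (\<lambda>t. B (t, d) - B (t, c))"
  proof (rule integral_cong)
    fix t assume "t \<in> cbox a b"
    then have t: "t \<in> {a..b}" by simp
    have "((\<lambda>\<theta>. B' (t, \<theta>)) has_integral B (t, d) - B (t, c)) {c..d}"
    proof (rule fundamental_theorem_of_calculus[OF assms(1)])
      fix \<theta> assume "\<theta> \<in> {c..d}"
      from D[OF t this] show "((\<lambda>\<theta>. B (t, \<theta>)) has_vector_derivative B' (t, \<theta>)) (at \<theta> within {c..d})"
        unfolding has_real_derivative_iff_has_vector_derivative by (rule has_vector_derivative_at_within)
    qed
    then show "integral (cbox c d) (\<lambda>\<theta>. B' (t, \<theta>)) = B (t, d) - B (t, c)" by (simp add: integral_unique)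
  qed
  finally show ?thesis by simp
qed

text \<open>Integration by parts for the Laplacian conjugated with a radial weight. The angular
  fluxes cancel by periodicity and the flux at \<open>t0\<close> vanishes with the data there. The
  flux at \<open>t1\<close> has no sign and is kept as a separate term.\<close>

lemma carleman_identity:
  fixes v vt vh vtt vth vhh :: "real \<times> real \<Rightarrow> real" and \<phi>1 \<phi>2 \<phi>3 \<phi>4 :: "real \<Rightarrow> real"
  assumes t: "t0 \<le> t1"
    and v: "hess_on S v vt vh vtt vth vhh" and R: "cbox (t0, 0) (t1, 2 * pi) \<subseteq> S"
    and cont: "continuous_on (cbox (t0, 0) (t1, 2 * pi)) vtt" "continuous_on (cbox (t0, 0) (t1, 2 * pi)) vth"
      "continuous_on (cbox (t0, 0) (t1, 2 * pi)) vhh"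
    and \<phi>: "\<And>t. (\<phi>1 has_real_derivative \<phi>2 t) (at t)" "\<And>t. (\<phi>2 has_real_derivative \<phi>3 t) (at t)"
      "\<And>t. (\<phi>3 has_real_derivative \<phi>4 t) (at t)" "continuous_on UNIV \<phi>4"
    and per: "\<And>t. v (t, 2 * pi) = v (t, 0)" "\<And>t. vt (t, 2 * pi) = vt (t, 0)" "\<And>t. vh (t, 2 * pi) = vh (t, 0)"
    and zero: "\<And>\<theta>. v (t0, \<theta>) = 0" "\<And>\<theta>. vt (t0, \<theta>) = 0" "\<And>\<theta>. vh (t0, \<theta>) = 0"
  shows "integral (cbox (t0, 0) (t1, 2 * pi)) (\<lambda>z. 4 * \<phi>2 (fst z) * (vt z)\<^sup>2
            + (4 * (\<phi>1 (fst z))\<^sup>2 * \<phi>2 (fst z) - \<phi>4 (fst z)) * (v z)\<^sup>2)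
     + integral {0..2 * pi} (\<lambda>\<theta>. - 2 * \<phi>1 t1 * (vt (t1, \<theta>))\<^sup>2 + 2 * \<phi>1 t1 * (vh (t1, \<theta>))\<^sup>2
            - 2 * (\<phi>1 t1) ^ 3 * (v (t1, \<theta>))\<^sup>2 - 2 * \<phi>2 t1 * v (t1, \<theta>) * vt (t1, \<theta>) + \<phi>3 t1 * (v (t1, \<theta>))\<^sup>2)
    \<le> integral (cbox (t0, 0) (t1, 2 * pi)) (\<lambda>z. (vtt z + vhh z - 2 * \<phi>1 (fst z) * vt z
            + ((\<phi>1 (fst z))\<^sup>2 - \<phi>2 (fst z)) * v z)\<^sup>2)"
proof -
  let ?R = "cbox (t0, 0) (t1, 2 * pi)"
  have vS: "hess_on ?R v vt vh vtt vth vhh" using hess_on_subset[OF v R] .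
  note cv = hess_on_continuous[OF vS]
  have c\<phi>: "continuous_on UNIV \<phi>1" "continuous_on UNIV \<phi>2" "continuous_on UNIV \<phi>3"
    using \<phi>(1-3) by (auto intro!: continuous_at_imp_continuous_on DERIV_isCont)
  have c\<phi>': "continuous_on ?R (\<lambda>z. \<phi>1 (fst z))" "continuous_on ?R (\<lambda>z. \<phi>2 (fst z))"
    "continuous_on ?R (\<lambda>z. \<phi>3 (fst z))" "continuous_on ?R (\<lambda>z. \<phi>4 (fst z))"
    using c\<phi> \<phi>(4) by (auto intro!: continuous_on_compose2[of UNIV _ _ fst] continuous_intros)
  \<comment> \<open>\<open>B\<close> and \<open>C\<close> are the radial and the angular flux,
    \<open>B'\<close> and \<open>C'\<close> their derivatives. They are designed so that, together
    with \<open>G\<close>, the derivatives add up to twice the product of the two parts of the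
    conjugated operator.\<close>
  define B where "B z = - 2 * \<phi>1 (fst z) * (vt z)\<^sup>2 + 2 * \<phi>1 (fst z) * (vh z)\<^sup>2
      - 2 * (\<phi>1 (fst z)) ^ 3 * (v z)\<^sup>2 - 2 * \<phi>2 (fst z) * v z * vt z + \<phi>3 (fst z) * (v z)\<^sup>2" for z
  define B' where "B' z = - 2 * \<phi>2 (fst z) * (vt z)\<^sup>2 - 4 * \<phi>1 (fst z) * vt z * vtt z
      + 2 * \<phi>2 (fst z) * (vh z)\<^sup>2 + 4 * \<phi>1 (fst z) * vh z * vth z
      - 6 * (\<phi>1 (fst z))\<^sup>2 * \<phi>2 (fst z) * (v z)\<^sup>2 - 4 * (\<phi>1 (fst z)) ^ 3 * v z * vt z
      - 2 * \<phi>3 (fst z) * v z * vt z - 2 * \<phi>2 (fst z) * (vt z)\<^sup>2 - 2 * \<phi>2 (fst z) * v z * vtt z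
      + \<phi>4 (fst z) * (v z)\<^sup>2 + 2 * \<phi>3 (fst z) * v z * vt z" for z
  define C where "C z = - 4 * \<phi>1 (fst z) * vt z * vh z - 2 * \<phi>2 (fst z) * v z * vh z" for z
  define C' where "C' z = - 4 * \<phi>1 (fst z) * vth z * vh z - 4 * \<phi>1 (fst z) * vt z * vhh z
      - 2 * \<phi>2 (fst z) * (vh z)\<^sup>2 - 2 * \<phi>2 (fst z) * v z * vhh z" for z
  define G where "G z = 4 * \<phi>2 (fst z) * (vt z)\<^sup>2 + (4 * (\<phi>1 (fst z))\<^sup>2 * \<phi>2 (fst z) - \<phi>4 (fst z)) * (v z)\<^sup>2" for z
  define P where "P z = vtt z + vhh z - 2 * \<phi>1 (fst z) * vt z + ((\<phi>1 (fst z))\<^sup>2 - \<phi>2 (fst z)) * v z" for z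
  have contB': "continuous_on ?R B'" unfolding B'_def by (intro continuous_intros cv cont c\<phi>')
  have contC': "continuous_on ?R C'" unfolding C'_def by (intro continuous_intros cv cont c\<phi>')
  have contG: "continuous_on ?R G" unfolding G_def by (intro continuous_intros cv cont c\<phi>')
  have contP: "continuous_on ?R P" unfolding P_def by (intro continuous_intros cv cont c\<phi>')
  have in_R: "(t, \<theta>) \<in> ?R" if "t \<in> {t0..t1}" "\<theta> \<in> {0..2 * pi}" for t \<theta>
    using that by (auto simp: cbox_Pair_eq)
  have "integral ?R B' = integral {0..2 * pi} (\<lambda>\<theta>. B (t1, \<theta>) - B (t0, \<theta>))"
  proof (rule integral_cbox_fst_derivative[OF t contB'])
    fix t \<theta> assume "t \<in> {t0..t1}" "\<theta> \<in> {0..2 * pi}"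
    note d = hess_on_partials[OF vS in_R[OF this]]
    show "((\<lambda>t. B (t, \<theta>)) has_real_derivative B' (t, \<theta>)) (at t)"
      unfolding B_def B'_def fst_conv
      by (rule derivative_eq_intros d \<phi> refl)+ (simp add: algebra_simps power2_eq_square power3_eq_cube)
  qed
  then have IB: "integral ?R B' = integral {0..2 * pi} (\<lambda>\<theta>. B (t1, \<theta>))"
    by (simp add: B_def zero)
  have "integral ?R C' = integral {t0..t1} (\<lambda>t. C (t, 2 * pi) - C (t, 0))"
  proof (rule integral_cbox_snd_derivative[OF _ contC'])
    fix t \<theta> assume "t \<in> {t0..t1}" "\<theta> \<in> {0..2 * pi}"
    note d = hess_on_partials[OF vS in_R[OF this]]
    show "((\<lambda>\<theta>. C (t, \<theta>)) has_real_derivative C' (t, \<theta>)) (at \<theta>)"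
      unfolding C_def C'_def fst_conv
      by (rule derivative_eq_intros d refl)+ (simp add: algebra_simps power2_eq_square)
  qed simp
  then have IC: "integral ?R C' = 0" by (simp add: C_def per)
  txt \<open>\<open>SS\<close> and \<open>AA\<close> are the symmetric and the antisymmetric part of the conjugated Laplacian; the
    integral of \<open>2 * SS * AA\<close> is that of their commutator.\<close>
  have "G z + B' z + C' z \<le> (P z)\<^sup>2" for z
  proof -
    define SS AA where "SS = vtt z + vhh z + (\<phi>1 (fst z))\<^sup>2 * v z" and "AA = - 2 * \<phi>1 (fst z) * vt z - \<phi>2 (fst z) * v z"
    have "G z + B' z + C' z = 2 * SS * AA"
      unfolding G_def B'_def C'_def SS_def AA_def by (simp add: algebra_simps power2_eq_square power3_eq_cube)
    moreover have "P z = SS + AA" by (simp add: P_def SS_def AA_def algebra_simps)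
    moreover have "2 * SS * AA \<le> (SS + AA)\<^sup>2" by (simp add: power2_sum)
    ultimately show ?thesis by simp
  qed
  then have "integral ?R (\<lambda>z. G z + B' z + C' z) \<le> integral ?R (\<lambda>z. (P z)\<^sup>2)"
    by (intro integral_le integrable_continuous continuous_intros contG contB' contC' contP) auto
  also have "integral ?R (\<lambda>z. G z + B' z + C' z) = integral ?R G + integral ?R B' + integral ?R C'"
    by (simp add: integral_add integrable_continuous continuous_on_add contG contB' contC')
  finally show ?thesis unfolding IB IC G_def B_def P_def by simp
qed

text \<open>The exponent of the weight is \<tau> divided by the squared radius, hence convex in
  \<open>t\<close> and largest near the centre. It gives \<open>v\<^sup>2\<close> the coefficient
  \<open>64 * p ^ 3 - 16 * p\<close>, which absorbs the potential term \<open>C\<^sup>2\<close> for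
  large \<tau> and leaves at least one.\<close>

lemma carleman_estimate:
  fixes F Ft Fh Ftt Fth Fhh :: "real \<times> real \<Rightarrow> real"
  assumes t: "t0 \<le> t1" and "1 \<le> \<tau> * exp (- 2 * t1)" "1 + C\<^sup>2 \<le> \<tau> * exp (- 2 * t1)"
    and F: "hess_on S F Ft Fh Ftt Fth Fhh" and R: "cbox (t0, 0) (t1, 2 * pi) \<subseteq> S"
    and cont: "continuous_on (cbox (t0, 0) (t1, 2 * pi)) Ftt" "continuous_on (cbox (t0, 0) (t1, 2 * pi)) Fth"
      "continuous_on (cbox (t0, 0) (t1, 2 * pi)) Fhh"
    and per: "\<And>t. F (t, 2 * pi) = F (t, 0)" "\<And>t. Ft (t, 2 * pi) = Ft (t, 0)" "\<And>t. Fh (t, 2 * pi) = Fh (t, 0)"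
    and zero: "\<And>\<theta>. F (t0, \<theta>) = 0" "\<And>\<theta>. Ft (t0, \<theta>) = 0" "\<And>\<theta>. Fh (t0, \<theta>) = 0"
    and le: "\<And>z. z \<in> cbox (t0, 0) (t1, 2 * pi) \<Longrightarrow> \<bar>Ftt z + Fhh z\<bar> \<le> C * \<bar>F z\<bar>"
    and N: "\<And>\<theta>. \<theta> \<in> {0..2 * pi} \<Longrightarrow> \<bar>F (t1, \<theta>)\<bar> \<le> N" "\<And>\<theta>. \<theta> \<in> {0..2 * pi} \<Longrightarrow> \<bar>Ft (t1, \<theta>)\<bar> \<le> N"
       "\<And>\<theta>. \<theta> \<in> {0..2 * pi} \<Longrightarrow> \<bar>Fh (t1, \<theta>)\<bar> \<le> N"
  shows "integral (cbox (t0, 0) (t1, 2 * pi)) (\<lambda>z. exp (2 * \<tau> * exp (- 2 * fst z)) * (F z)\<^sup>2)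
    \<le> 2 * pi * (20 * (\<tau> * exp (- 2 * t1)) * N\<^sup>2 * exp (2 * (\<tau> * exp (- 2 * t1))))"
proof -
  let ?R = "cbox (t0, 0) (t1, 2 * pi)"
  define \<phi> where "\<phi> t = \<tau> * exp (- 2 * t)" for t
  \<comment> \<open>The smallest value of the exponent on the annulus, taken on the outer
    circle.\<close>
  define s where "s = \<phi> t1"
  have s: "1 \<le> s" "1 + C\<^sup>2 \<le> s" using assms(2,3) by (auto simp: s_def \<phi>_def)
  have "0 < \<tau> * exp (- 2 * t1)" using assms(2) by linarith
  then have \<tau>: "0 < \<tau>" by (simp add: zero_less_mult_iff)
  define \<phi>1 where "\<phi>1 t = - 2 * \<phi> t" for t
  define \<phi>2 where "\<phi>2 t = 4 * \<phi> t" for t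
  define \<phi>3 where "\<phi>3 t = - 8 * \<phi> t" for t
  define \<phi>4 where "\<phi>4 t = 16 * \<phi> t" for t
  have D\<phi>: "(\<phi> has_real_derivative \<phi>1 t) (at t)" "(\<phi>1 has_real_derivative \<phi>2 t) (at t)"
    "(\<phi>2 has_real_derivative \<phi>3 t) (at t)" "(\<phi>3 has_real_derivative \<phi>4 t) (at t)" for t
    unfolding \<phi>_def[abs_def] \<phi>1_def[abs_def] \<phi>2_def[abs_def] \<phi>3_def[abs_def] \<phi>4_def[abs_def]
    by (auto intro!: derivative_eq_intros)
  have c4: "continuous_on UNIV \<phi>4" unfolding \<phi>4_def \<phi>_def by (intro continuous_intros)
  have c\<phi>: "continuous_on ?R (\<lambda>z. \<phi> (fst z))" unfolding \<phi>_def by (intro continuous_intros)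
  define E where "E z = exp (\<phi> (fst z))" for z :: "real \<times> real"
  define v where "v z = E z * F z" for z
  define vt where "vt z = E z * (Ft z + \<phi>1 (fst z) * F z)" for z
  define vh where "vh z = E z * Fh z" for z
  define vtt where "vtt z = E z * (Ftt z + 2 * \<phi>1 (fst z) * Ft z + (\<phi>2 (fst z) + (\<phi>1 (fst z))\<^sup>2) * F z)" for z
  define vth where "vth z = E z * (Fth z + \<phi>1 (fst z) * Fh z)" for z
  define vhh where "vhh z = E z * Fhh z" for z
  have hv: "hess_on S v vt vh vtt vth vhh"
    unfolding v_def[abs_def] vt_def[abs_def] vh_def[abs_def] vtt_def[abs_def] vth_def[abs_def] vhh_def[abs_def] E_def
    by (rule hess_on_weighted[OF F D\<phi>(1,2)])
  note cF = hess_on_continuous[OF hess_on_subset[OF F R]]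
  have cE: "continuous_on ?R E" unfolding E_def by (intro continuous_intros c\<phi>)
  have c2: "continuous_on ?R vtt" "continuous_on ?R vth" "continuous_on ?R vhh"
    unfolding vtt_def vth_def vhh_def \<phi>1_def \<phi>2_def by (intro continuous_intros cE cF cont c\<phi>)+
  note cv = hess_on_continuous[OF hess_on_subset[OF hv R]]
  define Bd where "Bd \<theta> = - 2 * \<phi>1 t1 * (vt (t1, \<theta>))\<^sup>2 + 2 * \<phi>1 t1 * (vh (t1, \<theta>))\<^sup>2
            - 2 * (\<phi>1 t1) ^ 3 * (v (t1, \<theta>))\<^sup>2 - 2 * \<phi>2 t1 * v (t1, \<theta>) * vt (t1, \<theta>) + \<phi>3 t1 * (v (t1, \<theta>))\<^sup>2" for \<theta>
  define G where "G z = 4 * \<phi>2 (fst z) * (vt z)\<^sup>2 + (4 * (\<phi>1 (fst z))\<^sup>2 * \<phi>2 (fst z) - \<phi>4 (fst z)) * (v z)\<^sup>2" for z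
  define P where "P z = (vtt z + vhh z - 2 * \<phi>1 (fst z) * vt z + ((\<phi>1 (fst z))\<^sup>2 - \<phi>2 (fst z)) * v z)\<^sup>2" for z
  have id: "integral ?R G + integral {0..2 * pi} Bd \<le> integral ?R P"
    unfolding G_def[abs_def] Bd_def[abs_def] P_def[abs_def]
    by (rule carleman_identity[OF t hv R c2 D\<phi>(2-4) c4])
      (auto simp: v_def vt_def vh_def E_def per zero)
  have contG: "continuous_on ?R G" unfolding G_def \<phi>1_def \<phi>2_def \<phi>4_def by (intro continuous_intros cv c\<phi>)
  have contP: "continuous_on ?R P" unfolding P_def \<phi>1_def \<phi>2_def by (intro continuous_intros cv c2 c\<phi>)
  have contv: "continuous_on ?R (\<lambda>z. (v z)\<^sup>2)" by (intro continuous_intros cv)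
  have GP: "(v z)\<^sup>2 \<le> G z - P z" if z: "z \<in> ?R" for z
  proof -
    define p where "p = \<phi> (fst z)"
    have zt: "t0 \<le> fst z" "fst z \<le> t1" using z by (cases z; auto simp: cbox_Pair_eq)+
    have p: "s \<le> p" unfolding p_def s_def \<phi>_def using zt \<tau> by simp
    have "P z = (E z * (Ftt z + Fhh z))\<^sup>2"
      unfolding P_def vtt_def vhh_def vt_def v_def by (simp add: algebra_simps power2_eq_square)
    also have "\<dots> \<le> (E z * (C * F z))\<^sup>2"
    proof -
      have "\<bar>Ftt z + Fhh z\<bar> \<le> \<bar>C * F z\<bar>" 
      proof (rule order_trans[OF le[OF z]])
        show "C * \<bar>F z\<bar> \<le> \<bar>C * F z\<bar>" unfolding abs_mult by (intro mult_right_mono) auto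
      qed
      then have "\<bar>E z * (Ftt z + Fhh z)\<bar> \<le> \<bar>E z * (C * F z)\<bar>"
        by (simp add: abs_mult mult_left_mono)
      then show ?thesis by (simp add: abs_le_square_iff)
    qed
    also have "\<dots> = C\<^sup>2 * (v z)\<^sup>2" by (simp add: v_def power_mult_distrib)
    finally have P: "P z \<le> C\<^sup>2 * (v z)\<^sup>2" .
    have "(1 + C\<^sup>2) * (v z)\<^sup>2 \<le> (64 * p ^ 3 - 16 * p) * (v z)\<^sup>2"
    proof (rule mult_right_mono)
      have "1 * 1 \<le> p * p" using p s by (intro mult_mono) auto
      then have "p * 1 \<le> p * (p * p)" using p s by (intro mult_left_mono) auto
      then have "p \<le> p ^ 3" by (simp add: power3_eq_cube)
      then show "1 + C\<^sup>2 \<le> 64 * p ^ 3 - 16 * p" using p s by linarith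
    qed simp
    also have "\<dots> \<le> G z"
    proof -
      have "G z = 16 * p * (vt z)\<^sup>2 + (64 * p ^ 3 - 16 * p) * (v z)\<^sup>2"
        unfolding G_def \<phi>1_def \<phi>2_def \<phi>4_def p_def[symmetric] by (simp add: power2_eq_square power3_eq_cube)
      moreover have "0 \<le> 16 * p * (vt z)\<^sup>2" using p s by simp
      ultimately show ?thesis by linarith
    qed
    finally show ?thesis using P by (simp add: algebra_simps)
  qed
  have "integral ?R (\<lambda>z. (v z)\<^sup>2) \<le> integral ?R (\<lambda>z. G z - P z)"
    using GP by (intro integral_le integrable_continuous continuous_intros contG contP contv) auto
  also have "\<dots> = integral ?R G - integral ?R P"
    by (intro integral_diff integrable_continuous contG contP)
  also have "\<dots> \<le> - integral {0..2 * pi} Bd" using id by simp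
  also have "\<dots> = integral {0..2 * pi} (\<lambda>\<theta>. - Bd \<theta>)" by simp
  \<comment> \<open>Terms of the outer flux with a favourable sign are dropped. The remaining ones,
    in \<open>fh\<^sup>2\<close>, \<open>f * ft\<close> and \<open>f\<^sup>2\<close>, cost
    \<open>4 + 8 + 8\<close> times \<open>s * N\<^sup>2\<close>, up to the weight.\<close>
  also have "\<dots> \<le> integral {0..2 * pi} (\<lambda>\<theta>. 20 * s * N\<^sup>2 * exp (2 * s))"
  proof (rule integral_le)
    have in_R: "(t1, \<theta>) \<in> ?R" if "\<theta> \<in> {0..2 * pi}" for \<theta> using that t by (auto simp: cbox_Pair_eq)
    have row: "continuous_on {0..2 * pi} (\<lambda>\<theta>. k (t1, \<theta>))" if "continuous_on ?R k" for k :: "real \<times> real \<Rightarrow> real"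
      by (rule continuous_on_compose2[OF that]) (use t in \<open>auto intro!: continuous_intros in_R\<close>)
    note rows = row[OF cv(1)] row[OF cv(2)] row[OF cv(3)]
    show "(\<lambda>\<theta>. - Bd \<theta>) integrable_on {0..2 * pi}"
      unfolding Bd_def by (intro integrable_continuous_real continuous_intros rows)
    fix \<theta> assume \<theta>: "\<theta> \<in> {0..2 * pi}"
    define f ft fh where "f = F (t1, \<theta>)" and "ft = Ft (t1, \<theta>)" and "fh = Fh (t1, \<theta>)"
    have b: "\<bar>f\<bar> \<le> N" "\<bar>ft\<bar> \<le> N" "\<bar>fh\<bar> \<le> N" using N \<theta> by (auto simp: f_def ft_def fh_def)
    have N0: "0 \<le> N" using b by linarith
    have sq: "fh\<^sup>2 \<le> N\<^sup>2" "f\<^sup>2 \<le> N\<^sup>2" "f * ft \<le> N\<^sup>2"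
    proof -
      show "fh\<^sup>2 \<le> N\<^sup>2" "f\<^sup>2 \<le> N\<^sup>2" using b N0 by (auto simp: abs_le_square_iff[symmetric])
      have "f * ft \<le> \<bar>f\<bar> * \<bar>ft\<bar>" by (simp add: abs_mult[symmetric])
      also have "\<dots> \<le> N * N" using b by (intro mult_mono) auto
      finally show "f * ft \<le> N\<^sup>2" by (simp add: power2_eq_square)
    qed
    have "- Bd \<theta> = (exp s)\<^sup>2 * (- 4 * s * (ft - 2 * s * f)\<^sup>2 + 4 * s * fh\<^sup>2 - 16 * s ^ 3 * f\<^sup>2
        + 8 * s * (f * ft) - 16 * s\<^sup>2 * f\<^sup>2 + 8 * s * f\<^sup>2)"
      unfolding Bd_def v_def vt_def vh_def E_def \<phi>1_def \<phi>2_def \<phi>3_def fst_conv s_def[symmetric]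
        f_def[symmetric] ft_def[symmetric] fh_def[symmetric]
      by (simp add: algebra_simps power2_eq_square power3_eq_cube)
    also have "\<dots> \<le> (exp s)\<^sup>2 * (20 * s * N\<^sup>2)"
    proof (rule mult_left_mono)
      have "0 \<le> 4 * s * (ft - 2 * s * f)\<^sup>2" "0 \<le> 16 * s ^ 3 * f\<^sup>2" "0 \<le> 16 * s\<^sup>2 * f\<^sup>2" using s by auto
      moreover have "4 * s * fh\<^sup>2 \<le> 4 * s * N\<^sup>2" "8 * s * (f * ft) \<le> 8 * s * N\<^sup>2" "8 * s * f\<^sup>2 \<le> 8 * s * N\<^sup>2"
        using s sq by (auto intro!: mult_left_mono)
      ultimately show "- 4 * s * (ft - 2 * s * f)\<^sup>2 + 4 * s * fh\<^sup>2 - 16 * s ^ 3 * f\<^sup>2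
        + 8 * s * (f * ft) - 16 * s\<^sup>2 * f\<^sup>2 + 8 * s * f\<^sup>2 \<le> 20 * s * N\<^sup>2" by linarith
    qed simp
    also have "\<dots> = 20 * s * N\<^sup>2 * exp (2 * s)" by (simp add: exp_double)
    finally show "- Bd \<theta> \<le> 20 * s * N\<^sup>2 * exp (2 * s)" .
  qed auto
  also have "\<dots> = 2 * pi * (20 * s * N\<^sup>2 * exp (2 * s))" by simp
  finally have "integral ?R (\<lambda>z. (v z)\<^sup>2) \<le> 2 * pi * (20 * s * N\<^sup>2 * exp (2 * s))" .
  moreover have "(v z)\<^sup>2 = exp (2 * \<tau> * exp (- 2 * fst z)) * (F z)\<^sup>2" for z
    unfolding v_def E_def power_mult_distrib \<phi>_def by (simp add: exp_double[symmetric] mult.assoc)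
  ultimately show ?thesis by (simp add: s_def \<phi>_def)
qed

text \<open>Up to \<open>t2\<close> the weight is at least \<open>exp (2 * \<tau> * e2)\<close>,
  while the outer circle contributes only a multiple of
  \<open>\<tau> * exp (2 * \<tau> * e1)\<close>, and \<open>e1 < e2\<close>. Letting \<tau> grow
  forces the integral of \<open>F\<^sup>2\<close> up to \<open>t2\<close> to vanish.\<close>

lemma polar_unique_continuation:
  fixes F Ft Fh Ftt Fth Fhh :: "real \<times> real \<Rightarrow> real"
  assumes t: "t0 < t2" "t2 < t1"
    and F: "hess_on S F Ft Fh Ftt Fth Fhh" and R: "cbox (t0, 0) (t1, 2 * pi) \<subseteq> S"
    and cont: "continuous_on (cbox (t0, 0) (t1, 2 * pi)) Ftt" "continuous_on (cbox (t0, 0) (t1, 2 * pi)) Fth"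
      "continuous_on (cbox (t0, 0) (t1, 2 * pi)) Fhh"
    and per: "\<And>t. F (t, 2 * pi) = F (t, 0)" "\<And>t. Ft (t, 2 * pi) = Ft (t, 0)" "\<And>t. Fh (t, 2 * pi) = Fh (t, 0)"
    and zero: "\<And>\<theta>. F (t0, \<theta>) = 0" "\<And>\<theta>. Ft (t0, \<theta>) = 0" "\<And>\<theta>. Fh (t0, \<theta>) = 0"
    and le: "\<And>z. z \<in> cbox (t0, 0) (t1, 2 * pi) \<Longrightarrow> \<bar>Ftt z + Fhh z\<bar> \<le> C * \<bar>F z\<bar>"
    and \<theta>: "\<theta> \<in> {0..2 * pi}"
  shows "F (t2, \<theta>) = 0"
proof -
  let ?R = "cbox (t0, 0) (t1, 2 * pi)" and ?R2 = "cbox (t0, 0) (t2, 2 * pi)"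
  have R2: "?R2 \<subseteq> ?R" using t by (auto simp: cbox_Pair_eq)
  note cF = hess_on_continuous[OF hess_on_subset[OF F R]]
  have bound: "\<exists>N. \<forall>\<theta>\<in>{0..2*pi}. \<bar>k (t1, \<theta>)\<bar> \<le> N" if "continuous_on ?R k" for k :: "real \<times> real \<Rightarrow> real"
  proof -
    have "continuous_on {0..2*pi} (\<lambda>\<theta>. k (t1, \<theta>))"
      by (rule continuous_on_compose2[OF that]) (use t in \<open>auto intro!: continuous_intros simp: cbox_Pair_eq\<close>)
    then have "compact ((\<lambda>\<theta>. k (t1, \<theta>)) ` {0..2*pi})" by (intro compact_continuous_image) auto
    then have "bounded ((\<lambda>\<theta>. k (t1, \<theta>)) ` {0..2*pi})" by (rule compact_imp_bounded)
    then show ?thesis unfolding bounded_iff by auto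
  qed
  obtain N1 N2 N3 where N123: "\<forall>\<theta>\<in>{0..2*pi}. \<bar>F (t1, \<theta>)\<bar> \<le> N1" "\<forall>\<theta>\<in>{0..2*pi}. \<bar>Ft (t1, \<theta>)\<bar> \<le> N2"
    "\<forall>\<theta>\<in>{0..2*pi}. \<bar>Fh (t1, \<theta>)\<bar> \<le> N3"
    using bound[OF cF(1)] bound[OF cF(2)] bound[OF cF(3)] by blast
  define N where "N = max N1 (max N2 N3)"
  have N: "\<bar>F (t1, \<theta>)\<bar> \<le> N" "\<bar>Ft (t1, \<theta>)\<bar> \<le> N" "\<bar>Fh (t1, \<theta>)\<bar> \<le> N" if "\<theta> \<in> {0..2*pi}" for \<theta>
    using N123 that unfolding N_def by (auto simp: le_max_iff_disj)
  define e1 e2 where "e1 = exp (- 2 * t1)" and "e2 = exp (- 2 * t2)"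
  have e: "0 < e1" "e1 < e2" using t by (auto simp: e1_def e2_def)
  define I where "I = integral ?R2 (\<lambda>z. (F z)\<^sup>2)"
  have cF2: "continuous_on ?R2 (\<lambda>z. (F z)\<^sup>2)" using continuous_on_subset[OF cF(1) R2] by (intro continuous_intros)
  have I0: "0 \<le> I" unfolding I_def using cF2 by (intro integral_nonneg integrable_continuous) auto
  define Q where "Q = 2 * pi * (20 * e1 * N\<^sup>2)"
  have main: "I \<le> Q * (\<tau> * exp (- (2 * (e2 - e1) * \<tau>)))" if \<tau>: "1 \<le> \<tau> * e1" "1 + C\<^sup>2 \<le> \<tau> * e1" for \<tau>
  proof -
    have "0 < \<tau> * e1" using \<tau>(1) by linarith
    then have \<tau>0: "0 < \<tau>" using e by (simp add: zero_less_mult_iff)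
    define W where "W z = exp (2 * \<tau> * exp (- 2 * fst z)) * (F z)\<^sup>2" for z
    have cW: "continuous_on ?R W" unfolding W_def by (intro continuous_intros cF)
    have "exp (2 * \<tau> * e2) * I = integral ?R2 (\<lambda>z. exp (2 * \<tau> * e2) * (F z)\<^sup>2)"
      unfolding I_def by simp
    also have "\<dots> \<le> integral ?R2 W"
    proof (rule integral_le)
      show "(\<lambda>z. exp (2 * \<tau> * e2) * (F z)\<^sup>2) integrable_on ?R2" by (intro integrable_continuous continuous_on_mult continuous_on_const cF2)
      show "W integrable_on ?R2" using continuous_on_subset[OF cW R2] by (rule integrable_continuous)
      fix z assume "z \<in> ?R2"
      then have "fst z \<le> t2" by (cases z) (auto simp: cbox_Pair_eq)
      then have "e2 \<le> exp (- 2 * fst z)" by (simp add: e2_def)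
      then have "exp (2 * \<tau> * e2) \<le> exp (2 * \<tau> * exp (- 2 * fst z))" using \<tau>0 by simp
      then show "exp (2 * \<tau> * e2) * (F z)\<^sup>2 \<le> W z" unfolding W_def by (intro mult_right_mono) auto
    qed
    also have "\<dots> \<le> integral ?R W"
      by (rule integral_subset_le[OF R2])
        (use continuous_on_subset[OF cW R2] cW in \<open>auto intro!: integrable_continuous simp: W_def\<close>)
    also have "\<dots> \<le> 2 * pi * (20 * (\<tau> * e1) * N\<^sup>2 * exp (2 * (\<tau> * e1)))"
      unfolding W_def e1_def
      by (rule carleman_estimate[OF _ _ _ F R cont per zero le N]) (use t \<tau> in \<open>auto simp: e1_def\<close>)
    finally have "exp (- (2 * \<tau> * e2)) * (exp (2 * \<tau> * e2) * I) \<le>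
        exp (- (2 * \<tau> * e2)) * (2 * pi * (20 * (\<tau> * e1) * N\<^sup>2 * exp (2 * (\<tau> * e1))))"
      by (intro mult_left_mono) auto
    moreover have "exp (- (2 * \<tau> * e2)) * (exp (2 * \<tau> * e2) * I) = I"
      by (simp add: mult.assoc[symmetric] exp_add[symmetric])
    moreover have "exp (- (2 * \<tau> * e2)) * (2 * pi * (20 * (\<tau> * e1) * N\<^sup>2 * exp (2 * (\<tau> * e1)))) =
       Q * (\<tau> * (exp (- (2 * \<tau> * e2)) * exp (2 * (\<tau> * e1))))" by (simp add: Q_def)
    moreover have "exp (- (2 * \<tau> * e2)) * exp (2 * (\<tau> * e1)) = exp (- (2 * (e2 - e1) * \<tau>))"
      by (simp add: exp_add[symmetric] algebra_simps)
    ultimately show ?thesis by (simp only:)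
  qed
  have lim: "((\<lambda>\<tau>. Q * (\<tau> * exp (- (2 * (e2 - e1) * \<tau>)))) \<longlongrightarrow> 0) at_top"
  proof -
    define k where "k = 2 * (e2 - e1)"
    have k: "k > 0" using e by (simp add: k_def)
    have "((\<lambda>x::real. x ^ 1 / exp x) \<longlongrightarrow> 0) at_top" by (rule tendsto_power_div_exp_0)
    moreover have "filterlim (\<lambda>\<tau>. k * \<tau>) at_top at_top"
      by (rule filterlim_tendsto_pos_mult_at_top[OF tendsto_const k filterlim_ident])
    ultimately have "((\<lambda>\<tau>. (k * \<tau>) ^ 1 / exp (k * \<tau>)) \<longlongrightarrow> 0) at_top" by (rule filterlim_compose)
    then have "((\<lambda>\<tau>. Q / k * ((k * \<tau>) ^ 1 / exp (k * \<tau>))) \<longlongrightarrow> Q / k * 0) at_top" by (intro tendsto_intros)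
    moreover have "Q / k * ((k * \<tau>) ^ 1 / exp (k * \<tau>)) = Q * (\<tau> * exp (- (k * \<tau>)))" for \<tau>
      using k by (simp add: exp_minus field_simps)
    ultimately show ?thesis by (simp add: k_def)
  qed
  have "\<forall>\<^sub>F \<tau> in at_top. I \<le> Q * (\<tau> * exp (- (2 * (e2 - e1) * \<tau>)))"
    using eventually_ge_at_top[of "(1 + C\<^sup>2) / e1"]
  proof eventually_elim
    case (elim \<tau>)
    then have "1 + C\<^sup>2 \<le> \<tau> * e1" using e by (simp add: pos_divide_le_eq)
    moreover have "0 \<le> C\<^sup>2" by simp
    ultimately have "1 \<le> \<tau> * e1" "1 + C\<^sup>2 \<le> \<tau> * e1" by linarith+
    then show ?case by (rule main)
  qed
  then have "I \<le> 0" by (rule tendsto_lowerbound[OF lim]) simp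
  then have "I = 0" using I0 by simp
  then have "((\<lambda>z. (F z)\<^sup>2) has_integral 0) ?R2"
    unfolding I_def using integrable_integral[OF integrable_continuous[OF cF2]] by simp
  then have "(F (t2, \<theta>))\<^sup>2 = 0"
    by (intro has_integral_0_cbox_imp_0[OF cF2]) (use t \<theta> in \<open>auto simp: cbox_Pair_eq box_ne_empty Basis_prod_def\<close>)
  then show ?thesis by simp
qed

text \<open>Vanishing on a whole small ball gives zero Cauchy data on an inner circle, so the
  annulus estimate applies without any cutoff near the centre, where the coordinates
  degenerate.\<close>

theorem unique_continuation_ball:
  fixes f :: "real \<times> real \<Rightarrow> real"
  assumes f: "hess_on (ball a r) f fx fy fxx fxy fyy"
    and cont: "continuous_on (ball a r) fxx" "continuous_on (ball a r) fxy" "continuous_on (ball a r) fyy"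
    and le: "\<And>z. z \<in> ball a r \<Longrightarrow> \<bar>fxx z + fyy z\<bar> \<le> C * \<bar>f z\<bar>"
    and \<epsilon>: "0 < \<epsilon>" "\<And>z. z \<in> ball a \<epsilon> \<Longrightarrow> f z = 0"
    and z: "z \<in> ball a r"
  shows "f z = 0"
proof (cases "z = a")
  case True
  then show ?thesis using \<epsilon> by simp
next
  case False
  define \<rho> where "\<rho> = dist a z"
  have \<rho>: "0 < \<rho>" "\<rho> < r" using False z by (auto simp: \<rho>_def)
  \<comment> \<open>The inner circle lies in the known zero ball and closer to \<open>a\<close> than
    \<open>z\<close>, the middle one passes through \<open>z\<close>, and the outer one runs between
    \<open>z\<close> and the boundary of the ball.\<close>
  define t0 t1 t2 where "t0 = ln (min \<epsilon> \<rho> / 2)" and "t1 = ln ((\<rho> + r) / 2)" and "t2 = ln \<rho>"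
  have et: "exp t0 = min \<epsilon> \<rho> / 2" "exp t1 = (\<rho> + r) / 2" "exp t2 = \<rho>"
    using \<epsilon>(1) \<rho> by (auto simp: t0_def t1_def t2_def)
  have t: "t0 < t2" "t2 < t1"
  proof -
    have "exp t0 < exp t2" "exp t2 < exp t1" unfolding et using \<epsilon>(1) \<rho> by auto
    then show "t0 < t2" "t2 < t1" by simp_all
  qed
  define c where "c z = exp (fst z) * cos (snd z)" for z :: "real \<times> real"
  define s where "s z = exp (fst z) * sin (snd z)" for z :: "real \<times> real"
  define \<Gamma> where "\<Gamma> z = (fst a + c z, snd a + s z)" for z
  have dist\<Gamma>: "dist a (\<Gamma> z) = exp (fst z)" for z
  proof -
    have "dist a (\<Gamma> z) = sqrt ((c z)\<^sup>2 + (s z)\<^sup>2)"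
      by (cases a) (simp add: \<Gamma>_def dist_Pair_Pair dist_real_def)
    also have "(c z)\<^sup>2 + (s z)\<^sup>2 = (exp (fst z))\<^sup>2 * ((cos (snd z))\<^sup>2 + (sin (snd z))\<^sup>2)"
      unfolding c_def s_def power_mult_distrib by (simp only: distrib_left)
    finally show ?thesis by simp
  qed
  define T where "T = {z. \<Gamma> z \<in> ball a r}"
  have R: "cbox (t0, 0) (t1, 2 * pi) \<subseteq> T"
  proof
    fix z assume "z \<in> cbox (t0, 0) (t1, 2 * pi)"
    then have "exp (fst z) \<le> exp t1" by (cases z) (auto simp: cbox_Pair_eq)
    then show "z \<in> T" unfolding T_def using \<rho> by (simp add: dist\<Gamma> et)
  qed
  note hp = hess_on_polar[OF f, of T a, folded c_def s_def, folded \<Gamma>_def]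
  have cont\<Gamma>: "continuous_on A \<Gamma>" and contc: "continuous_on A c" and conts: "continuous_on A s" for A
    unfolding \<Gamma>_def c_def s_def by (intro continuous_intros)+
  have comp: "continuous_on (cbox (t0, 0) (t1, 2 * pi)) (\<lambda>z. k (\<Gamma> z))" if "continuous_on (ball a r) k" for k :: "real \<times> real \<Rightarrow> real"
    using R by (intro continuous_on_compose2[OF that cont\<Gamma>]) (auto simp: T_def)
  note cf = hess_on_continuous[OF f]
  \<comment> \<open>The zero function touches \<open>f\<close> from below near the centre, so the
    gradient vanishes along with \<open>f\<close>.\<close>
  have grad0: "f y = 0 \<and> fx y = 0 \<and> fy y = 0" if y: "y \<in> ball a (min \<epsilon> r)" for y
  proof -
    have z0: "f x = 0" if "x \<in> ball a (min \<epsilon> r)" for x using \<epsilon>(2)[of x] that by simp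
    have h0: "hess_on (ball a (min \<epsilon> r)) (\<lambda>_. 0) (\<lambda>_. 0) (\<lambda>_. 0) (\<lambda>_. 0) (\<lambda>_. 0) (\<lambda>_. 0)"
      unfolding hess_on_def by simp
    have h1: "hess_on (ball a (min \<epsilon> r)) f fx fy fxx fxy fyy" by (rule hess_on_subset[OF f]) auto
    have le0: "\<forall>x\<in>ball a (min \<epsilon> r). 0 \<le> f x" using z0 by simp
    have eq0: "0 = f y" using z0[OF y] by simp
    show ?thesis using touching(1,2)[OF open_ball y h1 h0 le0 eq0] eq0 by simp
  qed
  have \<Gamma>0: "\<Gamma> (t0, \<theta>) \<in> ball a (min \<epsilon> r)" for \<theta>
    using \<epsilon>(1) \<rho> by (auto simp: dist\<Gamma> et min_def)
  have per: "c (t, 2 * pi) = c (t, 0)" "s (t, 2 * pi) = s (t, 0)" "\<Gamma> (t, 2 * pi) = \<Gamma> (t, 0)" for t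
    by (simp_all add: c_def s_def \<Gamma>_def)
  have zero: "f (\<Gamma> (t0, \<theta>)) = 0" "fx (\<Gamma> (t0, \<theta>)) = 0" "fy (\<Gamma> (t0, \<theta>)) = 0" for \<theta> using grad0[OF \<Gamma>0] by auto
  obtain \<theta> where \<theta>: "\<theta> \<in> {0..2 * pi}" "\<Gamma> (t2, \<theta>) = z"
  proof -
    define X Y where "X = (fst z - fst a) / \<rho>" and "Y = (snd z - snd a) / \<rho>"
    have r0: "\<rho>\<^sup>2 = (fst z - fst a)\<^sup>2 + (snd z - snd a)\<^sup>2"
      by (cases z; cases a) (simp add: \<rho>_def dist_Pair_Pair dist_real_def power2_commute)
    have r2: "((fst z - fst a)\<^sup>2 + (snd z - snd a)\<^sup>2) / \<rho>\<^sup>2 = 1" unfolding r0[symmetric] using \<rho> by simp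
    have "X\<^sup>2 + Y\<^sup>2 = ((fst z - fst a)\<^sup>2 + (snd z - snd a)\<^sup>2) / \<rho>\<^sup>2"
      by (simp only: X_def Y_def power_divide add_divide_distrib)
    then have "X\<^sup>2 + Y\<^sup>2 = 1" unfolding r2 .
    then obtain \<theta> where \<theta>: "0 \<le> \<theta>" "\<theta> < 2 * pi" "X = cos \<theta>" "Y = sin \<theta>" using sincos_total_2pi by metis
    have "\<Gamma> (t2, \<theta>) = z"
      using \<rho> unfolding \<Gamma>_def c_def s_def fst_conv snd_conv et \<theta>(3,4)[symmetric] X_def Y_def by simp
    with \<theta> show ?thesis using that[of \<theta>] by simp
  qed
  \<comment> \<open>The conformal factor is at most \<open>(exp t1)\<^sup>2\<close> on the annulus
    and enlarges the constant of the potential accordingly.\<close>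
  have "f (\<Gamma> (t2, \<theta>)) = 0"
  proof (rule polar_unique_continuation[OF t hp R, where C = "C * (exp t1)\<^sup>2"])
    fix y assume y: "y \<in> cbox (t0, 0) (t1, 2 * pi)"
    then have yT: "\<Gamma> y \<in> ball a r" using R by (auto simp: T_def)
    have yt: "fst y \<le> t1" using y by (cases y) (auto simp: cbox_Pair_eq)
    have cs: "c y * c y + s y * s y = (exp (fst y))\<^sup>2"
    proof -
      have "c y * c y + s y * s y = (exp (fst y))\<^sup>2 * ((cos (snd y))\<^sup>2 + (sin (snd y))\<^sup>2)"
        unfolding c_def s_def by (simp only: distrib_left power2_eq_square mult_ac)
      then show ?thesis by simp
    qed
    have "(fxx (\<Gamma> y) * c y + fxy (\<Gamma> y) * s y) * c y + fx (\<Gamma> y) * c y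
        + (fxy (\<Gamma> y) * c y + fyy (\<Gamma> y) * s y) * s y + fy (\<Gamma> y) * s y +
        ((fyy (\<Gamma> y) * c y - fxy (\<Gamma> y) * s y) * c y - fy (\<Gamma> y) * s y
        - (fxy (\<Gamma> y) * c y - fxx (\<Gamma> y) * s y) * s y - fx (\<Gamma> y) * c y) =
        (c y * c y + s y * s y) * (fxx (\<Gamma> y) + fyy (\<Gamma> y))"
      by (simp add: algebra_simps)
    also have "\<bar>\<dots>\<bar> = (exp (fst y))\<^sup>2 * \<bar>fxx (\<Gamma> y) + fyy (\<Gamma> y)\<bar>" unfolding cs by (simp add: abs_mult)
    also have "\<dots> \<le> (exp t1)\<^sup>2 * (C * \<bar>f (\<Gamma> y)\<bar>)"
      using le[OF yT] yt by (intro mult_mono power_mono) auto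
    finally show "\<bar>(fxx (\<Gamma> y) * c y + fxy (\<Gamma> y) * s y) * c y + fx (\<Gamma> y) * c y
        + (fxy (\<Gamma> y) * c y + fyy (\<Gamma> y) * s y) * s y + fy (\<Gamma> y) * s y +
        ((fyy (\<Gamma> y) * c y - fxy (\<Gamma> y) * s y) * c y - fy (\<Gamma> y) * s y
        - (fxy (\<Gamma> y) * c y - fxx (\<Gamma> y) * s y) * s y - fx (\<Gamma> y) * c y)\<bar> \<le> C * (exp t1)\<^sup>2 * \<bar>f (\<Gamma> y)\<bar>"
      by (simp add: mult_ac)
  qed (use \<theta>(1) in \<open>auto simp: per zero T_def intro!: continuous_intros comp cont cf contc conts\<close>)
  then show ?thesis by (simp add: \<theta>(2))
qed

section \<open>The hodograph transform\<close>

lemma has_derivative_partials: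
  assumes "f differentiable (at z)"
  shows "(f has_derivative (\<lambda>h. partial_x f z * fst h + partial_y f z * snd h)) (at z)"
proof -
  obtain f' where f': "(f has_derivative f') (at z)" using assms unfolding differentiable_def by blast
  then interpret bounded_linear f' by (rule has_derivative_bounded_linear)
  obtain x y where z: "z = (x, y)" by (cases z)
  have 1: "((\<lambda>s. (s, y)) has_derivative (\<lambda>h. (h, 0))) (at x)"
    and 2: "((\<lambda>s. (x, s)) has_derivative (\<lambda>h. (0, h))) (at y)"
    by (auto intro!: derivative_eq_intros)
  have lin: "f' (h, 0) = f' (1, 0) * h" "f' (0, h) = f' (0, 1) * h" for h
    using scaleR[of h "(1, 0)"] scaleR[of h "(0, 1)"] by (simp_all add: mult.commute)
  have "((\<lambda>s. f (s, y)) has_real_derivative f' (1, 0)) (at x)"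
    unfolding has_field_derivative_def
    by (rule has_derivative_eq_rhs[OF has_derivative_compose[OF 1 f'[unfolded z]]]) (rule ext, rule lin(1))
  then have px: "partial_x f z = f' (1, 0)" by (simp add: partial_x_def z DERIV_imp_deriv)
  have "((\<lambda>s. f (x, s)) has_real_derivative f' (0, 1)) (at y)"
    unfolding has_field_derivative_def
    by (rule has_derivative_eq_rhs[OF has_derivative_compose[OF 2 f'[unfolded z]]]) (rule ext, rule lin(2))
  then have py: "partial_y f z = f' (0, 1)" by (simp add: partial_y_def z DERIV_imp_deriv)
  have "f' h = partial_x f z * fst h + partial_y f z * snd h" for h
  proof -
    have "f' h = f' (fst h, 0) + f' (0, snd h)" using add[of "(fst h, 0)" "(0, snd h)"] by simp
    also have "\<dots> = f' (1, 0) * fst h + f' (0, 1) * snd h"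
      by (rule arg_cong2[where f = "(+)", OF lin(1) lin(2)])
    finally show ?thesis by (simp only: px py)
  qed
  then show ?thesis by (intro has_derivative_eq_rhs[OF f'] ext)
qed

text \<open>By the fundamental theorem \<open>f\<close> is an antiderivative of \<open>f'\<close> up
  to the endpoint. It supplies the normal derivative of the height on the top, where the interior
  formula is available only as a limit.\<close>

lemma one_sided_derivative_of_limit:
  fixes f f' :: "real \<Rightarrow> real"
  assumes "p0 < 0" "continuous_on {p0..0} f" "continuous_on {p0..0} f'"
    and "\<And>s. s \<in> {p0<..<0} \<Longrightarrow> (f has_real_derivative f' s) (at s)"
  shows "(f has_real_derivative f' 0) (at 0 within {p0..0})"
proof -
  have I: "f s = f p0 + integral {p0..s} f'" if "s \<in> {p0..0}" for s
  proof -
    have "(f' has_integral f s - f p0) {p0..s}"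
      using that assms by (intro fundamental_theorem_of_calculus_interior)
        (auto intro: continuous_on_subset simp: has_real_derivative_iff_has_vector_derivative[symmetric])
    then show ?thesis by (simp add: integral_unique)
  qed
  have "((\<lambda>s. integral {p0..s} f') has_real_derivative f' 0) (at 0 within {p0..0})"
    using assms by (intro integral_has_real_derivative) auto
  then have "((\<lambda>s. f p0 + integral {p0..s} f') has_real_derivative f' 0) (at 0 within {p0..0})"
    using DERIV_add[OF DERIV_const] by fastforce
  then show ?thesis
    by (rule has_field_derivative_transform_within[where d = 1]) (use assms(1) in \<open>simp_all add: I[symmetric]\<close>)
qed

section \<open>The fluid domain, the stream function and the streamline height\<close>

locale water_wave =
  fixes g c P0 d L p0 :: real
    and \<eta> \<gamma> :: "real \<Rightarrow> real"
    and u v P \<psi> :: "real \<times> real \<Rightarrow> real"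
  assumes g: "g > 0" and d: "d > 0"
    and wave: "steady_water_wave g c P0 d L \<eta> u v P"
    and stream: "is_stream_function c d L \<eta> u v \<psi>"
    and flux: "is_relative_mass_flux d \<psi> p0"
    and vort: "is_vorticity_function d \<eta> u v \<psi> p0 \<gamma>"
    and p0: "p0 < 0"
begin

definition \<Omega> :: "(real \<times> real) set" where "\<Omega> = fluid_domain d \<eta>"

definition \<Omega>c :: "(real \<times> real) set" where "\<Omega>c = {z. - d \<le> snd z \<and> snd z \<le> \<eta> (fst z)}"

lemmas wave_unfolded = wave[unfolded steady_water_wave_def Let_def, folded \<Omega>_def]

lemma wave_facts:
  "L > 0" "\<forall>x. \<eta> x > - d" "\<eta> C1_differentiable_on UNIV" "\<forall>x. \<eta> (x + L) = \<eta> x"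
  "C1_closure \<Omega> u" "C1_closure \<Omega> v" "C1_closure \<Omega> P"
  "periodic_x_on L (closure \<Omega>) u" "periodic_x_on L (closure \<Omega>) v"
  "\<forall>z\<in>\<Omega>. (u z - c) * partial_x u z + v z * partial_y u z = - partial_x P z"
  "\<forall>z\<in>\<Omega>. (u z - c) * partial_x v z + v z * partial_y v z = - partial_y P z - g"
  "\<forall>z\<in>\<Omega>. partial_x u z + partial_y v z = 0"
  "\<forall>x. P (x, \<eta> x) = P0" "\<forall>x. v (x, \<eta> x) = (u (x, \<eta> x) - c) * deriv \<eta> x"
  "\<forall>x. v (x, - d) = 0" "\<forall>z\<in>closure \<Omega>. u z < c"
  by (insert wave_unfolded, elim conjE, assumption)+

lemma L: "0 < L" and \<eta>_gt: "- d < \<eta> x" and \<eta>_per: "\<eta> (x + L) = \<eta> x"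
  using wave_facts(1,2,4) by auto

lemma \<eta>_deriv: "(\<eta> has_real_derivative deriv \<eta> x) (at x)"
proof -
  have "\<eta> differentiable (at x)" using wave_facts(3) by (simp add: C1_differentiable_on_eq)
  then show ?thesis by (simp add: DERIV_deriv_iff_real_differentiable)
qed

lemma \<eta>_cont: "continuous_on S \<eta>"
  by (auto intro!: continuous_at_imp_continuous_on DERIV_isCont[OF \<eta>_deriv])

lemma \<eta>_fst_cont: "continuous_on UNIV (\<lambda>z::real \<times> real. \<eta> (fst z))"
  by (rule continuous_on_compose2[OF \<eta>_cont[of UNIV]]) (auto intro!: continuous_intros)

lemma \<Omega>_iff: "z \<in> \<Omega> \<longleftrightarrow> - d < snd z \<and> snd z < \<eta> (fst z)"
  by (cases z) (simp add: \<Omega>_def fluid_domain_def)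

lemma open_\<Omega>: "open \<Omega>"
proof -
  have "\<Omega> = {z. - d < snd z} \<inter> {z. snd z < \<eta> (fst z)}" by (auto simp: \<Omega>_iff)
  also have "open \<dots>"
    by (intro open_Int open_Collect_less continuous_intros \<eta>_fst_cont)
  finally show ?thesis .
qed

lemma closed_\<Omega>c: "closed \<Omega>c"
  unfolding \<Omega>c_def
  by (intro closed_Collect_conj closed_Collect_le continuous_intros \<eta>_fst_cont)

lemma closure_\<Omega>: "closure \<Omega> = \<Omega>c"
proof
  have "\<Omega> \<subseteq> \<Omega>c" by (auto simp: \<Omega>_iff \<Omega>c_def)
  then show "closure \<Omega> \<subseteq> \<Omega>c" by (rule closure_minimal[OF _ closed_\<Omega>c])
  show "\<Omega>c \<subseteq> closure \<Omega>"
  proof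
    fix z assume "z \<in> \<Omega>c"
    then have "snd z \<in> closure {- d<..<\<eta> (fst z)}" using \<eta>_gt[of "fst z"] by (auto simp: \<Omega>c_def)
    then have "\<forall>e>0. \<exists>y\<in>{- d<..<\<eta> (fst z)}. dist y (snd z) < e" by (simp add: closure_approachable)
    then have "\<forall>e>0. \<exists>z'\<in>\<Omega>. dist z' z < e"
    proof (intro allI impI)
      fix e :: real assume *: "\<forall>e>0. \<exists>y\<in>{- d<..<\<eta> (fst z)}. dist y (snd z) < e" and "e > 0"
      then obtain y where "y \<in> {- d<..<\<eta> (fst z)}" "dist y (snd z) < e" by blast
      then show "\<exists>z'\<in>\<Omega>. dist z' z < e"
        by (intro bexI[of _ "(fst z, y)"]) (auto simp: \<Omega>_iff dist_prod_def)
    qed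
    then show "z \<in> closure \<Omega>" by (simp add: closure_approachable)
  qed
qed

lemma sub_\<Omega>c: "z \<in> \<Omega> \<Longrightarrow> z \<in> \<Omega>c" by (auto simp: \<Omega>_iff \<Omega>c_def)

lemmas C1_u = wave_facts(5) and C1_v = wave_facts(6) and C1_P = wave_facts(7)

lemma C1_closureD:
  assumes "C1_closure \<Omega> f"
  shows "continuous_on \<Omega>c f"
    and "z \<in> \<Omega> \<Longrightarrow> (f has_derivative (\<lambda>h. partial_x f z * fst h + partial_y f z * snd h)) (at z)"
proof -
  show "continuous_on \<Omega>c f" using assms unfolding C1_closure_def closure_\<Omega> by (elim conjE)
  have "\<forall>z\<in>\<Omega>. f differentiable (at z)" using assms unfolding C1_closure_def by (elim conjE)
  then show "(f has_derivative (\<lambda>h. partial_x f z * fst h + partial_y f z * snd h)) (at z)" if "z \<in> \<Omega>"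
    using that by (intro has_derivative_partials) blast
qed

lemma stream_unfolded:
  "C1_closure \<Omega> \<psi>" "\<And>z. z \<in> \<Omega>c \<Longrightarrow> \<psi> (fst z + L, snd z) = \<psi> z"
  "\<And>z. z \<in> \<Omega> \<Longrightarrow> partial_x \<psi> z = - v z \<and> partial_y \<psi> z = u z - c" "\<And>x. \<psi> (x, \<eta> x) = 0"
proof -
  note s = stream[unfolded is_stream_function_def Let_def, folded \<Omega>_def, unfolded closure_\<Omega>]
  show "C1_closure \<Omega> \<psi>" using s unfolding C2_closure_def by blast
  show "\<psi> (fst z + L, snd z) = \<psi> z" if "z \<in> \<Omega>c" for z
    using s that unfolding periodic_x_on_def by (cases z) auto
  show "partial_x \<psi> z = - v z \<and> partial_y \<psi> z = u z - c" if "z \<in> \<Omega>" for z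
  proof -
    have "boundary_ext \<Omega> (partial_x \<psi>) z = - v z \<and> boundary_ext \<Omega> (partial_y \<psi>) z = u z - c"
      using s sub_\<Omega>c[OF that] by blast
    then show ?thesis using that by (simp add: boundary_ext_def)
  qed
  show "\<psi> (x, \<eta> x) = 0" for x using s by blast
qed

lemma \<psi>_deriv: "z \<in> \<Omega> \<Longrightarrow> (\<psi> has_derivative (\<lambda>h. - v z * fst h + (u z - c) * snd h)) (at z)"
  using C1_closureD(2)[OF stream_unfolded(1), of z] stream_unfolded(3)[of z] by simp

lemma \<psi>_bottom: "\<psi> (x, - d) = - p0" using flux unfolding is_relative_mass_flux_def by blast

lemma u_lt: "z \<in> \<Omega>c \<Longrightarrow> u z < c" using wave_facts(16) unfolding closure_\<Omega> by blast

lemma incompressible: "z \<in> \<Omega> \<Longrightarrow> partial_x u z + partial_y v z = 0" using wave_facts(12) by blast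

lemma vorticity_eq: "z \<in> \<Omega> \<Longrightarrow> partial_y u z - partial_x v z = \<gamma> (- \<psi> z)"
proof -
  assume z: "z \<in> \<Omega>"
  have "vorticity \<Omega> u v z = \<gamma> (- \<psi> z)"
    using vort sub_\<Omega>c[OF z] unfolding is_vorticity_function_def \<Omega>_def[symmetric] closure_\<Omega> by blast
  then show ?thesis using z by (simp add: vorticity_def boundary_ext_def)
qed

lemma u_per: "z \<in> \<Omega>c \<Longrightarrow> u (fst z + L, snd z) = u z" and v_per: "z \<in> \<Omega>c \<Longrightarrow> v (fst z + L, snd z) = v z"
proof -
  show "z \<in> \<Omega>c \<Longrightarrow> u (fst z + L, snd z) = u z" "z \<in> \<Omega>c \<Longrightarrow> v (fst z + L, snd z) = v z"
    using wave_facts(8,9) unfolding closure_\<Omega> periodic_x_on_def by (cases z; auto)+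
qed

lemma \<psi>_column_deriv: "(x, y) \<in> \<Omega> \<Longrightarrow> ((\<lambda>s. \<psi> (x, s)) has_real_derivative u (x, y) - c) (at y)"
  using has_derivative_rowcol(2)[OF \<psi>_deriv] .

lemma column_cont: "continuous_on \<Omega>c f \<Longrightarrow> continuous_on {- d..\<eta> x} (\<lambda>s. f (x, s))" for f :: "real \<times> real \<Rightarrow> real"
  by (erule continuous_on_compose2) (auto intro!: continuous_intros simp: \<Omega>c_def)

lemma \<psi>_cont: "continuous_on \<Omega>c \<psi>" using C1_closureD(1)[OF stream_unfolded(1)] .
lemma u_cont: "continuous_on \<Omega>c u" using C1_closureD(1)[OF C1_u] .
lemma v_cont: "continuous_on \<Omega>c v" using C1_closureD(1)[OF C1_v] .
lemma P_cont: "continuous_on \<Omega>c P" using C1_closureD(1)[OF C1_P] .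

lemma \<psi>_strict:
  assumes "- d \<le> s" "s < t" "t \<le> \<eta> x"
  shows "\<psi> (x, t) < \<psi> (x, s)"
proof (rule DERIV_neg_imp_decreasing_open[OF assms(2)])
  fix y assume "s < y" "y < t"
  then have "(x, y) \<in> \<Omega>" using assms by (auto simp: \<Omega>_iff)
  from \<psi>_column_deriv[OF this] u_lt[OF sub_\<Omega>c[OF this]]
  show "\<exists>l. ((\<lambda>s. \<psi> (x, s)) has_real_derivative l) (at y) \<and> l < 0" by (intro exI conjI) auto
qed (rule continuous_on_subset[OF column_cont[OF \<psi>_cont]], use assms in auto)

lemma \<psi>_range: "(x, y) \<in> \<Omega>c \<Longrightarrow> - \<psi> (x, y) \<in> {p0..0}"
  using \<psi>_strict[of "- d" y x] \<psi>_strict[of y "\<eta> x" x] \<psi>_bottom[of x] stream_unfolded(4)[of x]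
  by (cases "y = - d"; cases "y = \<eta> x") (auto simp: \<Omega>c_def)

lemma \<psi>_range_interior: "z \<in> \<Omega> \<longleftrightarrow> z \<in> \<Omega>c \<and> - \<psi> z \<in> {p0<..<0}"
proof (cases z)
  case (Pair x y)
  show ?thesis
    using \<psi>_strict[of "- d" y x] \<psi>_strict[of y "\<eta> x" x] \<psi>_bottom[of x] stream_unfolded(4)[of x] \<eta>_gt[of x]
    unfolding Pair by (cases "y = - d"; cases "y = \<eta> x") (auto simp: \<Omega>c_def \<Omega>_iff)
qed

text \<open>On a vertical line \<open>\<psi>\<close> decreases strictly, because
  \<open>u < c\<close>, from \<open>- p0\<close> on the bed to \<open>0\<close> on the
  surface.\<close>

lemma level_exists: "p \<in> {p0..0} \<Longrightarrow> \<exists>!y. (q, y) \<in> \<Omega>c \<and> - \<psi> (q, y) = p"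
proof -
  assume p: "p \<in> {p0..0}"
  have "\<exists>y\<ge>- d. y \<le> \<eta> q \<and> - \<psi> (q, y) = p"
    using p \<eta>_gt[of q] \<psi>_bottom[of q] stream_unfolded(4)[of q]
    by (intro IVT') (auto intro!: continuous_intros column_cont \<psi>_cont)
  then obtain y where y: "(q, y) \<in> \<Omega>c" "- \<psi> (q, y) = p" by (auto simp: \<Omega>c_def)
  show ?thesis
  proof (rule ex1I[of _ y])
    fix y' assume "(q, y') \<in> \<Omega>c \<and> - \<psi> (q, y') = p"
    then show "y' = y"
      using y \<psi>_strict[of y' y q] \<psi>_strict[of y y' q] by (cases y' y rule: linorder_cases) (auto simp: \<Omega>c_def)
  qed (use y in auto)
qed

text \<open>The streamline height \<open>h(q, p)\<close> of the Dubreil-Jacotin hodograph transform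
  \<open>q = x\<close>, \<open>p = - \<psi>\<close>, measured from \<open>y = 0\<close>.\<close>

definition Y :: "real \<times> real \<Rightarrow> real" where
  "Y z = (THE y. (fst z, y) \<in> \<Omega>c \<and> - \<psi> (fst z, y) = snd z)"

text \<open>Inverse of the hodograph map, leading from the strip back to the closed fluid
  domain.\<close>

definition \<Theta> :: "real \<times> real \<Rightarrow> real \<times> real" where "\<Theta> z = (fst z, Y z)"

lemma \<Theta>: "snd z \<in> {p0..0} \<Longrightarrow> \<Theta> z \<in> \<Omega>c \<and> - \<psi> (\<Theta> z) = snd z"
  using theI'[OF level_exists[of "snd z" "fst z"]] by (simp add: Y_def \<Theta>_def)

lemma Y_unique: "z \<in> \<Omega>c \<Longrightarrow> Y (fst z, - \<psi> z) = snd z"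
  unfolding Y_def using level_exists[of "- \<psi> z" "fst z"] \<psi>_range[of "fst z" "snd z"]
  by (intro the1_equality) auto

lemma \<Theta>_inverse: "z \<in> \<Omega>c \<Longrightarrow> \<Theta> (fst z, - \<psi> z) = z"
  by (simp add: \<Theta>_def Y_unique)

lemma \<Theta>_interior: "snd z \<in> {p0<..<0} \<Longrightarrow> \<Theta> z \<in> \<Omega>"
  using \<Theta>[of z] unfolding \<psi>_range_interior by auto

lemma Y_bottom: "Y (q, p0) = - d" using Y_unique[of "(q, - d)"] \<eta>_gt[of q] by (simp add: \<psi>_bottom \<Omega>c_def)

lemma Y_top: "Y (q, 0) = \<eta> q" using Y_unique[of "(q, \<eta> q)"] \<eta>_gt[of q] by (simp add: stream_unfolded(4) \<Omega>c_def)

lemma shift_\<Omega>c: "z \<in> \<Omega>c \<Longrightarrow> (fst z + L, snd z) \<in> \<Omega>c" by (simp add: \<Omega>c_def \<eta>_per)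

lemma Y_per: "p \<in> {p0..0} \<Longrightarrow> Y (q + L, p) = Y (q, p)"
proof -
  assume "p \<in> {p0..0}"
  then have t: "\<Theta> (q, p) \<in> \<Omega>c" "- \<psi> (\<Theta> (q, p)) = p" using \<Theta>[of "(q, p)"] by auto
  have "Y (q + L, - \<psi> (q + L, Y (q, p))) = Y (q, p)"
    using Y_unique[OF shift_\<Omega>c[OF t(1)]] by (simp add: \<Theta>_def)
  moreover have "- \<psi> (q + L, Y (q, p)) = p" using stream_unfolded(2)[OF t(1)] t(2) by (simp add: \<Theta>_def)
  ultimately show ?thesis by simp
qed

lemma \<eta>_bounded: "\<exists>B. \<forall>x. \<eta> x \<le> B"
proof -
  have "compact (\<eta> ` {0..L})" by (intro compact_continuous_image \<eta>_cont) auto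
  then have "bounded (\<eta> ` {0..L})" by (rule compact_imp_bounded)
  then obtain B where B: "\<forall>y\<in>\<eta> ` {0..L}. \<bar>y\<bar> \<le> B" unfolding bounded_iff by auto
  have "\<eta> x \<le> B" for x
  proof -
    obtain k where k: "x + of_int k * L \<in> {0..<0 + L}" using periodic_reduce[OF L] .
    have "\<eta> (x + of_int k * L) \<le> B" using B k by force
    then show ?thesis using periodic_shift[of \<eta> L x k] \<eta>_per by simp
  qed
  then show ?thesis by blast
qed

text \<open>The height is given only implicitly. Its graph is the closed set on which
  \<open>- \<psi>\<close> equals \<open>p\<close>, and its values stay in a compact interval, so the
  closed graph criterion yields continuity up to the boundary of the strip at once.\<close>

lemma Y_cont: "continuous_on (UNIV \<times> {p0..0}) Y"
proof -
  obtain B where B: "\<And>x. \<eta> x \<le> B" using \<eta>_bounded by blast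
  let ?S = "UNIV \<times> {p0..0} :: (real \<times> real) set"
  show ?thesis
  proof (rule continuous_from_closed_graph[of "{- d..B}"])
    show "Y \<in> ?S \<rightarrow> {- d..B}"
    proof
      fix z assume "z \<in> ?S"
      then have "\<Theta> z \<in> \<Omega>c" using \<Theta>[of z] by auto
      then show "Y z \<in> {- d..B}" using B[of "fst z"] by (auto simp: \<Theta>_def \<Omega>c_def)
    qed
    let ?D = "{x :: (real \<times> real) \<times> real. fst x \<in> ?S \<and> (fst (fst x), snd x) \<in> \<Omega>c}"
    have "(\<lambda>z. (z, Y z)) ` ?S = {x \<in> ?D. - \<psi> (fst (fst x), snd x) = snd (fst x)}" (is "?A = ?B")
    proof
      show "?A \<subseteq> ?B" using \<Theta> by (auto simp: \<Theta>_def)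
      show "?B \<subseteq> ?A"
      proof
        fix x assume x: "x \<in> ?B"
        then have "Y (fst x) = snd x" using Y_unique[of "(fst (fst x), snd x)"] by (cases "fst x") auto
        then show "x \<in> ?A" using x by (intro image_eqI[of _ _ "fst x"]) (cases x; auto)+
      qed
    qed
    moreover have "closed ?B"
    proof -
      have c: "continuous_on A (\<lambda>x::(real \<times> real) \<times> real. (fst (fst x), snd x))" for A by (intro continuous_intros)
      have "closed (fst -` ?S \<inter> (\<lambda>x::(real \<times> real) \<times> real. (fst (fst x), snd x)) -` \<Omega>c)"
        by (intro closed_Int continuous_closed_vimage closed_Times closed_\<Omega>c)
          (auto intro!: continuous_intros)
      moreover have "fst -` ?S \<inter> (\<lambda>x::(real \<times> real) \<times> real. (fst (fst x), snd x)) -` \<Omega>c = ?D" by auto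
      ultimately have D: "closed ?D" by simp
      have "continuous_on ?D (\<lambda>x. - \<psi> (fst (fst x), snd x) - snd (fst x))"
        by (intro continuous_intros continuous_on_compose2[OF \<psi>_cont c]) auto
      then have "closed {x \<in> ?D. - \<psi> (fst (fst x), snd x) - snd (fst x) = 0}"
        using D by (rule continuous_closed_preimage_constant)
      then show ?thesis by (simp add: algebra_simps)
    qed
    ultimately show "closed ((\<lambda>z. (z, Y z)) ` ?S)" by simp
  qed auto
qed

lemma \<Theta>_cont: "continuous_on (UNIV \<times> {p0..0}) \<Theta>"
  unfolding \<Theta>_def by (intro continuous_intros Y_cont)

lemma comp_\<Theta>_cont: "continuous_on \<Omega>c f \<Longrightarrow> continuous_on (UNIV \<times> {p0..0}) (\<lambda>z. f (\<Theta> z))" for f :: "real \<times> real \<Rightarrow> real"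
  using \<Theta> by (intro continuous_on_compose2[OF _ \<Theta>_cont]) auto

text \<open>Differentiating \<open>\<psi> (q, Y (q, p)) = - p\<close> gives the first derivatives:
  \<open>a\<close> is the slope of the streamline and \<open>b\<close> its vertical spacing. The
  formulas for the second derivatives are the chain rule applied to \<open>a\<close> and
  \<open>b\<close>.\<close>

definition a :: "real \<times> real \<Rightarrow> real" where "a z = v (\<Theta> z) / (u (\<Theta> z) - c)"
definition b :: "real \<times> real \<Rightarrow> real" where "b z = 1 / (c - u (\<Theta> z))"
definition hqq :: "real \<times> real \<Rightarrow> real" where
  "hqq z = - b z * (partial_x v (\<Theta> z) + a z * partial_y v (\<Theta> z))
     + a z * b z * (partial_x u (\<Theta> z) + a z * partial_y u (\<Theta> z))"
definition hqp :: "real \<times> real \<Rightarrow> real" where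
  "hqp z = (b z)\<^sup>2 * (partial_x u (\<Theta> z) + a z * partial_y u (\<Theta> z))"
definition hpp :: "real \<times> real \<Rightarrow> real" where "hpp z = b z ^ 3 * partial_y u (\<Theta> z)"

lemma Y_hess: "hess_on (UNIV \<times> {p0<..<0}) Y a b hqq hqp hpp"
  unfolding hess_on_def
proof
  fix z :: "real \<times> real" assume z: "z \<in> UNIV \<times> {p0<..<0}"
  let ?S = "UNIV \<times> {p0<..<0} :: (real \<times> real) set"
  have S: "open ?S" by (intro open_Times) auto
  define w where "w = \<Theta> z"
  have w: "w \<in> \<Omega>" using \<Theta>_interior[of z] z by (auto simp: w_def)
  define U where "U = c - u w"
  have U: "0 < U" using u_lt[OF sub_\<Omega>c[OF w]] by (simp add: U_def)
  have ab: "a z = - v w / U" "b z = 1 / U"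
    unfolding a_def b_def w_def[symmetric] U_def using U[unfolded U_def] by (simp_all add: field_simps)
  define F where "F y = (fst y, - \<psi> y)" for y
  have DF: "(F has_derivative (\<lambda>h. (fst h, v w * fst h + U * snd h))) (at w)"
    unfolding F_def U_def
    by (rule has_derivative_eq_rhs[OF has_derivative_Pair[OF has_derivative_fst[OF has_derivative_ident]
          has_derivative_minus[OF \<psi>_deriv[OF w]]]]) (simp add: fun_eq_iff algebra_simps)
  \<comment> \<open>The inverse is already known to be continuous, so its derivative follows from
    that of the hodograph map at this one point.\<close>
  have D\<Theta>: "(\<Theta> has_derivative (\<lambda>k. (fst k, a z * fst k + b z * snd k))) (at z)"
  proof (rule has_derivative_inverse_basic[where f = F and g = \<Theta> and T = ?S and y = z, OF DF[unfolded w_def] _ _ _ S z])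
    show "bounded_linear (\<lambda>k. (fst k, a z * fst k + b z * snd k))"
      by (intro bounded_linear_Pair bounded_linear_add bounded_linear_const_mult bounded_linear_fst bounded_linear_snd)
    show "(\<lambda>k. (fst k, a z * fst k + b z * snd k)) \<circ> (\<lambda>h. (fst h, v (\<Theta> z) * fst h + U * snd h)) = id"
      unfolding w_def[symmetric] using U by (auto simp: fun_eq_iff ab field_simps)
    have "continuous_on ?S \<Theta>" by (rule continuous_on_subset[OF \<Theta>_cont]) auto
    then show "continuous (at z) \<Theta>" using continuous_on_eq_continuous_at[OF S] z by blast
    show "F (\<Theta> y) = y" if "y \<in> ?S" for y using \<Theta>[of y] that by (cases y) (auto simp: F_def \<Theta>_def)
  qed
  have DY: "(Y has_derivative (\<lambda>k. a z * fst k + b z * snd k)) (at z)"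
    using has_derivative_snd[OF D\<Theta>] by (simp add: \<Theta>_def)
  have comp: "((\<lambda>z. k (\<Theta> z)) has_derivative (\<lambda>h. kx * fst h + ky * (a z * fst h + b z * snd h))) (at z)"
    if "(k has_derivative (\<lambda>h. kx * fst h + ky * snd h)) (at w)" for k :: "real \<times> real \<Rightarrow> real" and kx ky
    using has_derivative_compose[OF D\<Theta> that[unfolded w_def]] by simp
  define ux uy vx vy where "ux = partial_x u w" and "uy = partial_y u w" and "vx = partial_x v w" and "vy = partial_y v w"
  have Du: "((\<lambda>z. c - u (\<Theta> z)) has_derivative (\<lambda>h. 0 - (ux * fst h + uy * (a z * fst h + b z * snd h)))) (at z)"
    by (intro has_derivative_diff has_derivative_const comp[OF C1_closureD(2)[OF C1_u w, folded ux_def uy_def]])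
  note Dv = comp[OF C1_closureD(2)[OF C1_v w, folded vx_def vy_def]]
  \<comment> \<open>Incompressibility is what makes the p-derivative of \<open>a\<close> equal to
    the q-derivative of \<open>b\<close>, as a Hessian requires.\<close>
  have inc: "ux = - vy" using incompressible[OF w] by (simp add: ux_def vy_def)
  have U': "c - u (\<Theta> z) = U" "c - u (\<Theta> z) \<noteq> 0" using U by (auto simp: U_def w_def)
  have b_eq: "b = (\<lambda>z. inverse (c - u (\<Theta> z)))" by (simp add: b_def fun_eq_iff inverse_eq_divide)
  have be: "inverse (c - u (\<Theta> z)) = b z" by (simp add: b_def inverse_eq_divide)
  have Db: "(b has_derivative (\<lambda>h. (b z)\<^sup>2 * (ux * fst h + uy * (a z * fst h + b z * snd h)))) (at z)"
    unfolding b_eq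
    by (rule has_derivative_eq_rhs[OF Deriv.has_derivative_inverse[OF U'(2) Du]])
      (simp add: be fun_eq_iff power2_eq_square algebra_simps)
  have a_eq: "a = (\<lambda>z. - (v (\<Theta> z) * b z))"
  proof
    fix y show "a y = - (v (\<Theta> y) * b y)" unfolding a_def b_def using minus_diff_eq[of c "u (\<Theta> y)"]
      by (metis divide_minus_right mult.right_neutral times_divide_eq_right minus_divide_right)
  qed
  have vb: "v w = - a z * U" using U by (simp add: ab)
  have bU: "b z * U = 1" using U by (simp add: ab)
  have "(a has_derivative (\<lambda>h. - (v (\<Theta> z) * ((b z)\<^sup>2 * (ux * fst h + uy * (a z * fst h + b z * snd h)))
      + (vx * fst h + vy * (a z * fst h + b z * snd h)) * b z))) (at z)"
    unfolding a_eq using has_derivative_minus[OF has_derivative_mult[OF Dv Db]] by (simp add: a_eq)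
  then have Da: "(a has_derivative (\<lambda>h. hqq z * fst h + hqp z * snd h)) (at z)"
  proof (rule has_derivative_eq_rhs)
    have e: "v w * (b z)\<^sup>2 = - a z * b z"
    proof -
      have "v w * (b z)\<^sup>2 = - a z * b z * (b z * U)" unfolding vb by (simp add: power2_eq_square mult_ac)
      then show ?thesis unfolding bU by simp
    qed
    show "(\<lambda>h. - (v (\<Theta> z) * ((b z)\<^sup>2 * (ux * fst h + uy * (a z * fst h + b z * snd h)))
      + (vx * fst h + vy * (a z * fst h + b z * snd h)) * b z)) = (\<lambda>h. hqq z * fst h + hqp z * snd h)"
    proof
      fix h :: "real \<times> real"
      have "- (v (\<Theta> z) * ((b z)\<^sup>2 * (ux * fst h + uy * (a z * fst h + b z * snd h)))
        + (vx * fst h + vy * (a z * fst h + b z * snd h)) * b z) =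
        - ((v (\<Theta> z) * (b z)\<^sup>2) * (ux * fst h + uy * (a z * fst h + b z * snd h))
        + (vx * fst h + vy * (a z * fst h + b z * snd h)) * b z)" by (simp add: mult.assoc)
      also have "\<dots> = hqq z * fst h + hqp z * snd h"
        unfolding e hqq_def hqp_def w_def[symmetric] ux_def[symmetric] uy_def[symmetric] vx_def[symmetric] vy_def[symmetric] inc
        by (simp add: algebra_simps power2_eq_square)
      finally show "- (v (\<Theta> z) * ((b z)\<^sup>2 * (ux * fst h + uy * (a z * fst h + b z * snd h)))
        + (vx * fst h + vy * (a z * fst h + b z * snd h)) * b z) = hqq z * fst h + hqp z * snd h" .
    qed
  qed
  have Db': "(b has_derivative (\<lambda>h. hqp z * fst h + hpp z * snd h)) (at z)"
    by (rule has_derivative_eq_rhs[OF Db])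
      (simp add: fun_eq_iff hqp_def hpp_def w_def ux_def uy_def algebra_simps power2_eq_square power3_eq_cube)
  show "(Y has_derivative (\<lambda>h. a z * fst h + b z * snd h)) (at z) \<and>
       (a has_derivative (\<lambda>h. hqq z * fst h + hqp z * snd h)) (at z) \<and>
       (b has_derivative (\<lambda>h. hqp z * fst h + hpp z * snd h)) (at z)"
    using DY Da Db' by blast
qed

text \<open>Once incompressibility has eliminated one partial derivative, all terms containing
  \<open>a\<close> cancel. What is left is \<open>b ^ 3\<close> times the vorticity, a function of
  \<open>p\<close> alone.\<close>

lemma height_equation:
  assumes "z \<in> UNIV \<times> {p0<..<0}"
  shows "hpp z + ((b z)\<^sup>2 * hqq z - 2 * a z * b z * hqp z + (a z)\<^sup>2 * hpp z) = \<gamma> (snd z) * b z ^ 3"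
proof -
  define w where "w = \<Theta> z"
  have w: "w \<in> \<Omega>" and \<psi>: "- \<psi> w = snd z" using \<Theta>_interior[of z] \<Theta>[of z] assms by (auto simp: w_def)
  have inc: "partial_x u w = - partial_y v w" using incompressible[OF w] by simp
  have vo: "\<gamma> (snd z) = partial_y u w - partial_x v w" using vorticity_eq[OF w] \<psi> by simp
  show ?thesis
    unfolding hpp_def hqp_def hqq_def w_def[symmetric] inc vo by (simp add: algebra_simps power2_eq_square power3_eq_cube)
qed

end

text \<open>A nonconstant \<open>f\<close> takes some intermediate value other than
  \<open>k1\<close> and \<open>k2\<close>, and the set where it does so is both open and closed.
  This is meant for \<open>\<psi>\<close> along a particle path: the chain rule is available only
  inside the fluid, and the two exceptional values are those on the surface and on the bed.\<close>

lemma constant_of_zero_derivative_off_two_values: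
  fixes f :: "real \<Rightarrow> real"
  assumes cont: "continuous_on UNIV f"
    and D: "\<And>t. f t \<noteq> k1 \<Longrightarrow> f t \<noteq> k2 \<Longrightarrow> (f has_real_derivative 0) (at t)"
  shows "f s = f t"
proof (rule ccontr)
  assume ne: "f s \<noteq> f t"
  define lo hi where "lo = min (f s) (f t)" and "hi = max (f s) (f t)"
  have "lo < hi" using ne by (auto simp: lo_def hi_def min_def max_def)
  then have "infinite {lo<..<hi}" by simp
  then have "infinite ({lo<..<hi} - {k1, k2})" by simp
  then have "{lo<..<hi} - {k1, k2} \<noteq> {}" by (rule infinite_imp_nonempty)
  then obtain y where "y \<in> {lo<..<hi} - {k1, k2}" by blast
  then have y: "lo < y" "y < hi" "y \<noteq> k1" "y \<noteq> k2" by auto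
  have "connected (range f)" using cont by (intro connected_continuous_image) auto
  moreover have "lo \<in> range f" "hi \<in> range f" by (auto simp: lo_def hi_def min_def max_def)
  ultimately have "y \<in> range f" using y(1,2) unfolding connected_iff_interval by (meson less_imp_le)
  then obtain r where r: "f r = y" by blast
  let ?A = "f -` {y}"
  have "closed ?A" using cont by (intro continuous_closed_vimage) (auto simp: continuous_on_eq_continuous_at)
  moreover have "open ?A"
    unfolding open_contains_ball
  proof
    fix x assume "x \<in> ?A"
    then have fx: "f x = y" by simp
    have "open (f -` (- {k1, k2}))" using cont by (intro open_vimage) auto
    moreover have "x \<in> f -` (- {k1, k2})" using fx y by simp
    ultimately obtain e where e: "e > 0" "ball x e \<subseteq> f -` (- {k1, k2})" using openE by blast
    have "f z = f x" if "z \<in> ball x e" for z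
    proof (rule has_derivative_zero_unique[of "ball x e" f z x])
      fix w assume "w \<in> ball x e"
      then have "f w \<noteq> k1" "f w \<noteq> k2" using e(2) by auto
      then have "(f has_real_derivative 0) (at w)" by (rule D)
      then have "(f has_derivative (\<lambda>h. 0)) (at w)"
        unfolding has_field_derivative_def by (rule has_derivative_eq_rhs) (simp add: fun_eq_iff)
      then show "(f has_derivative (\<lambda>h. 0)) (at w within ball x e)" by (rule has_derivative_at_withinI)
    qed (use that e(1) in auto)
    then show "\<exists>e>0. ball x e \<subseteq> ?A" using e(1) fx by (intro exI[of _ e]) auto
  qed
  ultimately have "?A = {} \<or> ?A = UNIV" using clopen[of ?A] by blast
  then have "?A = UNIV" using r by auto
  then have "f s = y" "f t = y" by auto
  then show False using ne by simp
qed

section \<open>Uniform bounds and the Bernoulli law\<close>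

context water_wave
begin

lemma periodic_multiple:
  fixes f :: "real \<times> real \<Rightarrow> real"
  assumes S: "\<And>z. (fst z + L, snd z) \<in> S \<longleftrightarrow> z \<in> S"
    and f: "\<And>z. z \<in> S \<Longrightarrow> f (fst z + L, snd z) = f z" and z: "z \<in> S"
  shows "(fst z + of_int k * L, snd z) \<in> S \<and> f (fst z + of_int k * L, snd z) = f z"
proof -
  \<comment> \<open>Packs membership and value into one function on the line, so that a single shift
    by periods transports both.\<close>
  define h where "h q = (if (q, snd z) \<in> S then Some (f (q, snd z)) else None)" for q
  have "h (q + L) = h q" for q using S[of "(q, snd z)"] f[of "(q, snd z)"] by (auto simp: h_def)
  then have "h (fst z + of_int k * L) = h (fst z)" by (rule periodic_shift)
  then show ?thesis using z by (auto simp: h_def split: if_splits)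
qed

lemma \<Omega>c_shift_iff: "(fst z + L, snd z) \<in> \<Omega>c \<longleftrightarrow> z \<in> \<Omega>c"
  and \<Omega>_shift_iff: "(fst z + L, snd z) \<in> \<Omega> \<longleftrightarrow> z \<in> \<Omega>"
  by (simp_all add: \<Omega>c_def \<Omega>_iff \<eta>_per)

definition cell :: "(real \<times> real) set" where "cell = \<Omega>c \<inter> {0..L} \<times> UNIV"

lemma compact_cell: "compact cell"
proof -
  obtain B where B: "\<And>x. \<eta> x \<le> B" using \<eta>_bounded by blast
  have "cell = ({0..L} \<times> {- d..B}) \<inter> \<Omega>c"
    using order_trans[OF _ B] by (auto simp: cell_def \<Omega>c_def)
  then show ?thesis using closed_\<Omega>c by (auto intro!: compact_Int_closed compact_Times)
qed

text \<open>\<open>F\<close> is a continuous extension to the closed domain and is bounded on one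
  compact period cell. Periodicity is known for \<open>f\<close> on \<open>S\<close>, so a point is
  shifted into the cell before \<open>f\<close> and \<open>F\<close> are compared.\<close>

lemma periodic_bounded:
  fixes f F :: "real \<times> real \<Rightarrow> real"
  assumes S: "\<And>z. (fst z + L, snd z) \<in> S \<longleftrightarrow> z \<in> S" "S \<subseteq> \<Omega>c"
    and f: "\<And>z. z \<in> S \<Longrightarrow> f (fst z + L, snd z) = f z"
    and F: "continuous_on \<Omega>c F" "\<And>z. z \<in> S \<Longrightarrow> F z = f z"
  shows "\<exists>N. \<forall>z\<in>S. \<bar>f z\<bar> \<le> N"
proof -
  have "compact (F ` cell)"
    by (intro compact_continuous_image compact_cell continuous_on_subset[OF F(1)]) (auto simp: cell_def)
  then have "bounded (F ` cell)" by (rule compact_imp_bounded)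
  then obtain N where N: "\<forall>z\<in>cell. \<bar>F z\<bar> \<le> N" unfolding bounded_iff by auto
  have "\<bar>f z\<bar> \<le> N" if z: "z \<in> S" for z
  proof -
    obtain k where k: "fst z + of_int k * L \<in> {0..<0 + L}" using periodic_reduce[OF L] .
    have 1: "(fst z + of_int k * L, snd z) \<in> S" and 2: "f (fst z + of_int k * L, snd z) = f z"
      using periodic_multiple[where f = f and S = S, OF S(1) f z] by auto
    have "(fst z + of_int k * L, snd z) \<in> cell" using 1 S(2) k by (auto simp: cell_def)
    then have "\<bar>F (fst z + of_int k * L, snd z)\<bar> \<le> N" using N by blast
    then show ?thesis using F(2)[OF 1] 2 by simp
  qed
  then show ?thesis by blast
qed

lemma partial_periodic:
  assumes C: "C1_closure \<Omega> f" and per: "\<And>z. z \<in> \<Omega>c \<Longrightarrow> f (fst z + L, snd z) = f z" and z: "z \<in> \<Omega>"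
  shows "partial_x f (fst z + L, snd z) = partial_x f z \<and> partial_y f (fst z + L, snd z) = partial_y f z"
proof -
  define z' where "z' = (fst z + L, snd z)"
  have z': "z' \<in> \<Omega>" using z \<Omega>_shift_iff by (simp add: z'_def)
  define sh where "sh w = (fst w + L, snd w)" for w :: "real \<times> real"
  have Dsh: "(sh has_derivative (\<lambda>h. h)) (at z)"
    unfolding sh_def by (auto intro!: derivative_eq_intros)
  have "(f has_derivative (\<lambda>h. partial_x f z' * fst h + partial_y f z' * snd h)) (at (sh z))"
    using C1_closureD(2)[OF C z'] by (simp add: sh_def z'_def)
  from has_derivative_compose[OF Dsh this]
  have "((\<lambda>w. f (sh w)) has_derivative (\<lambda>h. partial_x f z' * fst h + partial_y f z' * snd h)) (at z)" .
  then have "(f has_derivative (\<lambda>h. partial_x f z' * fst h + partial_y f z' * snd h)) (at z)"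
    by (rule has_derivative_transform_within_open[OF _ open_\<Omega> z]) (simp add: sh_def per[OF sub_\<Omega>c])
  from has_derivative_unique[OF this C1_closureD(2)[OF C z]]
  have eq: "(\<lambda>h::real\<times>real. partial_x f z' * fst h + partial_y f z' * snd h) = (\<lambda>h. partial_x f z * fst h + partial_y f z * snd h)" .
  show ?thesis using fun_cong[OF eq, of "(1, 0)"] fun_cong[OF eq, of "(0, 1)"] by (simp add: z'_def)
qed

lemma partials_bounded:
  assumes C: "C1_closure \<Omega> f" and per: "\<And>z. z \<in> \<Omega>c \<Longrightarrow> f (fst z + L, snd z) = f z"
  shows "\<exists>N. \<forall>z\<in>\<Omega>. \<bar>partial_x f z\<bar> \<le> N" "\<exists>N. \<forall>z\<in>\<Omega>. \<bar>partial_y f z\<bar> \<le> N"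
proof -
  note ext = C[unfolded C1_closure_def closure_\<Omega>, THEN conjunct2, THEN conjunct2]
  from ext[THEN conjunct1] ext[THEN conjunct2] obtain Fx Fy where F: "continuous_on \<Omega>c Fx" "\<forall>z\<in>\<Omega>. Fx z = partial_x f z"
    "continuous_on \<Omega>c Fy" "\<forall>z\<in>\<Omega>. Fy z = partial_y f z" by (elim exE conjE)
  have sub: "\<Omega> \<subseteq> \<Omega>c" using sub_\<Omega>c by blast
  have pp: "partial_x f (fst z + L, snd z) = partial_x f z" "partial_y f (fst z + L, snd z) = partial_y f z"
    if "z \<in> \<Omega>" for z
    using partial_periodic[where f = f, OF C _ that] per by blast+
  show "\<exists>N. \<forall>z\<in>\<Omega>. \<bar>partial_x f z\<bar> \<le> N"
  proof (rule periodic_bounded[where f = "partial_x f" and S = \<Omega>, OF \<Omega>_shift_iff sub _ F(1)])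
    show "partial_x f (fst z + L, snd z) = partial_x f z" if "z \<in> \<Omega>" for z using pp(1)[OF that] .
    show "Fx z = partial_x f z" if "z \<in> \<Omega>" for z using bspec[OF F(2) that] .
  qed
  show "\<exists>N. \<forall>z\<in>\<Omega>. \<bar>partial_y f z\<bar> \<le> N"
  proof (rule periodic_bounded[where f = "partial_y f" and S = \<Omega>, OF \<Omega>_shift_iff sub _ F(3)])
    show "partial_y f (fst z + L, snd z) = partial_y f z" if "z \<in> \<Omega>" for z using pp(2)[OF that] .
    show "Fy z = partial_y f z" if "z \<in> \<Omega>" for z using bspec[OF F(4) that] .
  qed
qed

lemma bounds:
  obtains N where "1 \<le> N" "\<And>z. z \<in> \<Omega>c \<Longrightarrow> \<bar>v z\<bar> \<le> N" "\<And>z. z \<in> \<Omega>c \<Longrightarrow> 1 / N \<le> c - u z"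
    "\<And>z. z \<in> \<Omega>c \<Longrightarrow> c - u z \<le> N"
    "\<And>z. z \<in> \<Omega> \<Longrightarrow> \<bar>partial_x u z\<bar> \<le> N" "\<And>z. z \<in> \<Omega> \<Longrightarrow> \<bar>partial_y u z\<bar> \<le> N"
    "\<And>z. z \<in> \<Omega> \<Longrightarrow> \<bar>partial_x v z\<bar> \<le> N" "\<And>z. z \<in> \<Omega> \<Longrightarrow> \<bar>partial_y v z\<bar> \<le> N"
    "\<And>p. p \<in> {p0..0} \<Longrightarrow> \<bar>\<gamma> p\<bar> \<le> N"
proof -
  have "\<exists>N. \<forall>z\<in>\<Omega>c. \<bar>v z\<bar> \<le> N"
    by (rule periodic_bounded[OF \<Omega>c_shift_iff subset_refl _ v_cont refl]) (rule v_per)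
  then obtain N1 where N1: "\<forall>z\<in>\<Omega>c. \<bar>v z\<bar> \<le> N1" ..
  have ne: "c - u z \<noteq> 0" if "z \<in> \<Omega>c" for z using u_lt[OF that] by simp
  have uc: "continuous_on \<Omega>c (\<lambda>z. 1 / (c - u z))" "continuous_on \<Omega>c (\<lambda>z. c - u z)"
    by (intro continuous_intros u_cont ballI ne, assumption) (intro continuous_intros u_cont)
  have "\<exists>N. \<forall>z\<in>\<Omega>c. \<bar>1 / (c - u z)\<bar> \<le> N"
    by (rule periodic_bounded[OF \<Omega>c_shift_iff subset_refl _ uc(1) refl]) (simp add: u_per)
  then obtain N2 where N2: "\<forall>z\<in>\<Omega>c. \<bar>1 / (c - u z)\<bar> \<le> N2" ..
  have "\<exists>N. \<forall>z\<in>\<Omega>c. \<bar>c - u z\<bar> \<le> N"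
    by (rule periodic_bounded[OF \<Omega>c_shift_iff subset_refl _ uc(2) refl]) (simp add: u_per)
  then obtain N3 where N3: "\<forall>z\<in>\<Omega>c. \<bar>c - u z\<bar> \<le> N3" ..
  have "\<exists>N. \<forall>z\<in>\<Omega>. \<bar>partial_x u z\<bar> \<le> N" by (rule partials_bounded(1)[OF C1_u]) (rule u_per)
  then obtain N4 where N4: "\<forall>z\<in>\<Omega>. \<bar>partial_x u z\<bar> \<le> N4" ..
  have "\<exists>N. \<forall>z\<in>\<Omega>. \<bar>partial_y u z\<bar> \<le> N" by (rule partials_bounded(2)[OF C1_u]) (rule u_per)
  then obtain N5 where N5: "\<forall>z\<in>\<Omega>. \<bar>partial_y u z\<bar> \<le> N5" ..
  have "\<exists>N. \<forall>z\<in>\<Omega>. \<bar>partial_x v z\<bar> \<le> N" by (rule partials_bounded(1)[OF C1_v]) (rule v_per)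
  then obtain N6 where N6: "\<forall>z\<in>\<Omega>. \<bar>partial_x v z\<bar> \<le> N6" ..
  have "\<exists>N. \<forall>z\<in>\<Omega>. \<bar>partial_y v z\<bar> \<le> N" by (rule partials_bounded(2)[OF C1_v]) (rule v_per)
  then obtain N7 where N7: "\<forall>z\<in>\<Omega>. \<bar>partial_y v z\<bar> \<le> N7" ..
  have "continuous_on {p0..0} \<gamma>" using vort[unfolded is_vorticity_function_def, THEN conjunct1] .
  then have "bounded (\<gamma> ` {p0..0})" by (intro compact_imp_bounded compact_continuous_image) auto
  then obtain N8 where N8: "\<forall>p\<in>{p0..0}. \<bar>\<gamma> p\<bar> \<le> N8" unfolding bounded_iff by auto
  define N where "N = Max {1, N1, N2, N3, N4, N5, N6, N7, N8}"
  have N: "1 \<le> N" "N1 \<le> N" "N2 \<le> N" "N3 \<le> N" "N4 \<le> N" "N5 \<le> N" "N6 \<le> N" "N7 \<le> N" "N8 \<le> N"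
    unfolding N_def by (intro Max_ge; simp)+
  show ?thesis
  proof (rule that[of N])
    show "1 / N \<le> c - u z" if "z \<in> \<Omega>c" for z
    proof -
      have U: "0 < c - u z" using u_lt[OF that] by simp
      have "\<bar>1 / (c - u z)\<bar> \<le> N" using N2 that N by fastforce
      then have "1 / (c - u z) \<le> N" using U by simp
      then show ?thesis using U N(1) by (simp add: field_simps)
    qed
    show "\<bar>v z\<bar> \<le> N" if "z \<in> \<Omega>c" for z using bspec[OF N1 that] N by simp
    show "c - u z \<le> N" if "z \<in> \<Omega>c" for z using bspec[OF N3 that] N by simp
    show "\<bar>partial_x u z\<bar> \<le> N" if "z \<in> \<Omega>" for z using bspec[OF N4 that] N by simp
    show "\<bar>partial_y u z\<bar> \<le> N" if "z \<in> \<Omega>" for z using bspec[OF N5 that] N by simp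
    show "\<bar>partial_x v z\<bar> \<le> N" if "z \<in> \<Omega>" for z using bspec[OF N6 that] N by simp
    show "\<bar>partial_y v z\<bar> \<le> N" if "z \<in> \<Omega>" for z using bspec[OF N7 that] N by simp
    show "\<bar>\<gamma> p\<bar> \<le> N" if "p \<in> {p0..0}" for p using bspec[OF N8 that] N by simp
  qed (rule N)
qed

text \<open>The Euler equations make \<open>E\<close>, twice the total head, constant along each
  interior streamline. They hold in the open domain, so the surface is reached as a limit of
  interior streamlines; there the pressure is \<open>P0\<close> and drops into the constant.\<close>

lemma bernoulli: "\<exists>Q. \<forall>q. (1 + (a (q, 0))\<^sup>2) / (b (q, 0))\<^sup>2 + 2 * g * Y (q, 0) = Q"
proof -
  define E where "E z = (u (\<Theta> z) - c)\<^sup>2 + (v (\<Theta> z))\<^sup>2 + 2 * g * Y z + 2 * P (\<Theta> z)" for z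
  have contE: "continuous_on (UNIV \<times> {p0..0}) E"
    unfolding E_def by (intro continuous_intros comp_\<Theta>_cont u_cont v_cont P_cont Y_cont)
  have E_int: "E (q, p) = E (0, p)" if p: "p \<in> {p0<..<0}" for q p
  proof -
    have "((\<lambda>q. E (q, p)) has_real_derivative 0) (at q)" for q
    proof -
      define w where "w = \<Theta> (q, p)"
      have w: "w \<in> \<Omega>" using \<Theta>_interior[of "(q, p)"] p by (simp add: w_def)
      have DY: "((\<lambda>q. Y (q, p)) has_real_derivative a (q, p)) (at q)"
        using hess_on_partials(1)[OF Y_hess] p by auto
      have D\<Theta>: "((\<lambda>q. (q, Y (q, p))) has_derivative (\<lambda>h. (h, a (q, p) * h))) (at q)"
        using DY unfolding has_field_derivative_def by (intro has_derivative_Pair has_derivative_ident)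
      have comp: "((\<lambda>q. k (\<Theta> (q, p))) has_real_derivative partial_x k w + partial_y k w * a (q, p)) (at q)"
        if "C1_closure \<Omega> k" for k
      proof -
        have "(k has_derivative (\<lambda>h. partial_x k w * fst h + partial_y k w * snd h)) (at (q, Y (q, p)))"
          using C1_closureD(2)[OF that w] by (simp add: w_def \<Theta>_def)
        from has_derivative_compose[OF D\<Theta> this] show ?thesis
          unfolding has_field_derivative_def \<Theta>_def fst_conv
          by (rule has_derivative_eq_rhs) (simp add: fun_eq_iff algebra_simps)
      qed
      note Du = comp[OF C1_u] and Dv = comp[OF C1_v] and DP = comp[OF C1_P]
      define U V where "U = u w - c" and "V = v w"
      have U: "U \<noteq> 0" using u_lt[OF sub_\<Omega>c[OF w]] by (simp add: U_def)
      have aU: "a (q, p) * U = V" using U by (simp add: a_def U_def V_def w_def)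
      have Px: "partial_x P w = - (U * partial_x u w + V * partial_y u w)"
        and Py: "partial_y P w = - (U * partial_x v w + V * partial_y v w) - g"
        using wave_facts(10,11) w unfolding U_def V_def by (force simp: algebra_simps)+
      have "((\<lambda>q. E (q, p)) has_real_derivative
        2 * U * (partial_x u w + partial_y u w * a (q, p)) + 2 * V * (partial_x v w + partial_y v w * a (q, p))
         + 2 * g * a (q, p) + 2 * (partial_x P w + partial_y P w * a (q, p))) (at q)"
        unfolding E_def
        by (rule DERIV_cong[OF DERIV_add[OF DERIV_add[OF DERIV_add[OF
              DERIV_power[where n = 2, OF DERIV_diff[OF Du DERIV_const]] DERIV_power[where n = 2, OF Dv]]
              DERIV_cmult[OF DY]] DERIV_cmult[OF DP]]])
          (simp add: U_def V_def w_def)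
      moreover have "2 * U * (partial_x u w + partial_y u w * a (q, p)) + 2 * V * (partial_x v w + partial_y v w * a (q, p))
         + 2 * g * a (q, p) + 2 * (partial_x P w + partial_y P w * a (q, p)) = 0"
        unfolding Px Py aU[symmetric] by (simp add: algebra_simps)
      ultimately show ?thesis by simp
    qed
    then show ?thesis by (rule DERIV_isconst_all[rule_format])
  qed
  have E_top: "E (q, 0) = E (0, 0)" for q
  proof -
    have lim: "((\<lambda>p. E (q, p)) \<longlongrightarrow> E (q, 0)) (at 0 within {p0..0})" for q
    proof -
      have "continuous_on {p0..0} (\<lambda>p. E (q, p))"
        by (rule continuous_on_compose2[OF contE]) (auto intro!: continuous_intros)
      then show ?thesis using p0 by (simp add: continuous_on_def)
    qed
    have "\<forall>\<^sub>F p in at 0 within {p0..0}. E (q, p) = E (0, p)"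
      unfolding eventually_at
    proof (intro exI[of _ "- p0"] conjI ballI impI E_int)
      fix p assume "p \<in> {p0..0}" "p \<noteq> 0 \<and> dist p 0 < - p0"
      then show "p \<in> {p0<..<0}" by (auto simp: dist_real_def)
    qed (use p0 in simp)
    then have "((\<lambda>p. E (0, p)) \<longlongrightarrow> E (q, 0)) (at 0 within {p0..0})"
      by (rule Lim_transform_eventually[OF lim])
    moreover have "at 0 within {p0..0} \<noteq> bot" using p0 by (simp add: trivial_limit_within islimpt_Icc)
    ultimately show ?thesis using lim tendsto_unique by blast
  qed
  have "(1 + (a (q, 0))\<^sup>2) / (b (q, 0))\<^sup>2 + 2 * g * Y (q, 0) = E (0, 0) - 2 * P0" for q
  proof -
    define w where "w = \<Theta> (q, 0)"
    have w: "w \<in> \<Omega>c" "w = (q, \<eta> q)" using \<Theta>[of "(q, 0)"] p0 by (auto simp: w_def \<Theta>_def Y_top)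
    define U V where "U = u w - c" and "V = v w"
    have U: "U \<noteq> 0" using u_lt[OF w(1)] by (simp add: U_def)
    have ab: "a (q, 0) = V / U" "b (q, 0) = - 1 / U"
      unfolding a_def b_def w_def[symmetric] U_def V_def by (simp_all add: minus_divide_right)
    have "(1 + (a (q, 0))\<^sup>2) / (b (q, 0))\<^sup>2 = U\<^sup>2 + V\<^sup>2"
      unfolding ab using U by (simp add: field_simps power2_eq_square)
    moreover have "P w = P0" using wave_facts(13) w(2) by simp
    then have "E (q, 0) = U\<^sup>2 + V\<^sup>2 + 2 * g * Y (q, 0) + 2 * P0"
      unfolding E_def w_def[symmetric] U_def V_def by simp
    ultimately show ?thesis using E_top[of q] by simp
  qed
  then show ?thesis by blast
qed

lemma Y_height_sol:
  obtains m M Q where "strip_problem p0 m M g" "strip_problem.height_sol p0 m M g Q \<gamma> Y a b hqq hqp hpp"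
proof -
  obtain N where N: "1 \<le> N" and bv: "\<And>z. z \<in> \<Omega>c \<Longrightarrow> \<bar>v z\<bar> \<le> N" and bu: "\<And>z. z \<in> \<Omega>c \<Longrightarrow> 1 / N \<le> c - u z"
    "\<And>z. z \<in> \<Omega>c \<Longrightarrow> c - u z \<le> N"
    and bp: "\<And>z. z \<in> \<Omega> \<Longrightarrow> \<bar>partial_x u z\<bar> \<le> N" "\<And>z. z \<in> \<Omega> \<Longrightarrow> \<bar>partial_y u z\<bar> \<le> N"
    "\<And>z. z \<in> \<Omega> \<Longrightarrow> \<bar>partial_x v z\<bar> \<le> N" "\<And>z. z \<in> \<Omega> \<Longrightarrow> \<bar>partial_y v z\<bar> \<le> N"
    and b\<gamma>: "\<And>p. p \<in> {p0..0} \<Longrightarrow> \<bar>\<gamma> p\<bar> \<le> N"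
    by (rule bounds, rule that)
  obtain Q where Q: "\<forall>q. (1 + (a (q, 0))\<^sup>2) / (b (q, 0))\<^sup>2 + 2 * g * Y (q, 0) = Q" using bernoulli by blast
  \<comment> \<open>The worst bound is that of \<open>hqq\<close>, namely
    \<open>2 * N ^ 4 + 2 * N ^ 6\<close>.\<close>
  define M where "M = 4 * N ^ 6"
  have Npow: "N ^ i \<le> N ^ 6" if "i \<le> 6" for i using N that by (intro power_increasing) auto
  have N6: "1 \<le> N ^ 6" using N by (simp add: one_le_power)
  have NM: "N \<le> M" "N ^ 2 \<le> M" using Npow[of 1] Npow[of 2] N6 by (auto simp: M_def)
  interpret S: strip_problem p0 "1 / N" M g Q \<gamma>
  proof
    have "1 / N \<le> 1" using N by simp
    then show "1 / N \<le> M" using N NM by linarith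
  qed (use p0 N g in auto)
  have prod2: "\<bar>x * y\<bar> \<le> e * f" if "\<bar>x\<bar> \<le> e" "\<bar>y\<bar> \<le> f" for x y e f :: real
    unfolding abs_mult using that by (intro mult_mono) auto
  have ab: "\<bar>a z\<bar> \<le> N ^ 2 \<and> 1 / N \<le> b z \<and> b z \<le> N" if "snd z \<in> {p0..0}" for z
  proof -
    define w where "w = \<Theta> z"
    have w: "w \<in> \<Omega>c" using \<Theta>[OF that] by (simp add: w_def)
    note U = bu[OF w]
    have U0: "0 < c - u w" using u_lt[OF w] by simp
    have b: "b z = 1 / (c - u w)" by (simp add: b_def w_def)
    have b1: "b z \<le> N" "1 / N \<le> b z" unfolding b using U U0 N by (auto simp: field_simps)
    have "a z = - v w * b z" unfolding a_def b w_def[symmetric] using U0 by (simp add: field_simps)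
    then have "\<bar>a z\<bar> \<le> N * N" using prod2[of "- v w" N "b z" N] bv[OF w] b1 U0 b by simp
    then show ?thesis using b1 by (simp add: power2_eq_square)
  qed
  have second: "\<bar>hqq z\<bar> \<le> M \<and> \<bar>hqp z\<bar> \<le> M \<and> \<bar>hpp z\<bar> \<le> M" if z: "snd z \<in> {p0<..<0}" for z
  proof -
    have w: "\<Theta> z \<in> \<Omega>" using \<Theta>_interior[OF z] .
    have ab': "\<bar>a z\<bar> \<le> N ^ 2" "\<bar>b z\<bar> \<le> N"
    proof -
      have "0 < 1 / N" using N by simp
      moreover have "\<bar>a z\<bar> \<le> N ^ 2 \<and> 1 / N \<le> b z \<and> b z \<le> N" using z by (intro ab) auto
      ultimately show "\<bar>a z\<bar> \<le> N ^ 2" "\<bar>b z\<bar> \<le> N" by linarith+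
    qed
    define X1 X2 where "X1 = partial_x u (\<Theta> z) + a z * partial_y u (\<Theta> z)"
      and "X2 = partial_x v (\<Theta> z) + a z * partial_y v (\<Theta> z)"
    have X: "\<bar>X1\<bar> \<le> 2 * N ^ 3" "\<bar>X2\<bar> \<le> 2 * N ^ 3"
    proof -
      have "N \<le> N ^ 3" using power_increasing[of 1 3 N] N by simp
      moreover have "N\<^sup>2 * N = N ^ 3" by (simp add: power2_eq_square power3_eq_cube)
      ultimately show "\<bar>X1\<bar> \<le> 2 * N ^ 3" "\<bar>X2\<bar> \<le> 2 * N ^ 3"
        unfolding X1_def X2_def
        using bp(1,3)[OF w] prod2[OF ab'(1) bp(2)[OF w]] prod2[OF ab'(1) bp(4)[OF w]] by linarith+
    qed
    have "\<bar>b z ^ 3 * partial_y u (\<Theta> z)\<bar> \<le> N ^ 3 * N"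
      using prod2[OF _ bp(2)[OF w], of "b z ^ 3" "N ^ 3"] power_mono[OF ab'(2), of 3] by (simp add: power_abs)
    moreover have "N ^ 3 * N = N ^ 4" by (simp add: power_Suc2[symmetric])
    ultimately have 1: "\<bar>hpp z\<bar> \<le> M" using Npow[of 4] N6 unfolding hpp_def M_def by linarith
    have "\<bar>(b z)\<^sup>2 * X1\<bar> \<le> N\<^sup>2 * (2 * N ^ 3)"
      using prod2[OF _ X(1), of "(b z)\<^sup>2" "N\<^sup>2"] power_mono[OF ab'(2), of 2] by simp
    moreover have "N\<^sup>2 * (2 * N ^ 3) = 2 * N ^ 5" by (simp add: power_add[symmetric])
    ultimately have 2: "\<bar>hqp z\<bar> \<le> M" using Npow[of 5] N6 unfolding hqp_def X1_def[symmetric] M_def by linarith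
    have "\<bar>b z * X2\<bar> \<le> N * (2 * N ^ 3)" using prod2[OF ab'(2) X(2)] .
    moreover have "\<bar>a z * b z * X1\<bar> \<le> N ^ 2 * N * (2 * N ^ 3)" using prod2[OF prod2[OF ab'] X(1)] .
    moreover have "N * (2 * N ^ 3) = 2 * N ^ 4" "N ^ 2 * N * (2 * N ^ 3) = 2 * N ^ 6"
      by (simp_all add: power2_eq_square power3_eq_cube power4_eq_xxxx eval_nat_numeral)
    moreover have "hqq z = - (b z * X2) + a z * b z * X1" by (simp add: hqq_def X1_def X2_def)
    ultimately have 3: "\<bar>hqq z\<bar> \<le> M" using Npow[of 4] unfolding M_def by linarith
    show ?thesis using 1 2 3 by blast
  qed
  \<comment> \<open>The kinematic condition identifies the streamline slope on the top with the
    slope of the surface.\<close>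
  have abtop: "a (q, 0) = deriv \<eta> q" for q
  proof -
    have "\<Theta> (q, 0) = (q, \<eta> q)" by (simp add: \<Theta>_def Y_top)
    moreover have "(q, \<eta> q) \<in> \<Omega>c" using \<eta>_gt[of q] by (simp add: \<Omega>c_def)
    ultimately show ?thesis using wave_facts(14) u_lt[of "(q, \<eta> q)"] unfolding a_def by simp
  qed
  have top1: "((\<lambda>s. Y (s, 0)) has_real_derivative a (q, 0)) (at q)" for q
    using \<eta>_deriv[of q] by (simp add: Y_top abtop)
  have top2: "((\<lambda>s. Y (q, s)) has_real_derivative b (q, 0)) (at 0 within {p0..0})" for q
  proof (rule one_sided_derivative_of_limit[OF p0])
    show "continuous_on {p0..0} (\<lambda>s. Y (q, s))"
      by (rule continuous_on_compose2[OF Y_cont]) (auto intro!: continuous_intros)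
    have "continuous_on (UNIV \<times> {p0..0}) b"
      unfolding b_def using u_lt \<Theta> by (intro continuous_intros comp_\<Theta>_cont u_cont) fastforce
    then show "continuous_on {p0..0} (\<lambda>s. b (q, s))"
      by (rule continuous_on_compose2) (auto intro!: continuous_intros)
    show "((\<lambda>s. Y (q, s)) has_real_derivative b (q, s)) (at s)" if "s \<in> {p0<..<0}" for s
      using hess_on_partials(4)[OF Y_hess] that by auto
  qed
  show ?thesis
  proof (rule that[OF S.strip_problem_axioms])
    show "S.height_sol Y a b hqq hqp hpp"
      unfolding S.height_sol_def
    proof (intro conjI allI ballI)
      fix z :: "real \<times> real" assume z: "z \<in> UNIV \<times> {p0<..<0}"
      then have "snd z \<in> {p0<..<0}" by auto
      from second[OF this] b\<gamma>[of "snd z"] this NM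
      show "\<bar>hqq z\<bar> \<le> M" "\<bar>hqp z\<bar> \<le> M" "\<bar>hpp z\<bar> \<le> M" "\<bar>\<gamma> (snd z)\<bar> \<le> M" by auto
      show "hpp z + ((b z)\<^sup>2 * hqq z - 2 * a z * b z * hqp z + (a z)\<^sup>2 * hpp z) = \<gamma> (snd z) * b z ^ 3"
        by (rule height_equation[OF z])
    next
      fix q p assume "p \<in> {p0<..0}"
      then show "\<bar>a (q, p)\<bar> \<le> M" "1 / N \<le> b (q, p)" "b (q, p) \<le> M" using ab[of "(q, p)"] NM by auto
    qed (use Y_hess Y_cont top1 top2 Q in auto)
  qed
qed

section \<open>Particle paths and streamlines\<close>

lemma \<psi>_constant_on_path:
  assumes "particle_path c d \<eta> u v X Z"
  shows "\<psi> (X s, Z s) = \<psi> (X t, Z t)"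
proof (rule constant_of_zero_derivative_off_two_values[of "\<lambda>t. \<psi> (X t, Z t)" 0 "- p0"])
  note pp = assms[unfolded particle_path_def, folded \<Omega>_def, unfolded closure_\<Omega>, rule_format]
  have DX: "(X has_real_derivative u (X t, Z t) - c) (at t)" and DZ: "(Z has_real_derivative v (X t, Z t)) (at t)"
    and mem: "(X t, Z t) \<in> \<Omega>c" for t
    using pp[of t] by auto
  have "continuous_on UNIV X" "continuous_on UNIV Z"
    using DX DZ by (auto intro!: continuous_at_imp_continuous_on DERIV_isCont)
  then show "continuous_on UNIV (\<lambda>t. \<psi> (X t, Z t))"
    by (intro continuous_on_compose2[OF \<psi>_cont] continuous_intros) (use mem in auto)
  fix t assume "\<psi> (X t, Z t) \<noteq> 0" "\<psi> (X t, Z t) \<noteq> - p0"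
  then have w: "(X t, Z t) \<in> \<Omega>"
    using mem[of t] \<psi>_range[OF mem[of t]] unfolding \<psi>_range_interior by auto
  have "((\<lambda>t. (X t, Z t)) has_derivative (\<lambda>h. ((u (X t, Z t) - c) * h, v (X t, Z t) * h))) (at t)"
    using DX[of t] DZ[of t] unfolding has_field_derivative_def by (intro has_derivative_Pair)
  from has_derivative_compose[OF this \<psi>_deriv[OF w]]
  show "((\<lambda>t. \<psi> (X t, Z t)) has_real_derivative 0) (at t)"
    unfolding has_field_derivative_def by (rule has_derivative_eq_rhs) (simp add: fun_eq_iff algebra_simps)
qed

text \<open>On the level \<open>p\<close> the horizontal position solves a scalar equation with a
  continuous negative right-hand side \<open>G\<close>. Time is an antiderivative \<tau> of
  \<open>1 / G\<close>, and the path is its inverse. The lower bound \<open>- N\<close> for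
  \<open>G\<close> makes \<tau> surjective, so the path exists for all times; as \<tau> is defined
  on the whole line, it sweeps the entire streamline.\<close>

lemma path_exists:
  assumes p: "p \<in> {p0<..<0}"
  obtains X where "particle_path c d \<eta> u v X (\<lambda>t. Y (X t, p))" "X 0 = x0" "\<And>q. \<exists>t. X t = q"
proof -
  obtain N where N: "1 \<le> N" and bu: "\<And>z. z \<in> \<Omega>c \<Longrightarrow> c - u z \<le> N"
    by (rule bounds, rule that)
  define G where "G x = u (\<Theta> (x, p)) - c" for x
  have mem: "\<Theta> (x, p) \<in> \<Omega>" for x using \<Theta>_interior[of "(x, p)"] p by simp
  have G: "G x < 0" "- N \<le> G x" for x
    using u_lt[OF sub_\<Omega>c[OF mem]] bu[OF sub_\<Omega>c[OF mem]] by (auto simp: G_def algebra_simps)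
  have "continuous_on UNIV G"
    unfolding G_def
    by (intro continuous_intros continuous_on_compose2[OF comp_\<Theta>_cont[OF u_cont]]) (use p in auto)
  then have contG: "isCont (\<lambda>x. 1 / G x) x" for x
    using G(1)[of x] by (intro continuous_intros) (auto simp: continuous_on_eq_continuous_at)
  obtain F where F: "\<And>x. (F has_vector_derivative 1 / G x) (at x)"
    using einterval_antiderivative[of "- \<infinity>" "\<infinity>" "\<lambda>x. 1 / G x"] contG by auto
  define \<tau> where "\<tau> x = F x - F x0" for x
  have D\<tau>: "(\<tau> has_real_derivative 1 / G x) (at x)" for x
    unfolding \<tau>_def using F[of x]
    by (auto intro!: derivative_eq_intros simp: has_real_derivative_iff_has_vector_derivative)
  have le: "1 / G x \<le> - (1 / N)" for x using G[of x] N by (simp add: field_simps)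
  have slope: "\<tau> y \<le> \<tau> x - (y - x) / N" if "x \<le> y" for x y
  proof (cases "x = y")
    case False
    then have "x < y" using that by simp
    then obtain z where "\<tau> y - \<tau> x = (y - x) * (1 / G z)"
      using MVT2[of x y \<tau> "\<lambda>x. 1 / G x"] D\<tau> by blast
    moreover have "(y - x) * (1 / G z) \<le> (y - x) * (- (1 / N))" using le that by (intro mult_left_mono) auto
    ultimately show ?thesis by simp
  qed simp
  have cont\<tau>: "continuous_on S \<tau>" for S using D\<tau> by (auto intro!: continuous_at_imp_continuous_on DERIV_isCont)
  have surj: "\<exists>x. \<tau> x = t" for t
  proof -
    define R where "R = N * \<bar>t\<bar>"
    have R: "0 \<le> R" "R / N = \<bar>t\<bar>" using N by (auto simp: R_def)
    have "\<tau> x0 = 0" by (simp add: \<tau>_def)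
    then have "\<tau> (x0 + R) \<le> - \<bar>t\<bar>" "\<bar>t\<bar> \<le> \<tau> (x0 - R)"
      using slope[of x0 "x0 + R"] slope[of "x0 - R" x0] R by auto
    then have "\<exists>x\<ge>x0 - R. x \<le> x0 + R \<and> \<tau> x = t"
      using R by (intro IVT2') (auto intro!: cont\<tau>)
    then show ?thesis by blast
  qed
  have inj: "x = y" if "\<tau> x = \<tau> y" for x y
    using slope[of x y] slope[of y x] that N by (cases x y rule: linorder_cases) (auto simp: divide_le_0_iff)
  define X where "X t = (THE x. \<tau> x = t)" for t
  have \<tau>X: "\<tau> (X t) = t" for t
    unfolding X_def using surj[of t] inj by (auto intro: theI2)
  have X\<tau>: "X (\<tau> x) = x" for x using inj \<tau>X by blast
  have lip: "\<bar>X s - X t\<bar> \<le> N * \<bar>s - t\<bar>" for s t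
  proof -
    have *: "y - x \<le> N * (\<tau> x - \<tau> y)" if "x \<le> y" for x y
      using slope[OF that] N by (simp add: field_simps)
    have "N * (s - t) \<le> N * \<bar>s - t\<bar>" "N * (t - s) \<le> N * \<bar>s - t\<bar>" using N by (auto intro!: mult_left_mono)
    then show ?thesis using *[of "X s" "X t"] *[of "X t" "X s"] unfolding \<tau>X by linarith
  qed
  have contX: "isCont X t" for t
    unfolding continuous_at_eps_delta
  proof (intro allI impI)
    fix e :: real assume e: "e > 0"
    show "\<exists>d>0. \<forall>x'. dist x' t < d \<longrightarrow> dist (X x') (X t) < e"
    proof (intro exI[of _ "e / N"] conjI allI impI)
      show "0 < e / N" using e N by simp
      fix s assume "dist s t < e / N"
      then have "N * \<bar>s - t\<bar> < e" using N by (simp add: dist_real_def field_simps)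
      then show "dist (X s) (X t) < e" using lip[of s t] by (simp add: dist_real_def)
    qed
  qed
  have DX: "(X has_real_derivative G (X t)) (at t)" for t
  proof -
    have "(X has_real_derivative inverse (1 / G (X t))) (at t)"
      by (rule DERIV_inverse_function[OF D\<tau>, where a = "t - 1" and b = "t + 1"])
        (use G(1)[of "X t"] \<tau>X contX in auto)
    then show ?thesis by simp
  qed
  have DZ: "((\<lambda>t. Y (X t, p)) has_real_derivative v (\<Theta> (X t, p))) (at t)" for t
  proof -
    have "((\<lambda>q. Y (q, p)) has_real_derivative a (X t, p)) (at (X t))"
      using hess_on_partials(1)[OF Y_hess] p by auto
    from DERIV_chain2[OF this DX] show ?thesis
      using G(1)[of "X t"] unfolding a_def G_def[symmetric] by simp
  qed
  show ?thesis
  proof (rule that[of X])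
    show "particle_path c d \<eta> u v X (\<lambda>t. Y (X t, p))"
      unfolding particle_path_def \<Omega>_def[symmetric] closure_\<Omega>
      using DX DZ sub_\<Omega>c[OF mem] unfolding G_def \<Theta>_def by auto
    show "X 0 = x0" using X\<tau>[of x0] by (simp add: \<tau>_def)
    show "\<exists>t. X t = q" for q using X\<tau> by blast
  qed
qed

lemma column_limit:
  assumes "\<And>p. p \<in> {p1<..<0} \<Longrightarrow> Y (q, p) \<le> Y (q', p)" "p1 < 0" "p0 \<le> p1"
  shows "Y (q, 0) \<le> Y (q', 0)"
proof -
  have lim: "((\<lambda>p. Y (q, p)) \<longlongrightarrow> Y (q, 0)) (at 0 within {p1..0})" for q
  proof -
    have "continuous_on {p1..0} (\<lambda>p. Y (q, p))"
      by (rule continuous_on_compose2[OF Y_cont]) (use assms in \<open>auto intro!: continuous_intros\<close>)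
    then show ?thesis using assms by (simp add: continuous_on_def)
  qed
  have "\<forall>\<^sub>F p in at 0 within {p1..0}. Y (q, p) \<le> Y (q', p)"
    unfolding eventually_at
  proof (intro exI[of _ "- p1"] conjI ballI impI assms(1))
    fix p assume "p \<in> {p1..0}" "p \<noteq> 0 \<and> dist p 0 < - p1"
    then show "p \<in> {p1<..<0}" by (auto simp: dist_real_def)
  qed (use assms in simp)
  moreover have "at 0 within {p1..0} \<noteq> bot" using assms by (simp add: trivial_limit_within islimpt_Icc)
  ultimately show ?thesis using lim by (intro tendsto_le)
qed

text \<open>In one direction a complete path is available on each interior streamline; the surface
  is a limit of these and the bed is flat. In the other direction every path, on the boundary as
  well, stays on its level of \<open>\<psi>\<close> and hence on the graph of
  \<open>Y\<close>.\<close>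

lemma lowest_on_line_iff:
  "particles_lowest_on_line c d \<eta> u v x0 \<longleftrightarrow> (\<forall>q. \<forall>p\<in>{p0..0}. Y (x0, p) \<le> Y (q, p))"
proof
  assume lowest: "particles_lowest_on_line c d \<eta> u v x0"
  have interior: "Y (x0, p) \<le> Y (q, p)" if p: "p \<in> {p0<..<0}" for q p
  proof -
    obtain X where X: "particle_path c d \<eta> u v X (\<lambda>t. Y (X t, p))" "X 0 = x0" "\<And>q. \<exists>t. X t = q"
      using path_exists[OF p] by blast
    obtain t where t: "X t = q" using X(3) by blast
    have "Y (x0, p) \<in> {- d..\<eta> x0}" using \<Theta>[of "(x0, p)"] p by (auto simp: \<Theta>_def \<Omega>c_def)
    then have "Y (x0, p) \<le> Y (X t, p)"
      using lowest X unfolding particles_lowest_on_line_def by blast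
    then show ?thesis using t by simp
  qed
  show "\<forall>q. \<forall>p\<in>{p0..0}. Y (x0, p) \<le> Y (q, p)"
  proof (intro allI ballI)
    fix q p assume "p \<in> {p0..0}"
    then consider "p = p0" | "p = 0" | "p \<in> {p0<..<0}" by fastforce
    then show "Y (x0, p) \<le> Y (q, p)"
    proof cases
      case 2
      then show ?thesis using column_limit[OF interior p0] by simp
    qed (use interior Y_bottom in auto)
  qed
next
  assume low: "\<forall>q. \<forall>p\<in>{p0..0}. Y (x0, p) \<le> Y (q, p)"
  show "particles_lowest_on_line c d \<eta> u v x0"
    unfolding particles_lowest_on_line_def
  proof (intro ballI allI impI, elim conjE)
    fix y0 X Z t
    assume path: "particle_path c d \<eta> u v X Z" and init: "X 0 = x0" "Z 0 = y0"
    have mem: "(X t, Z t) \<in> \<Omega>c" for t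
      using path unfolding particle_path_def \<Omega>_def[symmetric] closure_\<Omega> by blast
    define p where "p = - \<psi> (X 0, Z 0)"
    have p: "- \<psi> (X t, Z t) = p" for t using \<psi>_constant_on_path[OF path] by (simp add: p_def)
    have Z: "Z t = Y (X t, p)" for t using Y_unique[OF mem[of t]] p[of t] by simp
    have "p \<in> {p0..0}" using \<psi>_range[OF mem[of 0]] by (simp add: p_def)
    then have "Y (x0, p) \<le> Y (X t, p)" using low by blast
    then show "y0 \<le> Z t" using Z[of 0] Z[of t] init by simp
  qed
qed

end

section \<open>Reflection of the surface in a critical line\<close>

text \<open>Meant for a function cut off to zero on one side of a line: where \<open>f\<close>
  vanishes to first order, so does everything dominated by it.\<close>

lemma dominated_has_derivative_zero:
  fixes f k :: "real \<times> real \<Rightarrow> real"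
  assumes f: "(f has_derivative (\<lambda>h. 0)) (at z)" "f z = 0" and le: "\<And>y. \<bar>k y\<bar> \<le> \<bar>f y\<bar>"
  shows "(k has_derivative (\<lambda>h. 0)) (at z)"
proof -
  have k0: "k z = 0" using le[of z] f(2) by simp
  have "((\<lambda>h. norm (f (z + h) - f z - 0) / norm h) \<longlongrightarrow> 0) (at 0)"
    using f(1) unfolding has_derivative_at by blast
  then have lim: "((\<lambda>h. \<bar>f (z + h)\<bar> / norm h) \<longlongrightarrow> 0) (at 0)" using f(2) by simp
  have "((\<lambda>h. \<bar>k (z + h)\<bar> / norm h) \<longlongrightarrow> 0) (at 0)"
    by (rule tendsto_sandwich[OF _ _ tendsto_const lim])
      (auto intro!: always_eventually divide_right_mono le)
  then show ?thesis unfolding has_derivative_at using k0 by simp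
qed

lemma glue_has_derivative:
  fixes f :: "real \<times> real \<Rightarrow> real"
  assumes D: "(f has_derivative (\<lambda>h. A * fst h + B * snd h)) (at z)"
    and zero: "fst z = \<mu> \<Longrightarrow> f z = 0 \<and> A = 0 \<and> B = 0"
  shows "((\<lambda>z. if fst z \<le> \<mu> then 0 else f z) has_derivative
     (\<lambda>h. (if fst z \<le> \<mu> then 0 else A) * fst h + (if fst z \<le> \<mu> then 0 else B) * snd h)) (at z)"
proof -
  have half: "open {w :: real \<times> real. fst w < \<mu>}" "open {w :: real \<times> real. \<mu> < fst w}"
    by (intro open_Collect_less continuous_intros)+
  show ?thesis
  proof (cases "fst z" \<mu> rule: linorder_cases)
    case less
    have "((\<lambda>z. 0 :: real) has_derivative (\<lambda>h. 0)) (at z)" by simp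
    then have "((\<lambda>z. if fst z \<le> \<mu> then 0 else f z) has_derivative (\<lambda>h. 0)) (at z)"
      by (rule has_derivative_transform_within_open[OF _ half(1)]) (use less in auto)
    then show ?thesis using less by simp
  next
    case equal
    have "(f has_derivative (\<lambda>h. 0)) (at z)" using D zero[OF equal] by simp
    then have "((\<lambda>z. if fst z \<le> \<mu> then 0 else f z) has_derivative (\<lambda>h. 0)) (at z)"
      by (rule dominated_has_derivative_zero) (use zero[OF equal] in auto)
    then show ?thesis using equal by simp
  next
    case greater
    from D have "((\<lambda>z. if fst z \<le> \<mu> then 0 else f z) has_derivative (\<lambda>h. A * fst h + B * snd h)) (at z)"
      by (rule has_derivative_transform_within_open[OF _ half(2)]) (use greater in auto)
    then show ?thesis using greater by simp
  qed
qed

lemma glue_continuous_on: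
  fixes k :: "real \<times> real \<Rightarrow> real"
  assumes "continuous_on S k" "\<And>z. z \<in> S \<Longrightarrow> fst z = \<mu> \<Longrightarrow> k z = 0"
  shows "continuous_on S (\<lambda>z. if fst z \<le> \<mu> then 0 else k z)"
  by (rule continuous_on_cases_le[where h = fst])
    (use assms in \<open>auto intro!: continuous_intros intro: continuous_on_subset\<close>)

lemma hess_on_glue:
  fixes f :: "real \<times> real \<Rightarrow> real"
  assumes "hess_on S f fx fy fxx fxy fyy"
    and "\<And>z. z \<in> S \<Longrightarrow> fst z = \<mu> \<Longrightarrow> f z = 0 \<and> fx z = 0 \<and> fy z = 0 \<and> fxx z = 0 \<and> fxy z = 0 \<and> fyy z = 0"
  shows "hess_on S (\<lambda>z. if fst z \<le> \<mu> then 0 else f z)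
     (\<lambda>z. if fst z \<le> \<mu> then 0 else fx z) (\<lambda>z. if fst z \<le> \<mu> then 0 else fy z)
     (\<lambda>z. if fst z \<le> \<mu> then 0 else fxx z) (\<lambda>z. if fst z \<le> \<mu> then 0 else fxy z) (\<lambda>z. if fst z \<le> \<mu> then 0 else fyy z)"
  unfolding hess_on_def
proof (intro ballI conjI glue_has_derivative)
  fix z assume z: "z \<in> S"
  note d = assms(1)[unfolded hess_on_def, rule_format, OF z]
  show "(f has_derivative (\<lambda>h. fx z * fst h + fy z * snd h)) (at z)"
    "(fx has_derivative (\<lambda>h. fxx z * fst h + fxy z * snd h)) (at z)"
    "(fy has_derivative (\<lambda>h. fxy z * fst h + fyy z * snd h)) (at z)"
    using d by auto
qed (use assms(2) in auto)

context water_wave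
begin

lemma partials_continuous:
  assumes "C1_closure \<Omega> f"
  shows "continuous_on \<Omega> (partial_x f)" "continuous_on \<Omega> (partial_y f)"
proof -
  note ext = assms[unfolded C1_closure_def closure_\<Omega>, THEN conjunct2, THEN conjunct2]
  from ext[THEN conjunct1] ext[THEN conjunct2] obtain Fx Fy where F: "continuous_on \<Omega>c Fx" "\<forall>z\<in>\<Omega>. Fx z = partial_x f z"
    "continuous_on \<Omega>c Fy" "\<forall>z\<in>\<Omega>. Fy z = partial_y f z" by (elim exE conjE)
  have sub: "\<Omega> \<subseteq> \<Omega>c" using sub_\<Omega>c by blast
  show "continuous_on \<Omega> (partial_x f)" "continuous_on \<Omega> (partial_y f)"
    using continuous_on_cong[OF refl, of \<Omega> Fx "partial_x f"] continuous_on_cong[OF refl, of \<Omega> Fy "partial_y f"]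
      continuous_on_subset[OF F(1) sub] continuous_on_subset[OF F(3) sub] F(2,4) by auto
qed

text \<open>A connectedness argument in the strip \<open>p1 < p < 0\<close>. The set near whose
  points the height agrees with its reflection is open by definition, nonempty thanks to the
  extension by zero, and relatively closed by unique continuation in balls of the physical plane.
  The surface itself is reached as \<open>p\<close> tends to \<open>0\<close>.\<close>

lemma surface_symmetric_about_critical_line:
  assumes p1: "p1 \<in> {p0<..<0}" and lip: "C-lipschitz_on {p1..0} \<gamma>"
    and crit: "\<And>p. p \<in> {p0<..<0} \<Longrightarrow> a (\<mu>, p) = 0"
  shows "\<eta> (\<mu> + s) = \<eta> (\<mu> - s)"
proof -
  define R where "R z = (2 * \<mu> - fst z, snd z)" for z :: "real \<times> real"
  have R_fix: "R z = z" if "fst z = \<mu>" for z using that by (cases z) (simp add: R_def)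
  have contR: "continuous_on S R" for S unfolding R_def by (intro continuous_intros)
  \<comment> \<open>The domain and its mirror image may differ a priori; \<open>W\<close> is
    considered on their intersection.\<close>
  define \<Omega>2 where "\<Omega>2 = \<Omega> \<inter> R -` \<Omega>"
  have open2: "open \<Omega>2" unfolding \<Omega>2_def using contR open_\<Omega> by (intro open_Int open_vimage)
  define W where "W z = \<psi> z - \<psi> (R z)" for z
  define Wx where "Wx z = - v z - v (R z)" for z
  define Wy where "Wy z = u z - u (R z)" for z
  define Wxx where "Wxx z = - partial_x v z + partial_x v (R z)" for z
  define Wxy where "Wxy z = - partial_y v z - partial_y v (R z)" for z
  define Wyy where "Wyy z = partial_y u z - partial_y u (R z)" for z
  have hW: "hess_on \<Omega>2 W Wx Wy Wxx Wxy Wyy"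
    unfolding hess_on_def
  proof (intro ballI conjI)
    fix z assume "z \<in> \<Omega>2"
    then have z: "z \<in> \<Omega>" "R z \<in> \<Omega>" by (auto simp: \<Omega>2_def)
    have DR: "(R has_derivative (\<lambda>h. (- fst h, snd h))) (at z)"
      unfolding R_def by (auto intro!: derivative_eq_intros)
    note D\<psi> = has_derivative_diff[OF \<psi>_deriv[OF z(1)] has_derivative_compose[OF DR \<psi>_deriv[OF z(2)]]]
    note Dv = C1_closureD(2)[OF C1_v z(1)] has_derivative_compose[OF DR C1_closureD(2)[OF C1_v z(2)]]
    note Du = C1_closureD(2)[OF C1_u z(1)] has_derivative_compose[OF DR C1_closureD(2)[OF C1_u z(2)]]
    show "(W has_derivative (\<lambda>h. Wx z * fst h + Wy z * snd h)) (at z)"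
      unfolding W_def by (rule has_derivative_eq_rhs[OF D\<psi>]) (simp add: fun_eq_iff Wx_def Wy_def algebra_simps)
    show "(Wx has_derivative (\<lambda>h. Wxx z * fst h + Wxy z * snd h)) (at z)"
      unfolding Wx_def
      by (rule has_derivative_eq_rhs[OF has_derivative_diff[OF has_derivative_minus[OF Dv(1)] Dv(2)]])
        (simp add: fun_eq_iff Wxx_def Wxy_def algebra_simps)
    have inc: "partial_y v z = - partial_x u z" "partial_y v (R z) = - partial_x u (R z)"
      using incompressible z by (auto simp: eq_neg_iff_add_eq_0 add.commute)
    show "(Wy has_derivative (\<lambda>h. Wxy z * fst h + Wyy z * snd h)) (at z)"
      unfolding Wy_def
      by (rule has_derivative_eq_rhs[OF has_derivative_diff[OF Du]])
        (simp add: fun_eq_iff Wxy_def Wyy_def inc algebra_simps)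
  qed
  \<comment> \<open>Zero slope on the line means \<open>v = 0\<close> there, and so its vertical
    derivative vanishes as well. The other data of \<open>W\<close> vanish because the reflection
    fixes the line.\<close>
  have v0: "v z = 0" if z: "z \<in> \<Omega>" "fst z = \<mu>" for z
  proof -
    have "- \<psi> z \<in> {p0<..<0}" using z unfolding \<psi>_range_interior by blast
    from crit[OF this] have "v z / (u z - c) = 0"
      using \<Theta>_inverse[OF sub_\<Omega>c[OF z(1)]] z(2) by (simp add: a_def)
    then show ?thesis using u_lt[OF sub_\<Omega>c[OF z(1)]] by simp
  qed
  have vy0: "partial_y v z = 0" if z: "z \<in> \<Omega>" "fst z = \<mu>" for z
  proof -
    have zz: "z = (\<mu>, snd z)" using z(2) by (cases z) simp
    have "((\<lambda>s. v (\<mu>, s)) has_real_derivative partial_y v z) (at (snd z))"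
      using has_derivative_rowcol(2)[of v "partial_x v z" "partial_y v z" \<mu> "snd z"] C1_closureD(2)[OF C1_v z(1)] zz by simp
    moreover have "((\<lambda>s. v (\<mu>, s)) has_real_derivative 0) (at (snd z))"
    proof (rule has_field_derivative_transform_within_open[of "\<lambda>_. 0"])
      show "snd z \<in> {- d<..<\<eta> \<mu>}" using z by (auto simp: \<Omega>_iff)
      show "0 = v (\<mu>, s)" if "s \<in> {- d<..<\<eta> \<mu>}" for s using v0[of "(\<mu>, s)"] that by (simp add: \<Omega>_iff)
    qed auto
    ultimately show ?thesis by (rule DERIV_unique)
  qed
  have zero: "W z = 0 \<and> Wx z = 0 \<and> Wy z = 0 \<and> Wxx z = 0 \<and> Wxy z = 0 \<and> Wyy z = 0"
    if "z \<in> \<Omega>2" "fst z = \<mu>" for z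
    using that v0[of z] vy0[of z] R_fix[OF that(2)]
    by (simp add: \<Omega>2_def W_def Wx_def Wy_def Wxx_def Wxy_def Wyy_def)
  txt \<open>\<open>W\<close> has zero Cauchy data on the line, so it stays twice continuously differentiable when replaced
    by \<open>0\<close> on the left, where unique continuation can then start.\<close>
  let ?g = "\<lambda>k z. if fst z \<le> \<mu> then 0 else k z :: real"
  have hg: "hess_on \<Omega>2 (?g W) (?g Wx) (?g Wy) (?g Wxx) (?g Wxy) (?g Wyy)"
    by (rule hess_on_glue[OF hW zero])
  have cR: "continuous_on \<Omega>2 (\<lambda>z. k (R z))" if "continuous_on \<Omega> k" for k :: "real \<times> real \<Rightarrow> real"
    by (rule continuous_on_compose2[OF that contR]) (auto simp: \<Omega>2_def)
  have c0: "continuous_on \<Omega>2 k" if "continuous_on \<Omega> k" for k :: "real \<times> real \<Rightarrow> real"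
    using that by (rule continuous_on_subset) (auto simp: \<Omega>2_def)
  have cg: "continuous_on \<Omega>2 (?g Wxx)" "continuous_on \<Omega>2 (?g Wxy)" "continuous_on \<Omega>2 (?g Wyy)"
  proof -
    have "continuous_on \<Omega>2 Wxx" unfolding Wxx_def
      by (intro continuous_on_add continuous_on_minus c0 cR partials_continuous C1_v)
    then show "continuous_on \<Omega>2 (?g Wxx)" by (rule glue_continuous_on) (use zero in blast)
    have "continuous_on \<Omega>2 Wxy" unfolding Wxy_def
      by (intro continuous_on_diff continuous_on_minus c0 cR partials_continuous C1_v)
    then show "continuous_on \<Omega>2 (?g Wxy)" by (rule glue_continuous_on) (use zero in blast)
    have "continuous_on \<Omega>2 Wyy" unfolding Wyy_def
      by (intro continuous_on_diff c0 cR partials_continuous C1_u)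
    then show "continuous_on \<Omega>2 (?g Wyy)" by (rule glue_continuous_on) (use zero in blast)
  qed
  \<comment> \<open>Both the point and its mirror image lie on levels where \<gamma> is
    Lipschitz.\<close>
  define U where "U = {z \<in> \<Omega>2. - \<psi> z \<in> {p1<..<0} \<and> - \<psi> (R z) \<in> {p1<..<0}}"
  have \<psi>\<Omega>: "continuous_on \<Omega> (\<lambda>z. - \<psi> z)"
    by (intro continuous_on_minus continuous_on_subset[OF \<psi>_cont]) (use sub_\<Omega>c in blast)
  have openU: "open U"
  proof -
    have "open (\<Omega>2 \<inter> (\<lambda>z. - \<psi> z) -` {p1<..<0})"
      using continuous_open_preimage[OF c0[OF \<psi>\<Omega>] open2] by simp
    moreover have "open (\<Omega>2 \<inter> (\<lambda>z. - \<psi> (R z)) -` {p1<..<0})"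
      using continuous_open_preimage[OF cR[OF \<psi>\<Omega>] open2] by simp
    moreover have "U = (\<Omega>2 \<inter> (\<lambda>z. - \<psi> z) -` {p1<..<0}) \<inter> (\<Omega>2 \<inter> (\<lambda>z. - \<psi> (R z)) -` {p1<..<0})"
      by (auto simp: U_def)
    ultimately show ?thesis by (simp only: open_Int)
  qed
  have laplace: "\<bar>?g Wxx z + ?g Wyy z\<bar> \<le> C * \<bar>?g W z\<bar>" if z: "z \<in> U" for z
  proof (cases "fst z \<le> \<mu>")
    case False
    have mem: "z \<in> \<Omega>" "R z \<in> \<Omega>" "- \<psi> z \<in> {p1..0}" "- \<psi> (R z) \<in> {p1..0}" using z by (auto simp: U_def \<Omega>2_def)
    \<comment> \<open>The Laplacian of \<open>\<psi>\<close> is the vorticity and commutes with the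
      reflection, so the Lipschitz bound for \<gamma> becomes a bound by \<open>W\<close>
      itself.\<close>
    have "Wxx z + Wyy z = (partial_y u z - partial_x v z) - (partial_y u (R z) - partial_x v (R z))"
      by (simp add: Wxx_def Wyy_def)
    also have "\<dots> = \<gamma> (- \<psi> z) - \<gamma> (- \<psi> (R z))" using vorticity_eq mem by simp
    also have "\<bar>\<dots>\<bar> \<le> C * \<bar>- \<psi> z - - \<psi> (R z)\<bar>"
      using lipschitz_onD[OF lip mem(3,4)] by (simp add: dist_real_def)
    also have "\<bar>- \<psi> z - - \<psi> (R z)\<bar> = \<bar>W z\<bar>" by (simp add: W_def)
    finally show ?thesis using False by simp
  qed simp

  define S where "S = (UNIV \<times> {p1<..<0} :: (real \<times> real) set)"
  have S: "open S" "connected S" "S \<subseteq> UNIV \<times> {p0..0}" "S \<subseteq> UNIV \<times> {p0<..<0}"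
    unfolding S_def using p1 by (auto intro!: open_Times convex_connected convex_Times)
  have RS: "R z \<in> S \<longleftrightarrow> z \<in> S" for z by (cases z) (simp add: R_def S_def)
  have YS: "continuous_on S Y" and \<Theta>S: "continuous_on S \<Theta>"
    using continuous_on_subset[OF Y_cont S(3)] continuous_on_subset[OF \<Theta>_cont S(3)] by auto
  have \<Theta>\<Omega>: "\<Theta> z \<in> \<Omega> \<and> - \<psi> (\<Theta> z) = snd z" if "z \<in> S" for z
    using \<Theta>_interior[of z] \<Theta>[of z] that S(3,4) by auto
  \<comment> \<open>Points on or to the left of the line count as agreeing, in accordance with the
    extension of \<open>W\<close> by zero. The argument thus starts from an open set.\<close>
  define Eq where "Eq z \<longleftrightarrow> fst z \<le> \<mu> \<or> Y z = Y (R z)" for z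
  define A where "A = interior {z \<in> S. Eq z}"
  have A_sub: "z \<in> A \<Longrightarrow> z \<in> S \<and> Eq z" for z unfolding A_def using interior_subset by blast
  have left: "z \<in> A" if "z \<in> S" "fst z < \<mu>" for z
    unfolding A_def
  proof (rule interiorI)
    show "open (S \<inter> {w. fst w < \<mu>})" using S(1) by (intro open_Int open_Collect_less continuous_intros)
  qed (use that in \<open>auto simp: Eq_def\<close>)
  \<comment> \<open>At a limit point \<open>z\<close> of \<open>A\<close> the height equals that at
    the mirror point by continuity, so both physical points are interior and on the same level.
    Unique continuation spreads the zero from a nearby point of \<open>A\<close> to a full
    neighbourhood of \<open>z\<close>.\<close>
  have closed: "z \<in> A" if z: "z \<in> S" "z \<in> closure A" for z
  proof (cases "fst z < \<mu>")
    case True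
    then show ?thesis using left z by blast
  next
    case False
    have meets: "\<exists>w\<in>A. w \<in> V" if "open V" "z \<in> V" for V
      using open_Int_closure_eq_empty[OF that(1), of A] that(2) z(2) by blast
    have YR: "Y (R z) = Y z"
    proof (cases "fst z = \<mu>")
      case False
      show ?thesis
      proof (rule ccontr)
        assume ne: "Y (R z) \<noteq> Y z"
        have "continuous_on S (\<lambda>w. Y (R w) - Y w)"
          by (intro continuous_on_diff YS continuous_on_compose2[OF YS contR]) (use RS in auto)
        from continuous_open_preimage[OF this S(1) open_Compl[OF closed_singleton]]
        have "open (S \<inter> (\<lambda>w. Y (R w) - Y w) -` (- {0}))" .
        moreover have "open {w :: real \<times> real. \<mu> < fst w}" by (intro open_Collect_less continuous_intros)
        ultimately have "open (S \<inter> (\<lambda>w. Y (R w) - Y w) -` (- {0}) \<inter> {w. \<mu> < fst w})"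
          by (rule open_Int)
        moreover have "z \<in> S \<inter> (\<lambda>w. Y (R w) - Y w) -` (- {0}) \<inter> {w. \<mu> < fst w}"
          using z(1) ne False \<open>\<not> fst z < \<mu>\<close> by auto
        ultimately obtain w where "w \<in> A" "w \<in> S \<inter> (\<lambda>w. Y (R w) - Y w) -` (- {0}) \<inter> {w. \<mu> < fst w}"
          using meets by blast
        then show False using A_sub[of w] by (auto simp: Eq_def)
      qed
    qed (simp add: R_fix)
    define \<zeta> where "\<zeta> = \<Theta> z"
    have R\<zeta>: "R \<zeta> = \<Theta> (R z)" unfolding \<zeta>_def \<Theta>_def using YR by (simp add: R_def)
    have "\<zeta> \<in> U"
      using \<Theta>\<Omega>[OF z(1)] \<Theta>\<Omega>[of "R z"] RS[of z] z(1) unfolding U_def \<Omega>2_def \<zeta>_def[symmetric] R\<zeta>[symmetric]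
      by (auto simp: S_def R_def)
    then obtain r where r: "r > 0" "ball \<zeta> r \<subseteq> U" using openE[OF openU] by blast
    define V where "V = S \<inter> \<Theta> -` ball \<zeta> (r/4)"
    have openV: "open V" unfolding V_def using continuous_open_preimage[OF \<Theta>S S(1)] by simp
    have zV: "z \<in> V" using z(1) r(1) by (simp add: V_def \<zeta>_def)
    obtain z' where z': "z' \<in> A" "z' \<in> V" using meets[OF openV zV] by blast
    define \<zeta>' where "\<zeta>' = \<Theta> z'"
    \<comment> \<open>The ball of radius \<open>3 * r / 4\<close> about \<open>\<zeta>'\<close> fits
      between those of radii \<open>r / 4\<close> and \<open>r\<close> about \<open>\<zeta>\<close>:
      it inherits the differential inequality from the larger one and covers the smaller
      one.\<close>
    have d: "dist \<zeta> \<zeta>' < r / 4" using z'(2) by (simp add: V_def \<zeta>'_def)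
    have sub1: "ball \<zeta>' (3 * r / 4) \<subseteq> ball \<zeta> r"
    proof
      fix w assume "w \<in> ball \<zeta>' (3 * r / 4)"
      then show "w \<in> ball \<zeta> r" using dist_triangle[of \<zeta> w \<zeta>'] d by simp
    qed
    have sub2: "ball \<zeta> (r/4) \<subseteq> ball \<zeta>' (3 * r / 4)"
    proof
      fix w assume "w \<in> ball \<zeta> (r/4)"
      then show "w \<in> ball \<zeta>' (3 * r / 4)" using dist_triangle[of \<zeta>' w \<zeta>] d r(1) by (simp add: dist_commute)
    qed
    have subU: "ball \<zeta>' (3 * r / 4) \<subseteq> U" using sub1 r(2) by blast
    have sub\<Omega>2: "ball \<zeta>' (3 * r / 4) \<subseteq> \<Omega>2" using subU by (auto simp: U_def)
    have "open (\<Omega> \<inter> (\<lambda>w. (fst w, - \<psi> w)) -` A)"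
      by (rule continuous_open_preimage[OF continuous_on_Pair[OF _ \<psi>\<Omega>] open_\<Omega>])
        (auto intro!: continuous_intros simp: A_def)
    moreover have "\<zeta>' \<in> \<Omega> \<inter> (\<lambda>w. (fst w, - \<psi> w)) -` A"
      using \<Theta>\<Omega>[of z'] A_sub[OF z'(1)] z'(1) unfolding \<zeta>'_def by (simp add: \<Theta>_def)
    ultimately obtain \<epsilon> where \<epsilon>: "\<epsilon> > 0" "ball \<zeta>' \<epsilon> \<subseteq> \<Omega> \<inter> (\<lambda>w. (fst w, - \<psi> w)) -` A"
      using openE by blast
    have near: "?g W w = 0" if "w \<in> ball \<zeta>' \<epsilon>" for w
    proof (cases "fst w \<le> \<mu>")
      case False
      have w: "w \<in> \<Omega>" "(fst w, - \<psi> w) \<in> A" using \<epsilon>(2) that by auto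
      then have eq: "(fst w, - \<psi> w) \<in> S" "Y (fst w, - \<psi> w) = Y (R (fst w, - \<psi> w))"
        using A_sub[OF w(2)] False by (auto simp: Eq_def)
      then have "R w = \<Theta> (R (fst w, - \<psi> w))"
        using Y_unique[OF sub_\<Omega>c[OF w(1)]] by (simp add: \<Theta>_def R_def)
      then have "- \<psi> (R w) = - \<psi> w" using \<Theta>\<Omega>[of "R (fst w, - \<psi> w)"] RS[of "(fst w, - \<psi> w)"] eq(1) by (simp add: R_def)
      then show ?thesis by (simp add: W_def)
    qed simp
    have zeroB: "?g W w = 0" if w: "w \<in> ball \<zeta>' (3 * r / 4)" for w
      by (rule unique_continuation_ball[OF hess_on_subset[OF hg sub\<Omega>2] continuous_on_subset[OF cg(1) sub\<Omega>2]
            continuous_on_subset[OF cg(2) sub\<Omega>2] continuous_on_subset[OF cg(3) sub\<Omega>2] _ \<epsilon>(1) near w, of C])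
        (use subU laplace in blast)+
    have "V \<subseteq> {z \<in> S. Eq z}"
    proof
      fix w assume w: "w \<in> V"
      then have wS: "w \<in> S" and wB: "\<Theta> w \<in> ball \<zeta>' (3 * r / 4)" using sub2 by (auto simp: V_def)
      have "Eq w"
      proof (cases "fst w \<le> \<mu>")
        case False
        then have "W (\<Theta> w) = 0" using zeroB[OF wB] by (simp add: \<Theta>_def)
        then have "- \<psi> (R (\<Theta> w)) = snd w" using \<Theta>\<Omega>[OF wS] by (simp add: W_def)
        moreover have "R (\<Theta> w) \<in> \<Omega>" using wB sub\<Omega>2 by (auto simp: \<Omega>2_def)
        ultimately have "Y (fst (R (\<Theta> w)), snd w) = snd (R (\<Theta> w))" using Y_unique[OF sub_\<Omega>c] by metis
        then show ?thesis by (simp add: Eq_def R_def \<Theta>_def)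
      qed (simp add: Eq_def)
      then show "w \<in> {z \<in> S. Eq z}" using wS by simp
    qed
    then show ?thesis unfolding A_def using interiorI[OF openV zV] by blast
  qed
  have "A \<inter> S = {} \<or> (- closure A) \<inter> S = {}"
  proof (rule connectedD[OF S(2)])
    show "A \<inter> - closure A \<inter> S = {}" using closure_subset by blast
    show "S \<subseteq> A \<union> - closure A" using closed by blast
  qed (auto simp: A_def)
  moreover have "(\<mu> - 1, p1 / 2) \<in> A" using p1 by (intro left) (auto simp: S_def)
  then have "A \<inter> S \<noteq> {}" using A_sub by blast
  ultimately have all: "z \<in> A" if "z \<in> S" for z using closed that by blast
  have main: "\<eta> q = \<eta> (2 * \<mu> - q)" if "\<mu> < q" for q
  proof -
    have eq: "Y (q, p) = Y (2 * \<mu> - q, p)" if "p \<in> {p1<..<0}" for p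
      using A_sub[OF all[of "(q, p)"]] that \<open>\<mu> < q\<close> by (simp add: S_def Eq_def R_def)
    have "Y (q, 0) \<le> Y (2 * \<mu> - q, 0)" "Y (2 * \<mu> - q, 0) \<le> Y (q, 0)"
      by (rule column_limit[of p1]; use eq p1 in simp)+
    then show ?thesis by (simp add: Y_top)
  qed
  consider "s = 0" | "0 < s" | "s < 0" by linarith
  then show ?thesis
  proof cases
    case 2
    then show ?thesis using main[of "\<mu> + s"] by simp
  next
    case 3
    then show ?thesis using main[of "\<mu> - s"] by simp
  qed simp
qed

end

section \<open>Symmetric profiles with one crest per period\<close>

text \<open>The reflections in \<open>x0\<close> and \<open>x0 + l\<close> compose to a shift by
  \<open>T = 2 * l\<close>. Up to periods every point is \<open>x0 + r\<close> or
  \<open>x0 - r\<close> with \<open>r\<close> between \<open>0\<close> and \<open>l\<close>, so all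
  questions reduce to the increasing function \<open>G\<close> on that interval.\<close>

lemma symmetric_single_crestI:
  fixes F :: "real \<Rightarrow> real"
  assumes l: "0 < l" and sym0: "\<And>s. F (x0 + s) = F (x0 - s)" and sym1: "\<And>s. F (x0 + l + s) = F (x0 + l - s)"
    and mono: "strict_mono_on {x0..x0 + l} F"
  shows "symmetric_single_crest F"
proof -
  define T where "T = 2 * l"
  have T: "0 < T" using l by (simp add: T_def)
  have per: "F (x + T) = F x" for x
    using sym1[of "l + (x - x0)"] sym0[of "x - x0"] by (simp add: T_def algebra_simps)
  have perk: "F (x + of_int k * T) = F x" for x k using per by (rule periodic_shift)
  define G where "G r = F (x0 + r)" for r
  have G: "F (x0 + r + of_int k * T) = G r" "F (x0 - r + of_int k * T) = G r" for r k
    using perk sym0[of r] by (auto simp: G_def)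
  have Gmono: "G r < G s" if "0 \<le> r" "r < s" "s \<le> l" for r s
    unfolding G_def using that by (intro strict_mono_onD[OF mono]) auto
  have rep: "\<exists>k r. 0 \<le> r \<and> r \<le> l \<and> (x = x0 + r + of_int k * T \<or> x = x0 - r + of_int k * T)" for x
  proof -
    obtain k where k: "x + of_int k * T \<in> {x0 - l..<x0 - l + T}" using periodic_reduce[OF T] .
    define r where "r = x + of_int k * T - x0"
    have r: "- l \<le> r" "r < l" using k by (auto simp: r_def T_def)
    have x: "x = x0 + r + of_int (- k) * T" by (simp add: r_def)
    show ?thesis
    proof (cases "0 \<le> r")
      case True
      then show ?thesis using r x by (intro exI[of _ "- k"] exI[of _ r]) auto
    next
      case False
      then show ?thesis using r x by (intro exI[of _ "- k"] exI[of _ "- r"]) auto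
    qed
  qed
  have bounds: "G 0 \<le> F x" "F x \<le> G l" for x
  proof -
    obtain k r where r: "0 \<le> r" "r \<le> l" "x = x0 + r + of_int k * T \<or> x = x0 - r + of_int k * T" using rep by blast
    then have "F x = G r" using G by auto
    moreover have "G 0 \<le> G r" using Gmono[of 0 r] r by (cases "r = 0") auto
    moreover have "G r \<le> G l" using Gmono[of r l] r by (cases "r = l") auto
    ultimately show "G 0 \<le> F x" "F x \<le> G l" by auto
  qed
  have trough_at: "is_trough F (x0 + of_int k * T)" for k
    using bounds(1) G(1)[of 0 k] by (simp add: is_trough_def)
  have crest_at: "is_crest F (x0 + l + of_int k * T)" for k
    using bounds(2) G(1)[of l k] by (simp add: is_crest_def)
  \<comment> \<open>The sign \<sigma> selects the ascending or the descending branch; on either one,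
    smaller and larger values occur arbitrarily close to an inner point.\<close>
  have slope: "\<not> is_crest F x \<and> \<not> is_trough F x"
    if r: "0 < r" "r < l" and x: "x = x0 + \<sigma> * r + of_int k * T" and \<sigma>: "\<sigma> = 1 \<or> \<sigma> = - 1" for x r k \<sigma>
  proof -
    have val: "F (x0 + \<sigma> * t + of_int k * T) = G t" for t using G[of t k] \<sigma> by auto
    have ex: "\<exists>t. 0 < t \<and> t < e \<and> 0 < r - t \<and> r + t < l" if "e > 0" for e :: real
      using r that by (intro exI[of _ "min e (min r (l - r)) / 2"]) (auto simp: min_def field_simps)
    have near: "\<exists>y z. dist y x < e \<and> dist z x < e \<and> F y < F x \<and> F x < F z" if e: "e > 0" for e
    proof -
      obtain t where t: "0 < t" "t < e" "0 < r - t" "r + t < l" using ex[OF e] by blast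
      have "F (x0 + \<sigma> * (r - t) + of_int k * T) < F x" "F x < F (x0 + \<sigma> * (r + t) + of_int k * T)"
        unfolding x val using t r by (auto intro!: Gmono)
      moreover have "dist (x0 + \<sigma> * (r - t) + of_int k * T) x < e" "dist (x0 + \<sigma> * (r + t) + of_int k * T) x < e"
        using t \<sigma> by (auto simp: x dist_real_def algebra_simps)
      ultimately show ?thesis by blast
    qed
    show ?thesis
      unfolding is_crest_def is_trough_def eventually_nhds_metric using near by (meson not_le)
  qed
  have crest_trough: "(is_crest F x \<longleftrightarrow> (\<exists>k. x = x0 + l + of_int k * T)) \<and> (is_trough F x \<longleftrightarrow> (\<exists>k. x = x0 + of_int k * T))" for x
  proof -
    obtain k r where r: "0 \<le> r" "r \<le> l" "x = x0 + r + of_int k * T \<or> x = x0 - r + of_int k * T" using rep by blast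
    obtain \<sigma> where \<sigma>: "\<sigma> = 1 \<or> \<sigma> = - 1" "x = x0 + \<sigma> * r + of_int k * T"
      using r(3) by (metis diff_conv_add_uminus mult_1 mult_minus1)
    have ctl: "\<not> is_trough F (x0 + l + of_int j * T)" for j
    proof
      assume "is_trough F (x0 + l + of_int j * T)"
      then obtain e where e: "e > 0" "\<And>y. dist y (x0 + l + of_int j * T) < e \<Longrightarrow> F (x0 + l + of_int j * T) \<le> F y"
        unfolding is_trough_def eventually_nhds_metric by blast
      define t where "t = min e l / 2"
      have t: "0 < t" "t < e" "t < l" using e l by (auto simp: t_def)
      have "F (x0 + l + of_int j * T) \<le> F (x0 + (l - t) + of_int j * T)"
        using t by (intro e(2)) (simp add: dist_real_def)
      then show False unfolding G using Gmono[of "l - t" l] t by simp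
    qed
    have ctt: "\<not> is_crest F (x0 + of_int j * T)" for j
    proof
      assume "is_crest F (x0 + of_int j * T)"
      then obtain e where e: "e > 0" "\<And>y. dist y (x0 + of_int j * T) < e \<Longrightarrow> F y \<le> F (x0 + of_int j * T)"
        unfolding is_crest_def eventually_nhds_metric by blast
      define t where "t = min e l / 2"
      have t: "0 < t" "t < e" "t < l" using e l by (auto simp: t_def)
      have "F (x0 + t + of_int j * T) \<le> F (x0 + of_int j * T)"
        using t by (intro e(2)) (simp add: dist_real_def)
      then show False using G(1)[of t j] G(1)[of 0 j] Gmono[of 0 t] t by simp
    qed
    consider "r = 0" | "r = l" | "0 < r" "r < l" using r by fastforce
    then show ?thesis
    proof cases
      case 1
      then have "x = x0 + of_int k * T" using \<sigma> by simp
      then show ?thesis using trough_at crest_at ctt by blast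
    next
      case 2
      \<comment> \<open>On the descending branch \<open>x0 - l\<close> is the crest
        \<open>x0 + l\<close> shifted back by one period, hence the index
        \<open>k - 1\<close>.\<close>
      have "x = x0 + l + of_int k * T \<or> x = x0 + l + of_int (k - 1) * T"
        using \<sigma> 2 by (auto simp: T_def algebra_simps)
      then show ?thesis using trough_at crest_at ctl by blast
    next
      case 3
      then show ?thesis using slope[OF 3 \<sigma>(2,1)] trough_at crest_at by blast
    qed
  qed
  have crestD: "\<exists>k. x = x0 + l + of_int k * T" if "is_crest F x" for x using crest_trough[of x] that by simp
  have troughD: "\<exists>k. x = x0 + of_int k * T" if "is_trough F x" for x using crest_trough[of x] that by simp
  have unique: "\<exists>!x. x \<in> {a..<a + T} \<and> (\<exists>k. x = y + of_int k * T)" for a y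
  proof -
    obtain k where k: "y + of_int k * T \<in> {a..<a + T}" using periodic_reduce[OF T] .
    show ?thesis
    proof (rule ex1I[of _ "y + of_int k * T"])
      fix x assume "x \<in> {a..<a + T} \<and> (\<exists>k. x = y + of_int k * T)"
      then obtain j where j: "x = y + of_int j * T" "x \<in> {a..<a + T}" by blast
      define n where "n = j - k"
      have "\<bar>of_int j * T - of_int k * T\<bar> < T" using j k by auto
      then have "\<bar>of_int n * T\<bar> < 1 * T" by (simp add: n_def left_diff_distrib)
      then have "\<bar>real_of_int n\<bar> < 1" using T by (simp only: abs_mult abs_of_pos mult_less_cancel_right_pos)
      then have "n = 0" by (simp only: of_int_abs[symmetric] of_int_less_1_iff)
      then have "j = k" by (simp add: n_def)
      then show "x = y + of_int k * T" using j by simp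
    qed (use k in auto)
  qed
  have symk: "symmetric_about F (y + of_int k * T)" if "\<And>s. F (y + s) = F (y - s)" for y k
    unfolding symmetric_about_def
  proof
    fix s
    have "F (y + of_int k * T + s) = F (y + s)" using perk[of "y + s" k] by (simp add: add_ac)
    moreover have "F (y + of_int k * T - s) = F (y - s)" using perk[of "y - s" k] by (simp add: algebra_simps)
    ultimately show "F (y + of_int k * T + s) = F (y + of_int k * T - s)" using that by simp
  qed
  \<comment> \<open>Used with base \<open>y = x0\<close> for a trough followed by a crest, and with
    base \<open>y = x0 + l\<close> for a crest followed by a trough, since \<open>x0 + l + l\<close>
    is \<open>x0\<close> up to a period.\<close>
  have gap: "b = a + l"
    if ab: "a < b" "a = y + of_int k * T" "b = y + l + of_int j * T"
      and no: "\<And>x. a < x \<Longrightarrow> x < b \<Longrightarrow> x \<noteq> y + l + of_int k * T" for a b y k j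
  proof -
    have "\<not> a + l < b" using no[of "a + l"] ab l by auto
    define n where "n = j - k"
    have b_eq: "b = a + l + of_int n * T" using ab by (simp add: n_def algebra_simps)
    then have "- l < of_int n * T" using ab(1) by linarith
    then have "- 1 * T < of_int n * T" using l T_def by linarith
    then have "- 1 < real_of_int n" using T by (simp only: mult_less_cancel_right_pos)
    then have "real_of_int (- 1) < real_of_int n" by simp
    then have "- 1 < n" by (simp only: of_int_less_iff)
    then have "0 \<le> real_of_int n" by simp
    then have "0 \<le> of_int n * T" using T by simp
    then have "a + l \<le> b" using b_eq by simp
    with \<open>\<not> a + l < b\<close> show ?thesis by simp
  qed
  show ?thesis
    unfolding symmetric_single_crest_def
  proof (intro conjI exI[of _ T] allI impI; (elim conjE disjE)?)
    show "is_minimal_period F T"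
      unfolding is_minimal_period_def
    proof (intro conjI allI impI T per, elim conjE)
      fix T' assume T': "0 < T'" "\<forall>x. F (x + T') = F x"
      \<comment> \<open>A period moves the trough \<open>x0\<close> to another trough, and those lie
        at distances that are multiples of \<open>T\<close>.\<close>
      have "is_trough F (x0 + T')" using bounds(1) T'(2)[rule_format, of x0] by (simp add: is_trough_def G_def)
      then obtain k where k: "x0 + T' = x0 + of_int k * T" using crest_trough by blast
      then have "0 < of_int k * T" using T' by simp
      then have "1 \<le> real_of_int k" using T by (simp add: zero_less_mult_iff)
      then have "1 * T \<le> of_int k * T" using T by (intro mult_right_mono) auto
      then show "T \<le> T'" using k by simp
    qed
    show "\<exists>!x. x \<in> {a..<a + T} \<and> is_crest F x" for a using unique[of a "x0 + l"] crest_trough by simp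
    show "\<exists>!x. x \<in> {a..<a + T} \<and> is_trough F x" for a using unique[of a x0] crest_trough by simp
    show "symmetric_about F a" if ct: "is_crest F a" for a
    proof -
      obtain k where k: "a = x0 + l + of_int k * T" using crestD[OF ct] by blast
      show ?thesis unfolding k by (rule symk) (rule sym1)
    qed
    show "symmetric_about F a" if ct: "is_trough F a" for a
    proof -
      obtain k where k: "a = x0 + of_int k * T" using troughD[OF ct] by blast
      show ?thesis unfolding k by (rule symk) (rule sym0)
    qed
  next
    fix a b assume ab: "a < b" "\<forall>x\<in>{a<..<b}. \<not> is_crest F x \<and> \<not> is_trough F x" "is_crest F a" "is_trough F b"
    obtain k j where k: "a = x0 + l + of_int k * T" and j: "b = x0 + of_int j * T"
      using crestD[OF ab(3)] troughD[OF ab(4)] by blast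
    have "b = a + l"
    proof (rule gap[OF ab(1) k])
      show "b = x0 + l + l + of_int (j - 1) * T" by (simp add: j T_def algebra_simps)
      fix x assume x: "a < x" "x < b"
      have "x0 + l + l + of_int k * T = x0 + of_int (k + 1) * T" by (simp add: T_def algebra_simps)
      then show "x \<noteq> x0 + l + l + of_int k * T" using ab(2) x trough_at[of "k + 1"] by auto
    qed
    show "strict_antimono_on {a..b} F"
    proof (rule monotone_onI)
      fix x y assume xy: "x \<in> {a..b}" "y \<in> {a..b}" "x < y"
      have val: "F z = G (l - (z - a))" for z
        using perk[of "x0 + l + (z - a)" k] sym1[of "z - a"] by (simp add: G_def k algebra_simps)
      show "F y < F x" unfolding val using xy \<open>b = a + l\<close> by (intro Gmono) auto
    qed
  next
    fix a b assume ab: "a < b" "\<forall>x\<in>{a<..<b}. \<not> is_crest F x \<and> \<not> is_trough F x" "is_trough F a" "is_crest F b"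
    obtain k j where k: "a = x0 + of_int k * T" and j: "b = x0 + l + of_int j * T"
      using troughD[OF ab(3)] crestD[OF ab(4)] by blast
    have "b = a + l"
      by (rule gap[OF ab(1) k j]) (use ab(2) crest_at[of k] in auto)
    show "strict_mono_on {a..b} F"
    proof (rule strict_mono_onI)
      fix x y assume xy: "x \<in> {a..b}" "y \<in> {a..b}" "x < y"
      have val: "F z = G (z - a)" for z
        using perk[of "x0 + (z - a)" k] by (simp add: G_def k algebra_simps)
      show "F x < F y" unfolding val using xy \<open>b = a + l\<close> by (intro Gmono) auto
    qed
  qed
qed

section \<open>A monotone half period from a symmetric profile\<close>

lemma is_crest_affine:
  fixes F :: "real \<Rightarrow> real"
  assumes "is_crest F c" and F: "\<And>y. F (\<sigma> * y + \<tau>) = F y" and \<sigma>: "\<sigma> = 1 \<or> \<sigma> = - 1"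
  shows "is_crest F (\<sigma> * c + \<tau>)"
proof -
  obtain e where e: "e > 0" "\<And>y. dist y c < e \<Longrightarrow> F y \<le> F c"
    using assms(1) unfolding is_crest_def eventually_nhds_metric by blast
  have "F y \<le> F (\<sigma> * c + \<tau>)" if "dist y (\<sigma> * c + \<tau>) < e" for y
  proof -
    have "F y = F (\<sigma> * (\<sigma> * (y - \<tau>)) + \<tau>)" using \<sigma> by auto
    also have "\<dots> = F (\<sigma> * (y - \<tau>))" by (rule F)
    also have "\<dots> \<le> F c" using \<sigma> that by (intro e(2)) (auto simp: dist_real_def)
    finally show ?thesis by (simp add: F)
  qed
  then show ?thesis unfolding is_crest_def eventually_nhds_metric using e(1) by blast
qed

text \<open>Mirroring the crest in the trough and shifting by a period gives a crest again. Were the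
  crest in the first half of the period after the trough, this would be a second one, so the profile
  increases on at least half a period.\<close>

lemma symmetric_single_crestE:
  assumes "symmetric_single_crest F"
  obtains x0 T where "0 < T" "\<And>x. F (x + T) = F x" "\<And>s. F (x0 + s) = F (x0 - s)"
    "strict_mono_on {x0..x0 + T / 2} F"
proof -
  note single = assms[unfolded symmetric_single_crest_def]
  obtain T where T: "is_minimal_period F T"
    and u: "\<forall>a. (\<exists>!x. x \<in> {a..<a + T} \<and> is_crest F x) \<and> (\<exists>!x. x \<in> {a..<a + T} \<and> is_trough F x)"
    using single by (elim conjE exE) (rule that)
  have uc: "\<exists>!x. x \<in> {a..<a + T} \<and> is_crest F x" and ut: "\<exists>!x. x \<in> {a..<a + T} \<and> is_trough F x" for a
    using u[THEN spec, of a] by auto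
  have sym: "symmetric_about F a" if "is_trough F a" for a
    using single[THEN conjunct2, THEN conjunct1] that by blast
  note mono = single[THEN conjunct2, THEN conjunct2, rule_format, THEN conjunct2, rule_format]
  have T0: "0 < T" and per: "\<And>x. F (x + T) = F x" using T unfolding is_minimal_period_def by auto
  obtain x0 where x0: "is_trough F x0" using ut[of 0] by blast
  obtain x1 where x1: "x1 \<in> {x0..<x0 + T}" "is_crest F x1" using uc[of x0] by blast
  have sym0: "F (x0 + s) = F (x0 - s)" for s using sym[of x0] x0 unfolding symmetric_about_def by blast
  have trough_unique: "x = x0" if "x \<in> {x0..<x0 + T}" "is_trough F x" for x
    using ut[of x0] that x0 T0 by (metis atLeastLessThan_iff less_add_same_cancel1 order_refl)
  have crest_unique: "x = x1" if "x \<in> {x0..<x0 + T}" "is_crest F x" for x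
    using uc[of x0] that x1 by blast
  \<comment> \<open>A point that is both crest and trough has a neighbourhood on which the profile
    is constant, so a second trough would lie in the same period.\<close>
  have "x1 \<noteq> x0"
  proof
    assume "x1 = x0"
    then have "is_crest F x0" using x1 by simp
    then obtain e where e: "e > 0" "\<And>y. dist y x0 < e \<Longrightarrow> F y \<le> F x0"
      unfolding is_crest_def eventually_nhds_metric by blast
    obtain e' where e': "e' > 0" "\<And>y. dist y x0 < e' \<Longrightarrow> F x0 \<le> F y"
      using x0 unfolding is_trough_def eventually_nhds_metric by blast
    define t where "t = min (min e e') T / 2"
    have t: "0 < t" "2 * t \<le> e" "2 * t \<le> e'" "2 * t \<le> T" using e e' T0 by (auto simp: t_def)
    have "F (x0 + t) \<le> F y" if "dist y (x0 + t) < t" for y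
    proof -
      have "dist y x0 < e'" "dist (x0 + t) x0 < e" using that t by (auto simp: dist_real_def)
      then show ?thesis using e(2) e'(2) by fastforce
    qed
    then have "is_trough F (x0 + t)" unfolding is_trough_def eventually_nhds_metric using t(1) by blast
    then have "x0 + t = x0" using t by (intro trough_unique) auto
    then show False using t by simp
  qed
  then have lt: "x0 < x1" using x1 by simp
  have "strict_mono_on {x0..x1} F"
  proof (rule mono[OF conjI[OF lt] conjI[OF x0 x1(2)]], intro ballI conjI notI)
    fix x assume x: "x \<in> {x0<..<x1}"
    show False if "is_crest F x" using crest_unique[of x] that x x1 by auto
    show False if "is_trough F x" using trough_unique[of x] that x x1 by auto
  qed
  moreover have "x0 + T / 2 \<le> x1"
  proof (rule ccontr)
    assume less: "\<not> x0 + T / 2 \<le> x1"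
    have "is_crest F (- 1 * x1 + (2 * x0 + T))"
    proof (rule is_crest_affine[OF x1(2)])
      fix y
      have "F (- 1 * y + (2 * x0 + T)) = F (x0 + (x0 - y))" using per[of "2 * x0 - y"] by (simp add: algebra_simps)
      also have "\<dots> = F y" using sym0[of "x0 - y"] by simp
      finally show "F (- 1 * y + (2 * x0 + T)) = F y" .
    qed simp
    then have "- 1 * x1 + (2 * x0 + T) = x1" using less lt by (intro crest_unique) auto
    then show False using less by simp
  qed
  then have "{x0..x0 + T / 2} \<subseteq> {x0..x1}" by simp
  ultimately have "strict_mono_on {x0..x0 + T / 2} F" by (rule monotone_on_subset)
  then show ?thesis using that T0 per sym0 by blast
qed

theorem theorem2p1:
  fixes g c P0 d L p0 :: real
    and \<eta> \<gamma> :: "real \<Rightarrow> real"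
    and u v P \<psi> :: "real \<times> real \<Rightarrow> real"
  assumes "g > 0" and "d > 0"
    and "steady_water_wave g c P0 d L \<eta> u v P"
    and "is_stream_function c d L \<eta> u v \<psi>"
    and "is_relative_mass_flux d \<psi> p0"
    and "is_vorticity_function d \<eta> u v \<psi> p0 \<gamma>"
    and "\<not> \<eta> constant_on UNIV"
    and "\<exists>p1\<in>{p0<..<0}. \<exists>C. C-lipschitz_on {p1..0} \<gamma>"
  shows "symmetric_single_crest \<eta> \<longleftrightarrow> (\<exists>x0. particles_lowest_on_line c d \<eta> u v x0)"
proof -
  obtain p1 C where p1: "p1 \<in> {p0<..<0}" and lip: "C-lipschitz_on {p1..0} \<gamma>" using assms(8) by blast
  interpret water_wave g c P0 d L p0 \<eta> \<gamma> u v P \<psi>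
    using assms(1-6) p1 by unfold_locales auto
  obtain m M Q where mM: "strip_problem p0 m M g"
    and sol: "strip_problem.height_sol p0 m M g Q \<gamma> Y a b hqq hqp hpp"
    by (rule Y_height_sol)
  interpret S: strip_problem p0 m M g Q \<gamma> by (rule mM)
  show ?thesis
  proof
    assume "symmetric_single_crest \<eta>"
    then obtain x0 T where T: "0 < T" "\<And>x. \<eta> (x + T) = \<eta> x" and sym: "\<And>s. \<eta> (x0 + s) = \<eta> (x0 - s)"
      and mono: "strict_mono_on {x0..x0 + T / 2} \<eta>"
      by (rule symmetric_single_crestE) (rule that)
    \<comment> \<open>The flow is translated so that the distinguished line becomes
      \<open>q = 0\<close>.\<close>
    have sol': "S.height_sol (\<lambda>z. Y (x0 + fst z, snd z)) (\<lambda>z. a (x0 + fst z, snd z)) (\<lambda>z. b (x0 + fst z, snd z))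
       (\<lambda>z. hqq (x0 + fst z, snd z)) (\<lambda>z. hqp (x0 + fst z, snd z)) (\<lambda>z. hpp (x0 + fst z, snd z))"
      using S.height_sol_affine[OF sol, of 1 x0] by simp
    have "Y (x0 + 0, p) \<le> Y (x0 + q, p)" if p: "p \<in> {p0..0}" for q p
    proof -
      have "(\<lambda>z. Y (x0 + fst z, snd z)) (0, p) \<le> (\<lambda>z. Y (x0 + fst z, snd z)) (q, p)"
      proof (rule S.lowest_line_of_monotone_surface[OF sol' L _ _ T(1) _ _ _ p])
        show "Y (x0 + fst (q + L, p), snd (q + L, p)) = Y (x0 + fst (q, p), snd (q, p))" if "p \<in> {p0..0}" for q p
          using Y_per[OF that, of "x0 + q"] by (simp add: add.assoc)
        show "Y (x0 + fst (q, p0), snd (q, p0)) = - d" for q by (simp add: Y_bottom)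
        show "Y (x0 + fst (q + T, 0), snd (q + T, 0)) = Y (x0 + fst (q, 0), snd (q, 0))" for q
          using T(2)[of "x0 + q"] by (simp add: Y_top add.assoc)
        show "Y (x0 + fst (- s, 0), snd (- s, 0)) = Y (x0 + fst (s, 0), snd (s, 0))" for s
          using sym[of s] by (simp add: Y_top)
        show "Y (x0 + fst (s, 0), snd (s, 0)) \<le> Y (x0 + fst (t, 0), snd (t, 0))" if "0 \<le> s" "s \<le> t" "t \<le> T / 2" for s t
          using strict_mono_onD[OF mono, of "x0 + s" "x0 + t"] that by (cases "s = t") (auto simp: Y_top)
      qed
      then show ?thesis by simp
    qed
    from this[of _ "_ - x0"] have "\<forall>q. \<forall>p\<in>{p0..0}. Y (x0, p) \<le> Y (q, p)"
      by (metis add_0_right add.commute diff_add_cancel)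
    then show "\<exists>x0. particles_lowest_on_line c d \<eta> u v x0" unfolding lowest_on_line_iff by blast
  next
    assume "\<exists>x0. particles_lowest_on_line c d \<eta> u v x0"
    then obtain x0 where low: "\<And>q p. p \<in> {p0..0} \<Longrightarrow> Y (x0, p) \<le> Y (q, p)" unfolding lowest_on_line_iff by blast
    have sol': "S.height_sol (\<lambda>z. Y (x0 + fst z, snd z)) (\<lambda>z. a (x0 + fst z, snd z)) (\<lambda>z. b (x0 + fst z, snd z))
       (\<lambda>z. hqq (x0 + fst z, snd z)) (\<lambda>z. hqp (x0 + fst z, snd z)) (\<lambda>z. hpp (x0 + fst z, snd z))"
      using S.height_sol_affine[OF sol, of 1 x0] by simp
    obtain x2 where x2: "\<eta> x2 \<noteq> \<eta> x0" using assms(7) unfolding constant_on_def by blast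
    define H where "H z = Y (x0 + fst z, snd z)" for z
    have "\<exists>l>0. (\<forall>s. H (l + s, 0) = H (l - s, 0)) \<and> (\<forall>s. H (s, 0) = H (- s, 0)) \<and>
      strict_mono_on {0..l} (\<lambda>q. H (q, 0))"
    proof (rule S.moving_planes[OF sol'[folded H_def] L])
      show "H (q + L, p) = H (q, p)" if "p \<in> {p0..0}" for q p
        using Y_per[OF that, of "x0 + q"] by (simp add: H_def add.assoc)
      show "H (q, p0) = - d" for q by (simp add: H_def Y_bottom)
      show "H (0, p) \<le> H (q, p)" if "p \<in> {p0..0}" for q p using low[OF that] by (simp add: H_def)
      show "H (x2 - x0, 0) \<noteq> H (0, 0)" using x2 by (simp add: H_def Y_top)
      \<comment> \<open>A critical line \<mu> of the translated height is the critical line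
        \<open>x0 + \<mu>\<close> of the flow, where unique continuation applies.\<close>
      show "\<forall>s. H (\<mu> + s, 0) = H (\<mu> - s, 0)"
        if "\<And>p. p \<in> {p0<..<0} \<Longrightarrow> a (x0 + fst (\<mu>, p), snd (\<mu>, p)) = 0" for \<mu>
        using surface_symmetric_about_critical_line[OF p1 lip, of "x0 + \<mu>"] that
        by (simp add: H_def Y_top add.assoc add_diff_eq)
    qed
    then obtain l where l: "l > 0" "\<And>s. \<eta> (x0 + (l + s)) = \<eta> (x0 + (l - s))" "\<And>s. \<eta> (x0 + s) = \<eta> (x0 + - s)"
      "strict_mono_on {0..l} (\<lambda>q. \<eta> (x0 + q))"
      unfolding H_def Y_top fst_conv snd_conv by blast
    show "symmetric_single_crest \<eta>"
    proof (rule symmetric_single_crestI[OF l(1)])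
      show "\<eta> (x0 + s) = \<eta> (x0 - s)" for s using l(3)[of s] by simp
      show "\<eta> (x0 + l + s) = \<eta> (x0 + l - s)" for s using l(2)[of s] by (simp add: add.assoc add_diff_eq)
      show "strict_mono_on {x0..x0 + l} \<eta>"
      proof (rule strict_mono_onI)
        fix x y assume "x \<in> {x0..x0 + l}" "y \<in> {x0..x0 + l}" "x < y"
        then show "\<eta> x < \<eta> y" using strict_mono_onD[OF l(4), of "x - x0" "y - x0"] by auto
      qed
    qed
  qed
qed

end
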